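(* Let $f\colon M^n\to\mathbb{R}^{n+1}$, $n\geq 3$, be an isometric immersion of a simply connected Riemannian manifold, with Gauss map $N$ and corresponding shape operator $A$. Let $0\neq\mathcal{B}\in\Gamma(\mathrm{End}(TM))$ be a symmetric tensor and $\rho\in C^\infty(M)$ such that $$\mathcal{B}X\wedge AY-\mathcal{B}Y\wedge AX+X\wedge HY-Y\wedge HX=0$$ and $$(\nabla_X\mathcal{B})Y-(\nabla_Y\mathcal{B})X+(X\wedge Y)A\nabla\rho=0$$ for all $X,Y\in\mathfrak{X}(M)$. Then $\mathcal{B}$ and $\rho$ determine a unique conformal infinitesimal bending of $f$ (conformal infinitesimal bendings being identified when they differ by a trivial one). That is: there is a conformal infinitesimal bending of $f$ whose associated tensor $\mathcal{B}'$ has the form $\mathcal{B}'=\mathcal{B}+\varphi I$ for some $\varphi\in C^\infty(M)$, and any two conformal infinitesimal bendings of $f$ with this property differ by a trivial conformal infinitesimal bending.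
   Context: $\nabla$ is the Levi-Civita connection of $M^n$, $\tilde\nabla$ the flat connection of $\mathbb{R}^{n+1}$, $N$ is a smooth unit normal vector field along $f$, and $\langle AX,Y\rangle=\langle\alpha(X,Y),N\rangle$ where $\alpha$ is the second fundamental form of $f$. $HX=\nabla_X\nabla\rho$, where $\nabla\rho$ is the gradient of $\rho$. The wedge convention is $(X\wedge Y)Z=\langle Y,Z\rangle X-\langle X,Z\rangle Y$. A conformal infinitesimal bending of $f$ with conformal factor $\rho\in C^\infty(M)$ is a smooth section $\mathcal{T}\in\Gamma(f^*T\mathbb{R}^{n+1})$ with $\langle\tilde\nabla_X\mathcal{T},f_*Y\rangle+\langle f_*X,\tilde\nabla_Y\mathcal{T}\rangle=2\rho\langle X,Y\rangle$ for all $X,Y\in\mathfrak{X}(M)$. It is trivial if it is locally the restriction to the submanifold of a conformal Killing vector field of $\mathbb{R}^{n+1}$, i.e. locally $\mathcal{T}(x)=(\langle f(x),v\rangle+\lambda)f(x)-\frac12\|f(x)\|^2v+\mathcal{D}f(x)+w$ with $\lambda\in\mathbb{R}$, $v,w\in\mathbb{R}^{n+1}$ and $\mathcal{D}\in\mathrm{End}(\mathbb{R}^{n+1})$ skew-symmetric. The (symmetric) tensor associated to a conformal infinitesimal bending $\mathcal{T}$ with conformal factor $\rho$ is the endomorphism field given by $(X,Y)\mapsto\langle\tilde\nabla_XLY-L\nabla_XY,N\rangle$ via the metric (i.e. $\langle\mathcal{B}'X,Y\rangle$ equals this expression), where $LX=\tilde\nabla_X\mathcal{T}-\rho f_*X$.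 *)

theory Defs
  imports "HOL-Analysis.Analysis"
begin

section \<open>Smooth manifolds\<close>

text \<open>C-infinity maps on an open subset \<open>S\<close> of a Euclidean space. The derivative is the full
  one, at each point of \<open>S\<close>, so the definition is only meant for open \<open>S\<close>.\<close>

primrec Ck_on :: "nat \<Rightarrow> 'a::euclidean_space set \<Rightarrow> ('a \<Rightarrow> 'b::real_normed_vector) \<Rightarrow> bool" where
  "Ck_on 0 S h \<longleftrightarrow> continuous_on S h"
| "Ck_on (Suc k) S h \<longleftrightarrow>
     (\<forall>x\<in>S. h differentiable (at x)) \<and> (\<forall>v. Ck_on k S (\<lambda>x. frechet_derivative h (at x) v))"

definition smooth_on :: "'a::euclidean_space set \<Rightarrow> ('a \<Rightarrow> 'b::real_normed_vector) \<Rightarrow> bool" where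
  "smooth_on S h \<longleftrightarrow> (\<forall>k. Ck_on k S h)"

text \<open>The manifold is the whole type \<open>'m\<close>, required to be Hausdorff and second countable; \<open>'a\<close> is
  the model space, whose dimension is that of the manifold. A chart is a pair of an open set and a
  coordinate map on it. An atlas need not be maximal.\<close>

type_synonym ('m, 'a) chart = "'m set \<times> ('m \<Rightarrow> 'a)"

definition chart_inv :: "('m, 'a) chart \<Rightarrow> 'a \<Rightarrow> 'm" where
  "chart_inv c = inv_into (fst c) (snd c)"

definition is_chart :: "('m::topological_space, 'a::euclidean_space) chart \<Rightarrow> bool" where
  "is_chart c \<longleftrightarrow> open (fst c) \<and> open (snd c ` fst c) \<and>
     homeomorphism (fst c) (snd c ` fst c) (snd c) (chart_inv c)"

definition smooth_atlas ::
  "('m::{t2_space,second_countable_topology}, 'a::euclidean_space) chart set \<Rightarrow> bool" where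
  "smooth_atlas \<A> \<longleftrightarrow>
     (\<forall>c\<in>\<A>. is_chart c) \<and> (\<Union>c\<in>\<A>. fst c) = UNIV \<and>
     (\<forall>c\<in>\<A>. \<forall>d\<in>\<A>. smooth_on (snd c ` (fst c \<inter> fst d)) (snd d \<circ> chart_inv c))"

definition smooth_map ::
  "('m, 'a::euclidean_space) chart set \<Rightarrow> ('m \<Rightarrow> 'c::real_normed_vector) \<Rightarrow> bool" where
  "smooth_map \<A> h \<longleftrightarrow> (\<forall>c\<in>\<A>. smooth_on (snd c ` fst c) (h \<circ> chart_inv c))"

text \<open>The tangent space at \<open>p\<close> is modelled on \<open>'a\<close>: a tangent vector is given by its components
  in the chart \<open>chart_at \<A> p\<close>, which is selected once and for all at each point. Since the selected
  charts at nearby points may be unrelated, smoothness of fields is always tested in a fixed chart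
  around the point.\<close>

definition chart_at :: "('m, 'a) chart set \<Rightarrow> 'm \<Rightarrow> ('m, 'a) chart" where
  "chart_at \<A> p = (SOME c. c \<in> \<A> \<and> p \<in> fst c)"

definition tangent_map ::
  "('m, 'a::euclidean_space) chart set \<Rightarrow> ('m \<Rightarrow> 'c::real_normed_vector) \<Rightarrow> 'm \<Rightarrow> 'a \<Rightarrow> 'c" where
  "tangent_map \<A> h p =
     frechet_derivative (h \<circ> chart_inv (chart_at \<A> p)) (at (snd (chart_at \<A> p) p))"

text \<open>For a point \<open>p\<close> in the domain of \<open>c\<close>, this is the value at \<open>p\<close> of the field that has constant
  components \<open>v\<close> in the chart \<open>c\<close>, i.e. of the coordinate field in direction \<open>v\<close>.\<close>

definition coord_field ::
  "('m, 'a::euclidean_space) chart set \<Rightarrow> ('m, 'a) chart \<Rightarrow> 'a \<Rightarrow> 'm \<Rightarrow> 'a" where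
  "coord_field \<A> c v p = frechet_derivative (snd (chart_at \<A> p) \<circ> chart_inv c) (at (snd c p)) v"

definition smooth_field :: "('m, 'a::euclidean_space) chart set \<Rightarrow> ('m \<Rightarrow> 'a) \<Rightarrow> bool" where
  "smooth_field \<A> X \<longleftrightarrow>
     (\<forall>c\<in>\<A>. smooth_on (snd c ` fst c) ((\<lambda>p. tangent_map \<A> (snd c) p (X p)) \<circ> chart_inv c))"

text \<open>Smooth sections of the endomorphism bundle of the tangent bundle.\<close>

definition smooth_endo :: "('m, 'a::euclidean_space) chart set \<Rightarrow> ('m \<Rightarrow> 'a \<Rightarrow> 'a) \<Rightarrow> bool" where
  "smooth_endo \<A> B \<longleftrightarrow> (\<forall>p. linear (B p)) \<and>
     (\<forall>c\<in>\<A>. \<forall>v. smooth_on (snd c ` fst c)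
        ((\<lambda>p. tangent_map \<A> (snd c) p (B p (coord_field \<A> c v p))) \<circ> chart_inv c))"

text \<open>Derivative of a vector valued function along a field. For maps into a Euclidean space
  this is also the flat connection along the map.\<close>

definition deriv_along ::
  "('m, 'a::euclidean_space) chart set \<Rightarrow> ('m \<Rightarrow> 'a) \<Rightarrow> ('m \<Rightarrow> 'c::real_normed_vector) \<Rightarrow> 'm \<Rightarrow> 'c" where
  "deriv_along \<A> X h p = tangent_map \<A> h p (X p)"

section \<open>Riemannian metrics\<close>

definition riemannian_metric ::
  "('m, 'a::euclidean_space) chart set \<Rightarrow> ('m \<Rightarrow> 'a \<Rightarrow> 'a \<Rightarrow> real) \<Rightarrow> bool" where
  "riemannian_metric \<A> g \<longleftrightarrow>
     (\<forall>p. bilinear (g p) \<and> (\<forall>u v. g p u v = g p v u) \<and> (\<forall>u. u \<noteq> 0 \<longrightarrow> g p u u > 0)) \<and>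
     (\<forall>c\<in>\<A>. \<forall>u v. smooth_on (snd c ` fst c)
        ((\<lambda>p. g p (coord_field \<A> c u p) (coord_field \<A> c v p)) \<circ> chart_inv c))"

text \<open>The values of \<open>nabla\<close> on arguments that are not smooth fields are irrelevant. The last condition
  says that the torsion vanishes, i.e. that \<open>nabla X Y - nabla Y X\<close> is the Lie bracket, regarded as the
  derivation that is the commutator of \<open>X\<close> and \<open>Y\<close> on smooth functions.\<close>

definition levi_civita ::
  "('m, 'a::euclidean_space) chart set \<Rightarrow> ('m \<Rightarrow> 'a \<Rightarrow> 'a \<Rightarrow> real) \<Rightarrow>
   (('m \<Rightarrow> 'a) \<Rightarrow> ('m \<Rightarrow> 'a) \<Rightarrow> 'm \<Rightarrow> 'a) \<Rightarrow> bool" where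
  "levi_civita \<A> g nabla \<longleftrightarrow>
     (\<forall>X Y. smooth_field \<A> X \<longrightarrow> smooth_field \<A> Y \<longrightarrow> smooth_field \<A> (nabla X Y)) \<and>
     (\<forall>X X' Y p. smooth_field \<A> X \<longrightarrow> smooth_field \<A> X' \<longrightarrow> smooth_field \<A> Y \<longrightarrow>
        nabla (\<lambda>q. X q + X' q) Y p = nabla X Y p + nabla X' Y p) \<and>
     (\<forall>h X Y p. smooth_map \<A> h \<longrightarrow> smooth_field \<A> X \<longrightarrow> smooth_field \<A> Y \<longrightarrow>
        nabla (\<lambda>q. h q *\<^sub>R X q) Y p = h p *\<^sub>R nabla X Y p) \<and>
     (\<forall>X Y Y' p. smooth_field \<A> X \<longrightarrow> smooth_field \<A> Y \<longrightarrow> smooth_field \<A> Y' \<longrightarrow>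
        nabla X (\<lambda>q. Y q + Y' q) p = nabla X Y p + nabla X Y' p) \<and>
     (\<forall>h X Y p. smooth_map \<A> h \<longrightarrow> smooth_field \<A> X \<longrightarrow> smooth_field \<A> Y \<longrightarrow>
        nabla X (\<lambda>q. h q *\<^sub>R Y q) p = deriv_along \<A> X h p *\<^sub>R Y p + h p *\<^sub>R nabla X Y p) \<and>
     (\<forall>X Y Z p. smooth_field \<A> X \<longrightarrow> smooth_field \<A> Y \<longrightarrow> smooth_field \<A> Z \<longrightarrow>
        deriv_along \<A> X (\<lambda>q. g q (Y q) (Z q)) p = g p (nabla X Y p) (Z p) + g p (Y p) (nabla X Z p)) \<and>
     (\<forall>X Y p. \<forall>h :: 'm \<Rightarrow> real. smooth_field \<A> X \<longrightarrow> smooth_field \<A> Y \<longrightarrow> smooth_map \<A> h \<longrightarrow>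
        deriv_along \<A> (nabla X Y) h p - deriv_along \<A> (nabla Y X) h p =
        deriv_along \<A> X (deriv_along \<A> Y h) p - deriv_along \<A> Y (deriv_along \<A> X h) p)"

definition gradient ::
  "('m, 'a::euclidean_space) chart set \<Rightarrow> ('m \<Rightarrow> 'a \<Rightarrow> 'a \<Rightarrow> real) \<Rightarrow> ('m \<Rightarrow> real) \<Rightarrow> 'm \<Rightarrow> 'a" where
  "gradient \<A> g \<rho> p = (THE u. \<forall>v. g p u v = tangent_map \<A> \<rho> p v)"

definition hess ::
  "('m, 'a::euclidean_space) chart set \<Rightarrow> ('m \<Rightarrow> 'a \<Rightarrow> 'a \<Rightarrow> real) \<Rightarrow>
   (('m \<Rightarrow> 'a) \<Rightarrow> ('m \<Rightarrow> 'a) \<Rightarrow> 'm \<Rightarrow> 'a) \<Rightarrow> ('m \<Rightarrow> real) \<Rightarrow> ('m \<Rightarrow> 'a) \<Rightarrow> 'm \<Rightarrow> 'a" where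
  "hess \<A> g nabla \<rho> X = nabla X (gradient \<A> g \<rho>)"

definition wedge :: "('a::real_vector \<Rightarrow> 'a \<Rightarrow> real) \<Rightarrow> 'a \<Rightarrow> 'a \<Rightarrow> 'a \<Rightarrow> 'a" where
  "wedge b x y z = b y z *\<^sub>R x - b x z *\<^sub>R y"

definition symmetric_endo :: "('m \<Rightarrow> 'a \<Rightarrow> 'a \<Rightarrow> real) \<Rightarrow> ('m \<Rightarrow> 'a \<Rightarrow> 'a) \<Rightarrow> bool" where
  "symmetric_endo g B \<longleftrightarrow> (\<forall>p u v. g p (B p u) v = g p u (B p v))"

definition nabla_endo ::
  "(('m \<Rightarrow> 'a) \<Rightarrow> ('m \<Rightarrow> 'a) \<Rightarrow> 'm \<Rightarrow> 'a::real_vector) \<Rightarrow> ('m \<Rightarrow> 'a \<Rightarrow> 'a) \<Rightarrow>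
   ('m \<Rightarrow> 'a) \<Rightarrow> ('m \<Rightarrow> 'a) \<Rightarrow> 'm \<Rightarrow> 'a" where
  "nabla_endo nabla B X Y p = nabla X (\<lambda>q. B q (Y q)) p - B p (nabla X Y p)"

section \<open>Hypersurfaces\<close>

definition isometric_immersion ::
  "('m, 'a::euclidean_space) chart set \<Rightarrow> ('m \<Rightarrow> 'a \<Rightarrow> 'a \<Rightarrow> real) \<Rightarrow> ('m \<Rightarrow> 'b::euclidean_space) \<Rightarrow> bool" where
  "isometric_immersion \<A> g f \<longleftrightarrow> smooth_map \<A> f \<and> (\<forall>p. inj (tangent_map \<A> f p)) \<and>
     (\<forall>p u v. tangent_map \<A> f p u \<bullet> tangent_map \<A> f p v = g p u v)"

definition gauss_map ::
  "('m, 'a::euclidean_space) chart set \<Rightarrow> ('m \<Rightarrow> 'b::euclidean_space) \<Rightarrow> ('m \<Rightarrow> 'b) \<Rightarrow> bool" where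
  "gauss_map \<A> f N \<longleftrightarrow> smooth_map \<A> N \<and> (\<forall>p. norm (N p) = 1) \<and>
     (\<forall>p u. tangent_map \<A> f p u \<bullet> N p = 0)"

text \<open>The second fundamental form, by the Gauss formula. Note that \<open>deriv_along \<A> Y f\<close> is the
  push-forward of the field \<open>Y\<close> by \<open>f\<close>.\<close>

definition second_ff ::
  "('m, 'a::euclidean_space) chart set \<Rightarrow> (('m \<Rightarrow> 'a) \<Rightarrow> ('m \<Rightarrow> 'a) \<Rightarrow> 'm \<Rightarrow> 'a) \<Rightarrow>
   ('m \<Rightarrow> 'b::euclidean_space) \<Rightarrow> ('m \<Rightarrow> 'a) \<Rightarrow> ('m \<Rightarrow> 'a) \<Rightarrow> 'm \<Rightarrow> 'b" where
  "second_ff \<A> nabla f X Y p =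
     deriv_along \<A> X (deriv_along \<A> Y f) p - deriv_along \<A> (nabla X Y) f p"

definition shape_operator ::
  "('m, 'a::euclidean_space) chart set \<Rightarrow> ('m \<Rightarrow> 'a \<Rightarrow> 'a \<Rightarrow> real) \<Rightarrow>
   (('m \<Rightarrow> 'a) \<Rightarrow> ('m \<Rightarrow> 'a) \<Rightarrow> 'm \<Rightarrow> 'a) \<Rightarrow> ('m \<Rightarrow> 'b::euclidean_space) \<Rightarrow> ('m \<Rightarrow> 'b) \<Rightarrow>
   ('m \<Rightarrow> 'a \<Rightarrow> 'a) \<Rightarrow> bool" where
  "shape_operator \<A> g nabla f N A \<longleftrightarrow> smooth_endo \<A> A \<and>
     (\<forall>X Y p. smooth_field \<A> X \<longrightarrow> smooth_field \<A> Y \<longrightarrow>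
        g p (A p (X p)) (Y p) = second_ff \<A> nabla f X Y p \<bullet> N p)"

section \<open>Conformal infinitesimal bendings\<close>

definition conformal_bending ::
  "('m, 'a::euclidean_space) chart set \<Rightarrow> ('m \<Rightarrow> 'a \<Rightarrow> 'a \<Rightarrow> real) \<Rightarrow> ('m \<Rightarrow> 'b::euclidean_space) \<Rightarrow>
   ('m \<Rightarrow> real) \<Rightarrow> ('m \<Rightarrow> 'b) \<Rightarrow> bool" where
  "conformal_bending \<A> g f \<rho> T \<longleftrightarrow> smooth_map \<A> \<rho> \<and> smooth_map \<A> T \<and>
     (\<forall>X Y p. smooth_field \<A> X \<longrightarrow> smooth_field \<A> Y \<longrightarrow>
        deriv_along \<A> X T p \<bullet> deriv_along \<A> Y f p + deriv_along \<A> X f p \<bullet> deriv_along \<A> Y T p =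
        2 * \<rho> p * g p (X p) (Y p))"

definition trivial_bending ::
  "('m::topological_space, 'a::euclidean_space) chart set \<Rightarrow> ('m \<Rightarrow> 'a \<Rightarrow> 'a \<Rightarrow> real) \<Rightarrow>
   ('m \<Rightarrow> 'b::euclidean_space) \<Rightarrow> ('m \<Rightarrow> 'b) \<Rightarrow> bool" where
  "trivial_bending \<A> g f T \<longleftrightarrow> (\<exists>\<rho>. conformal_bending \<A> g f \<rho> T) \<and>
     (\<forall>p. \<exists>U l v w D. open U \<and> p \<in> U \<and> linear D \<and> (\<forall>x y. D x \<bullet> y = - (x \<bullet> D y)) \<and>
        (\<forall>x\<in>U. T x = (f x \<bullet> v + l) *\<^sub>R f x - (1/2 * (norm (f x))\<^sup>2) *\<^sub>R v + D (f x) + w))"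

definition bending_L ::
  "('m, 'a::euclidean_space) chart set \<Rightarrow> ('m \<Rightarrow> 'b::euclidean_space) \<Rightarrow> ('m \<Rightarrow> real) \<Rightarrow> ('m \<Rightarrow> 'b) \<Rightarrow>
   ('m \<Rightarrow> 'a) \<Rightarrow> 'm \<Rightarrow> 'b" where
  "bending_L \<A> f \<rho> T X p = deriv_along \<A> X T p - \<rho> p *\<^sub>R deriv_along \<A> X f p"

definition associated_tensor ::
  "('m, 'a::euclidean_space) chart set \<Rightarrow> ('m \<Rightarrow> 'a \<Rightarrow> 'a \<Rightarrow> real) \<Rightarrow>
   (('m \<Rightarrow> 'a) \<Rightarrow> ('m \<Rightarrow> 'a) \<Rightarrow> 'm \<Rightarrow> 'a) \<Rightarrow> ('m \<Rightarrow> 'b::euclidean_space) \<Rightarrow> ('m \<Rightarrow> 'b) \<Rightarrow>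
   ('m \<Rightarrow> real) \<Rightarrow> ('m \<Rightarrow> 'b) \<Rightarrow> ('m \<Rightarrow> 'a \<Rightarrow> 'a) \<Rightarrow> bool" where
  "associated_tensor \<A> g nabla f N \<rho> T B' \<longleftrightarrow> smooth_endo \<A> B' \<and>
     (\<forall>X Y p. smooth_field \<A> X \<longrightarrow> smooth_field \<A> Y \<longrightarrow>
        g p (B' p (X p)) (Y p) =
        (deriv_along \<A> X (bending_L \<A> f \<rho> T Y) p - bending_L \<A> f \<rho> T (nabla X Y) p) \<bullet> N p)"

text \<open>\<open>T\<close> is a conformal infinitesimal bending, with some conformal factor, whose associated tensor
  is \<open>B\<close> up to a multiple of the identity.\<close>

definition bending_with_tensor ::
  "('m, 'a::euclidean_space) chart set \<Rightarrow> ('m \<Rightarrow> 'a \<Rightarrow> 'a \<Rightarrow> real) \<Rightarrow>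
   (('m \<Rightarrow> 'a) \<Rightarrow> ('m \<Rightarrow> 'a) \<Rightarrow> 'm \<Rightarrow> 'a) \<Rightarrow> ('m \<Rightarrow> 'b::euclidean_space) \<Rightarrow> ('m \<Rightarrow> 'b) \<Rightarrow>
   ('m \<Rightarrow> 'a \<Rightarrow> 'a) \<Rightarrow> ('m \<Rightarrow> 'b) \<Rightarrow> bool" where
  "bending_with_tensor \<A> g nabla f N B T \<longleftrightarrow>
     (\<exists>\<rho> B' \<phi>. conformal_bending \<A> g f \<rho> T \<and> associated_tensor \<A> g nabla f N \<rho> T B' \<and>
        smooth_map \<A> \<phi> \<and> (\<forall>p v. B' p v = B p v + \<phi> p *\<^sub>R v))"

end

theory Submission
  imports Defs
begin

text \<open>Write \<open>L\<close> for the differential of a bending minus \<open>\<rho>\<close> times that of \<open>f\<close>. It extends uniquely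
  to a field \<open>D\<close> of skew-symmetric endomorphisms of the ambient space. For a bending with tensor \<open>B\<close>
  the derivative of \<open>D\<close> in the direction \<open>X\<close> is \<open>X \<and> \<nabla>\<rho> + N \<and> BX\<close>, and the
  two equations of the theorem say exactly that this form is closed. For existence one integrates it to
  \<open>D\<close>, and then the closed form \<open>D \<circ> df + \<rho> df\<close> to the bending, whose tensor is \<open>B\<close> itself.
  For the difference of two bendings, with factor \<open>\<sigma>\<close> and tensor \<open>\<phi> I\<close>, the derivative of \<open>D\<close> is
  \<open>X \<and> V\<close> with \<open>V = \<nabla>\<sigma> - \<phi> N\<close>. In dimension at least three closedness forces \<open>V\<close> to be
  constant, and integrating twice gives a conformal Killing field.

  All hypotheses on \<open>nabla\<close> concern globally defined fields. No cut-off functions are needed to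
  localise them, because the tangential parts of constant ambient vectors are global fields that span
  every tangent space.\<close>

section \<open>Smooth maps on open sets\<close>

text \<open>Why the derivative of \<open>D\<close> has that form: its values are skew, its
  antisymmetrisation on tangent vectors is forced by dL = - d\<rho> \<and> df, and its normal part
  on tangent vectors is the tensor. Two candidates differ by a skew-valued form that is symmetric on
  tangent vectors and has no normal part there; such a form is zero by the cyclic argument behind
  the uniqueness of the Levi-Civita connection. In its closedness, the equation with
  \<open>H\<close> is the part in bivectors of two tangent vectors, the equation with the derivative
  of \<open>B\<close> the part in bivectors containing \<open>N\<close>. The summand - \<phi> N of
  \<open>V\<close> comes from N \<and> \<phi> X = X \<and> (- \<phi> N). In dimension two dV could
  be diag(1, -1) in an orthonormal frame.

  Two gaps shape the proof. Closedness concerns coordinate fields of a chart, the hypotheses concern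
  global fields: \<open>closed_formI\<close> bridges them by reading the bracket of two fields off
  the second derivatives of the immersion. Simple connectedness concerns homotopies of loops: local
  primitives are therefore continued along maps of an interval or a square.\<close>

lemma linear_expansion:
  fixes l :: "'a::euclidean_space \<Rightarrow> 'b::real_vector"
  assumes "linear l"
  shows "l v = (\<Sum>b\<in>Basis. (v \<bullet> b) *\<^sub>R l b)"
  by (subst euclidean_representation[symmetric, of v])
    (simp add: linear_sum[OF assms] linear_scale[OF assms])

lemma Ck_on_cong:
  assumes "open S" "Ck_on k S h" "\<And>x. x \<in> S \<Longrightarrow> h x = h' x"
  shows "Ck_on k S h'"
  using assms(2,3)
proof (induction k arbitrary: h h')
  case 0
  then show ?case by (simp cong: continuous_on_cong)
next
  case (Suc k)
  have d: "(h' has_derivative frechet_derivative h (at x)) (at x)" if "x \<in> S" for x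
  proof (rule has_derivative_transform_within_open[OF _ \<open>open S\<close> that Suc.prems(2)])
    show "(h has_derivative frechet_derivative h (at x)) (at x)"
      using Suc.prems(1) that frechet_derivative_works by auto
  qed
  have eq: "frechet_derivative h (at x) = frechet_derivative h' (at x)" if "x \<in> S" for x
    using frechet_derivative_at[OF d[OF that]] .
  have "Ck_on k S (\<lambda>x. frechet_derivative h' (at x) v)" for v
    by (rule Suc.IH[of "\<lambda>x. frechet_derivative h (at x) v"]) (use Suc.prems eq in auto)
  then show ?case using d by (auto simp: differentiable_def)
qed

text \<open>The derivative may be given in any form, so that the inductions below can use what the
  differentiation rules produce.\<close>

lemma Ck_on_SucI:
  fixes h :: "'a::euclidean_space \<Rightarrow> 'b::real_normed_vector"
  assumes "open S" "\<And>x. x \<in> S \<Longrightarrow> (h has_derivative D x) (at x)" "\<And>v. Ck_on k S (\<lambda>x. D x v)"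
  shows "Ck_on (Suc k) S h"
proof -
  have "frechet_derivative h (at x) = D x" if "x \<in> S" for x
    using frechet_derivative_at[OF assms(2)[OF that]] by simp
  then have "Ck_on k S (\<lambda>x. frechet_derivative h (at x) v)" for v
    by (intro Ck_on_cong[OF assms(1) assms(3)[of v]]) simp
  then show ?thesis using assms(2) by (auto simp: differentiable_def)
qed

lemma Ck_on_Suc_lower: "Ck_on (Suc k) S h \<Longrightarrow> Ck_on k S h"
proof (induction k arbitrary: h)
  case 0
  then show ?case
    by (auto intro!: continuous_at_imp_continuous_on differentiable_imp_continuous_within)
next
  case (Suc k)
  then show ?case by (metis Ck_on.simps(2))
qed

lemma Ck_on_subset: "Ck_on k S h \<Longrightarrow> T \<subseteq> S \<Longrightarrow> Ck_on k T h"
  by (induction k arbitrary: h) (auto intro: continuous_on_subset)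

lemma Ck_on_const: "open S \<Longrightarrow> Ck_on k S (\<lambda>x. c)"
  by (induction k arbitrary: c) (auto simp: frechet_derivative_const)

lemma Ck_on_linear:
  assumes "open S" "bounded_linear l" "Ck_on k S h"
  shows "Ck_on k S (\<lambda>x. l (h x))"
  using assms(3)
proof (induction k arbitrary: h)
  case 0
  then show ?case using assms(2)
    by (simp add: bounded_linear.continuous_on)
next
  case (Suc k)
  have "((\<lambda>x. l (h x)) has_derivative (\<lambda>v. l (frechet_derivative h (at x) v))) (at x)" if "x \<in> S" for x
    using Suc.prems that bounded_linear.has_derivative[OF assms(2)]
    by (auto simp: frechet_derivative_works)
  with Suc show ?case by (intro Ck_on_SucI[OF \<open>open S\<close>]) (auto intro: assms)
qed

lemma Ck_on_add:
  assumes "open S" "Ck_on k S h" "Ck_on k S h'"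
  shows "Ck_on k S (\<lambda>x. h x + h' x)"
  using assms(2,3)
proof (induction k arbitrary: h h')
  case 0
  then show ?case by (simp add: continuous_on_add)
next
  case (Suc k)
  have "((\<lambda>x. h x + h' x) has_derivative (\<lambda>v. frechet_derivative h (at x) v + frechet_derivative h' (at x) v)) (at x)" if "x \<in> S" for x
    using Suc.prems that by (auto simp: frechet_derivative_works intro: has_derivative_add)
  with Suc show ?case by (intro Ck_on_SucI[OF \<open>open S\<close>]) (auto intro: assms)
qed

lemma Ck_on_sum:
  assumes "open S" "\<And>i. i \<in> I \<Longrightarrow> Ck_on k S (h i)"
  shows "Ck_on k S (\<lambda>x. \<Sum>i\<in>I. h i x)"
proof (cases "finite I")
  case True
  then show ?thesis using assms(2)
    by (induction I) (auto intro: Ck_on_const Ck_on_add assms(1))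
qed (simp add: Ck_on_const assms(1))

lemma Ck_on_bilinear:
  assumes "open S" "bounded_bilinear pr" "Ck_on k S h" "Ck_on k S h'"
  shows "Ck_on k S (\<lambda>x. pr (h x) (h' x))"
  using assms(3,4)
proof (induction k arbitrary: h h')
  case 0
  then show ?case using assms(2) by (simp add: bounded_bilinear.continuous_on)
next
  case (Suc k)
  have d: "((\<lambda>x. pr (h x) (h' x)) has_derivative (\<lambda>v. pr (h x) (frechet_derivative h' (at x) v) + pr (frechet_derivative h (at x) v) (h' x))) (at x)" if "x \<in> S" for x
    using Suc.prems that by (auto simp: frechet_derivative_works intro: bounded_bilinear.FDERIV[OF assms(2)])
  have "Ck_on k S h" "Ck_on k S h'" using Suc.prems Ck_on_Suc_lower by blast+
  with Suc show ?case
    by (intro Ck_on_SucI[OF \<open>open S\<close> d]) (auto intro!: Ck_on_add assms)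
qed

lemma smooth_on_cong: "open S \<Longrightarrow> smooth_on S h \<Longrightarrow> (\<And>x. x \<in> S \<Longrightarrow> h x = h' x) \<Longrightarrow> smooth_on S h'"
  unfolding smooth_on_def using Ck_on_cong by blast

lemma smooth_on_subset: "smooth_on S h \<Longrightarrow> T \<subseteq> S \<Longrightarrow> smooth_on T h"
  unfolding smooth_on_def using Ck_on_subset by blast

lemma smooth_on_const: "open S \<Longrightarrow> smooth_on S (\<lambda>x. c)"
  unfolding smooth_on_def using Ck_on_const by blast

lemma smooth_on_linear: "open S \<Longrightarrow> bounded_linear l \<Longrightarrow> smooth_on S h \<Longrightarrow> smooth_on S (\<lambda>x. l (h x))"
  unfolding smooth_on_def using Ck_on_linear by blast

lemma smooth_on_add: "open S \<Longrightarrow> smooth_on S h \<Longrightarrow> smooth_on S h' \<Longrightarrow> smooth_on S (\<lambda>x. h x + h' x)"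
  unfolding smooth_on_def using Ck_on_add by blast

lemma smooth_on_sum: "open S \<Longrightarrow> (\<And>i. i \<in> I \<Longrightarrow> smooth_on S (h i)) \<Longrightarrow> smooth_on S (\<lambda>x. \<Sum>i\<in>I. h i x)"
  unfolding smooth_on_def by (blast intro: Ck_on_sum)

lemma smooth_on_bilinear:
  "open S \<Longrightarrow> bounded_bilinear pr \<Longrightarrow> smooth_on S h \<Longrightarrow> smooth_on S h' \<Longrightarrow> smooth_on S (\<lambda>x. pr (h x) (h' x))"
  unfolding smooth_on_def using Ck_on_bilinear by blast

lemma smooth_on_differentiable: "smooth_on S h \<Longrightarrow> x \<in> S \<Longrightarrow> h differentiable (at x)"
  unfolding smooth_on_def by (meson Ck_on.simps(2))

lemma smooth_on_has_derivative:
  "smooth_on S h \<Longrightarrow> x \<in> S \<Longrightarrow> (h has_derivative frechet_derivative h (at x)) (at x)"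
  using smooth_on_differentiable frechet_derivative_works by blast

lemma smooth_on_continuous: "smooth_on S h \<Longrightarrow> continuous_on S h"
  unfolding smooth_on_def by (meson Ck_on.simps(1))

lemma smooth_on_frechet: "smooth_on S h \<Longrightarrow> smooth_on S (\<lambda>x. frechet_derivative h (at x) v)"
  unfolding smooth_on_def using Ck_on.simps(2) by blast

text \<open>One derivative of \<open>h\<close> suffices, all higher ones being read off
  \<open>D\<close>. This is how a primitive of a smooth form becomes smooth.\<close>

lemma smooth_onI:
  assumes "open S" "\<And>x. x \<in> S \<Longrightarrow> (h has_derivative D x) (at x)" "\<And>v. smooth_on S (\<lambda>x. D x v)"
  shows "smooth_on S h"
  unfolding smooth_on_def
proof
  fix k
  have "Ck_on (Suc k) S h"
    using assms by (intro Ck_on_SucI[OF _ assms(2)]) (auto simp: smooth_on_def)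
  then show "Ck_on k S h" by (rule Ck_on_Suc_lower)
qed

text \<open>Continuity of \<open>c\<close> is enough: \<open>(c y - c x) *\<^sub>R u y\<close> is of
  order o(|y - x|), because \<open>u y\<close> is O(|y - x|). It serves where the coefficient is an
  unknown not yet known to be differentiable.\<close>

lemma has_derivative_scaleR_vanishing:
  fixes u :: "'a::real_normed_vector \<Rightarrow> 'b::real_normed_vector"
  assumes u: "(u has_derivative u') (at x)" "u x = 0" and c: "isCont c x"
  shows "((\<lambda>y. c y *\<^sub>R u y) has_derivative (\<lambda>v. c x *\<^sub>R u' v)) (at x)"
proof -
  have bl: "bounded_linear u'" using u has_derivative_bounded_linear by blast
  obtain K where K: "K > 0" "\<And>v. norm (u' v) \<le> norm v * K"
    using bounded_linear.pos_bounded[OF bl] by blast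
  have "((\<lambda>y. (c y - c x) *\<^sub>R u y) has_derivative (\<lambda>v. 0)) (at x)"
    unfolding has_derivative_at_alt
  proof (intro conjI allI impI)
    fix e :: real assume e: "e > 0"
    obtain d1 where d1: "d1 > 0" "\<And>y. norm (y - x) < d1 \<Longrightarrow> norm (u y - u x - u' (y - x)) \<le> 1 * norm (y - x)"
      using u(1) unfolding has_derivative_at_alt by (meson zero_less_one)
    \<comment> \<open>\<open>K + 1\<close> bounds |u y| / |y - x| near \<open>x\<close>:
      \<open>K\<close> comes from \<open>u'\<close>, and 1 from the remainder.\<close>
    have "e / (K + 1) > 0" using e K by simp
    then obtain d2 where d2: "d2 > 0" "\<And>y. dist y x < d2 \<Longrightarrow> dist (c y) (c x) < e / (K + 1)"
      using c unfolding continuous_at_eps_delta by blast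
    have "norm ((c y - c x) *\<^sub>R u y) \<le> e * norm (y - x)" if y: "norm (y - x) < min d1 d2" for y
    proof -
      have "norm (u y) \<le> norm (u y - u x - u' (y - x)) + norm (u' (y - x))"
        using u(2) norm_triangle_ineq[of "u y - u x - u' (y - x)" "u' (y - x)"] by simp
      also have "\<dots> \<le> (K + 1) * norm (y - x)"
        using d1(2)[of y] K(2)[of "y - x"] y by (simp add: algebra_simps)
      finally have 1: "norm (u y) \<le> (K + 1) * norm (y - x)" .
      have 2: "\<bar>c y - c x\<bar> \<le> e / (K + 1)" using d2(2)[of y] y by (simp add: dist_norm)
      have "norm ((c y - c x) *\<^sub>R u y) \<le> e / (K + 1) * ((K + 1) * norm (y - x))"
        unfolding norm_scaleR using 1 2 K e by (intro mult_mono) auto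
      then show ?thesis using K by simp
    qed
    then show "\<exists>d>0. \<forall>y. norm (y - x) < d \<longrightarrow> norm ((c y - c x) *\<^sub>R u y - (c x - c x) *\<^sub>R u x - 0) \<le> e * norm (y - x)"
      using d1 d2 by (intro exI[of _ "min d1 d2"]) auto
  qed (rule bounded_linear_zero)
  from has_derivative_add[OF this has_derivative_scaleR_right[OF u(1), of "c x"]]
  show ?thesis by (simp add: algebra_simps)
qed

text \<open>Freezes the operator at \<open>x\<^sub>0\<close> and inverts it there. The unknown
  \<open>w\<close> reappears on the right, but only with coefficients that vanish at
  \<open>x\<^sub>0\<close>.\<close>

lemma solution_representation:
  fixes G :: "'x \<Rightarrow> 'e::euclidean_space \<Rightarrow> 'e"
  assumes lin: "linear (G x)" "linear (G x\<^sub>0)" and L: "linear L" "\<And>v. L (G x\<^sub>0 v) = v"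
    and eq: "G x (w x) = r x"
  shows "w x = L (r x) - (\<Sum>b\<in>Basis. (w x \<bullet> b) *\<^sub>R L (G x b - G x\<^sub>0 b))"
proof -
  have *: "G y (w x) = (\<Sum>b\<in>Basis. (w x \<bullet> b) *\<^sub>R G y b)" if "linear (G y)" for y
    by (rule linear_expansion[OF that])
  have "(\<Sum>b\<in>Basis. (w x \<bullet> b) *\<^sub>R L (G x b - G x\<^sub>0 b)) = L (G x (w x) - G x\<^sub>0 (w x))"
    unfolding *[OF lin(1)] *[OF lin(2)]
    by (simp add: linear_sum[OF L(1)] linear_scale[OF L(1)] linear_diff[OF L(1)]
        scaleR_diff_right sum_subtractf)
  then show ?thesis using L by (simp add: eq linear_diff)
qed

text \<open>Near \<open>x\<^sub>0\<close> the correction in the representation is at most half of |w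
  x| and can be absorbed. Hence \<open>w\<close> is bounded by \<open>L (r x)\<close>, and the
  correction tends to 0.\<close>

lemma solution_isCont:
  fixes G :: "'a::euclidean_space \<Rightarrow> 'e::euclidean_space \<Rightarrow> 'e"
  assumes "open S" "x\<^sub>0 \<in> S"
    and lin: "\<And>x. x \<in> S \<Longrightarrow> linear (G x)"
    and L: "linear L" "\<And>v. L (G x\<^sub>0 v) = v"
    and G: "\<And>v. isCont (\<lambda>x. G x v) x\<^sub>0"
    and r: "isCont r x\<^sub>0"
    and eq: "\<And>x. x \<in> S \<Longrightarrow> G x (w x) = r x"
  shows "isCont w x\<^sub>0"
proof -
  have bL: "bounded_linear L" using L(1) linear_conv_bounded_linear by blast
  define u where "u b x = L (G x b - G x\<^sub>0 b)" for b x
  have repr: "w x = L (r x) - (\<Sum>b\<in>Basis. (w x \<bullet> b) *\<^sub>R u b x)" if "x \<in> S" for x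
    unfolding u_def
    by (rule solution_representation[of G x x\<^sub>0 L w r, OF lin[OF that] lin[OF assms(2)] L eq[OF that]])
  have ev: "\<forall>\<^sub>F x in at x\<^sub>0. x \<in> S"
    using assms(1,2) eventually_at_in_open' by blast
  have ulim: "(u b \<longlongrightarrow> 0) (at x\<^sub>0)" for b
    unfolding u_def using bounded_linear.tendsto[OF bL tendsto_diff[OF G[of b, unfolded isCont_def] tendsto_const[of "G x\<^sub>0 b"]]]
    by (simp add: linear_0[OF L(1)])
  have rlim: "(r \<longlongrightarrow> r x\<^sub>0) (at x\<^sub>0)"
    using r by (simp add: isCont_def)
  \<comment> \<open>Bounds the norm of the operator that multiplies \<open>w x\<close> in the
    correction; once it is below 1/2 the correction can be absorbed.\<close>
  define \<epsilon> where "\<epsilon> x = (\<Sum>b\<in>Basis. norm (u b x))" for x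
  have elim: "(\<epsilon> \<longlongrightarrow> 0) (at x\<^sub>0)"
    unfolding \<epsilon>_def using tendsto_sum[OF tendsto_norm[OF ulim]] by simp
  then have e2: "\<forall>\<^sub>F x in at x\<^sub>0. \<epsilon> x < 1/2"
    by (rule order_tendstoD) simp
  have sumb: "norm (\<Sum>b\<in>Basis. (w x \<bullet> b) *\<^sub>R u b x) \<le> norm (w x) * \<epsilon> x" for x
    unfolding \<epsilon>_def sum_distrib_left
    by (rule sum_norm_le) (auto intro!: mult_right_mono simp: Basis_le_norm)
  have wb: "\<forall>\<^sub>F x in at x\<^sub>0. norm (w x) \<le> 2 * norm (L (r x))"
    using ev e2
  proof eventually_elim
    case (elim x)
    have "norm (w x) \<le> norm (L (r x)) + norm (w x) * \<epsilon> x"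
      using repr[OF elim(1)] norm_triangle_ineq4[of "L (r x)" "\<Sum>b\<in>Basis. (w x \<bullet> b) *\<^sub>R u b x"] sumb[of x]
      by simp
    moreover have "norm (w x) * \<epsilon> x \<le> norm (w x) * (1/2)"
      using elim(2) by (intro mult_left_mono) auto
    ultimately show ?case by simp
  qed
  have "\<forall>\<^sub>F x in at x\<^sub>0. norm (w x - L (r x)) \<le> 2 * norm (L (r x)) * \<epsilon> x"
    using ev wb
  proof eventually_elim
    case (elim x)
    have "norm (w x - L (r x)) = norm (\<Sum>b\<in>Basis. (w x \<bullet> b) *\<^sub>R u b x)"
      using repr[OF elim(1)] by (metis add_diff_cancel_left' diff_add_cancel norm_minus_commute)
    also have "\<dots> \<le> norm (w x) * \<epsilon> x" by (rule sumb)
    also have "\<dots> \<le> 2 * norm (L (r x)) * \<epsilon> x"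
      using elim(2) by (intro mult_right_mono) (auto simp: \<epsilon>_def intro: sum_nonneg)
    finally show ?case .
  qed
  moreover have Lr: "((\<lambda>x. L (r x)) \<longlongrightarrow> L (r x\<^sub>0)) (at x\<^sub>0)"
    by (rule bounded_linear.tendsto[OF bL rlim])
  have "((\<lambda>x. 2 * norm (L (r x)) * \<epsilon> x) \<longlongrightarrow> 2 * norm (L (r x\<^sub>0)) * 0) (at x\<^sub>0)"
    by (intro tendsto_intros Lr elim)
  ultimately have "((\<lambda>x. w x - L (r x)) \<longlongrightarrow> 0) (at x\<^sub>0)"
    using Lim_null_comparison by fastforce
  from tendsto_add[OF this Lr] have "(w \<longlongrightarrow> L (r x\<^sub>0)) (at x\<^sub>0)" by simp
  then show "isCont w x\<^sub>0"
    using eq[OF assms(2)] L(2) by (metis isCont_def)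
qed

text \<open>Differentiates the representation at \<open>x\<^sub>0\<close>. The coefficients of
  \<open>w\<close> vanish there, so continuity of \<open>w\<close> is all that the product rule asks
  for.\<close>

lemma solution_has_derivative:
  fixes G :: "'a::euclidean_space \<Rightarrow> 'e::euclidean_space \<Rightarrow> 'e"
  assumes "open S" "x\<^sub>0 \<in> S"
    and lin: "\<And>x. x \<in> S \<Longrightarrow> linear (G x)"
    and L: "linear L" "\<And>v. L (G x\<^sub>0 v) = v"
    and dG: "\<And>v. ((\<lambda>x. G x v) has_derivative G' v) (at x\<^sub>0)"
    and dr: "(r has_derivative r') (at x\<^sub>0)"
    and eq: "\<And>x. x \<in> S \<Longrightarrow> G x (w x) = r x"
  shows "(w has_derivative (\<lambda>v. L (r' v - (\<Sum>b\<in>Basis. (w x\<^sub>0 \<bullet> b) *\<^sub>R G' b v)))) (at x\<^sub>0)"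
proof -
  have bL: "bounded_linear L" using L(1) linear_conv_bounded_linear by blast
  have cont: "isCont w x\<^sub>0"
    using assms(1,2) lin L has_derivative_continuous[OF dG] has_derivative_continuous[OF dr] eq
    by (rule solution_isCont[where G = G and L = L and r = r and S = S])
  define u where "u b x = L (G x b - G x\<^sub>0 b)" for b x
  have repr: "w x = L (r x) - (\<Sum>b\<in>Basis. (w x \<bullet> b) *\<^sub>R u b x)" if "x \<in> S" for x
    unfolding u_def
    by (rule solution_representation[of G x x\<^sub>0 L w r, OF lin[OF that] lin[OF assms(2)] L eq[OF that]])
  have u0: "u b x\<^sub>0 = 0" for b by (simp add: u_def linear_0[OF L(1)])
  have du: "(u b has_derivative (\<lambda>v. L (G' b v))) (at x\<^sub>0)" for b
    unfolding u_def
    by (rule bounded_linear.has_derivative[OF bL]) (auto intro!: derivative_eq_intros dG)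
  have "((\<lambda>x. L (r x) - (\<Sum>b\<in>Basis. (w x \<bullet> b) *\<^sub>R u b x)) has_derivative
     (\<lambda>v. L (r' v) - (\<Sum>b\<in>Basis. (w x\<^sub>0 \<bullet> b) *\<^sub>R L (G' b v)))) (at x\<^sub>0)"
    using cont
    by (intro has_derivative_diff has_derivative_sum has_derivative_scaleR_vanishing
        bounded_linear.has_derivative[OF bL] dr du u0 continuous_intros)
  then have "(w has_derivative
     (\<lambda>v. L (r' v) - (\<Sum>b\<in>Basis. (w x\<^sub>0 \<bullet> b) *\<^sub>R L (G' b v)))) (at x\<^sub>0)"
    by (rule has_derivative_transform_within_open[OF _ assms(1,2)]) (use repr in auto)
  then show "(w has_derivative (\<lambda>v. L (r' v - (\<Sum>b\<in>Basis. (w x\<^sub>0 \<bullet> b) *\<^sub>R G' b v)))) (at x\<^sub>0)"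
    by (simp add: linear_sum[OF L(1)] linear_scale[OF L(1)] linear_diff[OF L(1)])
qed

text \<open>The derivative of \<open>w\<close> solves an equation with the same \<open>G\<close>,
  whose right-hand side involves only \<open>w\<close> and derivatives of \<open>G\<close> and
  \<open>r\<close>. Induction on the order, over all \<open>r\<close> and \<open>w\<close>,
  therefore replaces any formula for the inverse of \<open>G\<close>.\<close>

lemma smooth_on_solution:
  fixes G :: "'a::euclidean_space \<Rightarrow> 'e::euclidean_space \<Rightarrow> 'e"
  assumes "open S" and lin: "\<And>x. x \<in> S \<Longrightarrow> linear (G x)" and inj: "\<And>x. x \<in> S \<Longrightarrow> inj (G x)"
    and G: "\<And>v. smooth_on S (\<lambda>x. G x v)" and r: "smooth_on S r"
    and eq: "\<And>x. x \<in> S \<Longrightarrow> G x (w x) = r x"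
  shows "smooth_on S w"
  unfolding smooth_on_def
proof
  fix k
  obtain L where L: "\<And>x. x \<in> S \<Longrightarrow> linear (L x)" "\<And>x v. x \<in> S \<Longrightarrow> L x (G x v) = v"
    using linear_injective_left_inverse[OF lin inj] unfolding o_def id_def by metis
  have "Ck_on k S r" using r by (simp add: smooth_on_def)
  then show "Ck_on k S w" using eq
  proof (induction k arbitrary: r w)
    case 0
    have "isCont w x" if x: "x \<in> S" for x
    proof (rule solution_isCont[where G = G and L = "L x" and r = r and S = S])
      show "isCont (\<lambda>x. G x v) x" for v
        using smooth_on_continuous[OF G] \<open>open S\<close> x continuous_on_eq_continuous_at by blast
      show "isCont r x"
        using 0(1) \<open>open S\<close> x by (simp add: continuous_on_eq_continuous_at)
    qed (use \<open>open S\<close> x lin L 0(2) in auto)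
    then show ?case by (simp add: continuous_at_imp_continuous_on)
  next
    case (Suc k)
    define w' where "w' v x = L x (frechet_derivative r (at x) v - (\<Sum>b\<in>Basis. (w x \<bullet> b) *\<^sub>R frechet_derivative (\<lambda>x. G x b) (at x) v))" for v x
    have d: "(w has_derivative (\<lambda>v. w' v x)) (at x)" if "x \<in> S" for x
      unfolding w'_def
    proof (rule solution_has_derivative[where G = G and L = "L x" and r = r and S = S])
      show "((\<lambda>x. G x v) has_derivative frechet_derivative (\<lambda>x. G x v) (at x)) (at x)" for v
        by (rule smooth_on_has_derivative[OF G that])
      show "(r has_derivative frechet_derivative r (at x)) (at x)"
        using Suc.prems(1) that frechet_derivative_works by auto
    qed (use \<open>open S\<close> that lin L Suc.prems(2) in auto)
    \<comment> \<open>A left inverse of an endomorphism in finite dimension is also a right inverse;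
      with it \<open>w' v\<close> is seen to solve the new equation.\<close>
    have rinv: "G x (L x v) = v" if "x \<in> S" for x v
      using L(2)[OF that] linear_injective_imp_surjective[OF lin[OF that] inj[OF that]] by (metis surjD)
    have w: "Ck_on k S w" using Suc Ck_on_Suc_lower by blast
    show ?case
    proof (rule Ck_on_SucI[OF \<open>open S\<close> d])
      fix v
      show "Ck_on k S (w' v)"
      proof (rule Suc.IH)
        show "Ck_on k S (\<lambda>x. frechet_derivative r (at x) v + - (\<Sum>b\<in>Basis. (w x \<bullet> b) *\<^sub>R frechet_derivative (\<lambda>x. G x b) (at x) v))"
          using Suc.prems w smooth_on_frechet[OF G]
          by (intro Ck_on_add Ck_on_linear[OF _ bounded_linear_minus[OF bounded_linear_ident]] Ck_on_sum
              Ck_on_bilinear[OF _ bounded_bilinear_scaleR] \<open>open S\<close>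
              Ck_on_linear[OF _ bounded_linear_inner_left]) (auto simp: smooth_on_def)
      qed (simp add: w'_def rinv)
    qed
  qed
qed

section \<open>Symmetry of second derivatives and the Poincare lemma\<close>

lemma smooth_on_has_vector_derivative_line:
  fixes F :: "'a::euclidean_space \<Rightarrow> 'b::real_normed_vector"
  assumes "smooth_on S F" "c + t *\<^sub>R u \<in> S"
  shows "((\<lambda>t. F (c + t *\<^sub>R u)) has_vector_derivative frechet_derivative F (at (c + t *\<^sub>R u)) u) (at t within T)"
proof -
  have "((\<lambda>t. c + t *\<^sub>R u) has_derivative (\<lambda>s. s *\<^sub>R u)) (at t within T)"
    by (auto intro!: derivative_eq_intros)
  from has_derivative_compose[OF this smooth_on_has_derivative[OF assms]]
  show ?thesis unfolding has_vector_derivative_def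
    using linear_scale[OF linear_frechet_derivative[OF smooth_on_differentiable[OF assms]]] by simp
qed

text \<open>The second difference over a parallelogram with sides \<open>s *\<^sub>R v\<close> and
  \<open>s *\<^sub>R w\<close> is symmetric in \<open>v\<close> and \<open>w\<close>. Two
  applications of the mean value theorem, in either order, turn it into s^2 times either mixed
  derivative at some point of the parallelogram; continuity at \<open>x\<close> does the
  rest.\<close>

lemma frechet_derivative_commute_real:
  fixes F :: "'a::euclidean_space \<Rightarrow> real"
  assumes "open S" "x \<in> S" "smooth_on S F"
  shows "frechet_derivative (\<lambda>y. frechet_derivative F (at y) v) (at x) w =
         frechet_derivative (\<lambda>y. frechet_derivative F (at y) w) (at x) v"
proof -
  let ?D = "\<lambda>v y. frechet_derivative F (at y) v"
  let ?DD = "\<lambda>v w y. frechet_derivative (?D v) (at y) w"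
  obtain r where r: "r > 0" "ball x r \<subseteq> S" using assms openE by blast
  have quot: "\<exists>\<tau> \<sigma>. 0 < \<tau> \<and> \<tau> < s \<and> 0 < \<sigma> \<and> \<sigma> < s \<and>
       F (x + s *\<^sub>R v + s *\<^sub>R w) - F (x + s *\<^sub>R v) - (F (x + s *\<^sub>R w) - F x) = s * (s * ?DD v w (x + \<tau> *\<^sub>R v + \<sigma> *\<^sub>R w))"
    if s: "s > 0" "s * (norm v + norm w) < r" for s v w
  proof -
    have inS: "x + t *\<^sub>R v + t' *\<^sub>R w \<in> S" if "0 \<le> t" "t \<le> s" "0 \<le> t'" "t' \<le> s" for t t'
    proof -
      have "norm (t *\<^sub>R v + t' *\<^sub>R w) \<le> norm (t *\<^sub>R v) + norm (t' *\<^sub>R w)"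
        by (rule norm_triangle_ineq)
      also have "\<dots> \<le> s * norm v + s * norm w"
        using that s by (intro add_mono) (auto intro: mult_right_mono)
      finally have "norm (t *\<^sub>R v + t' *\<^sub>R w) < r" using s by (simp add: algebra_simps)
      then have "x + t *\<^sub>R v + t' *\<^sub>R w \<in> ball x r"
        by (simp add: dist_norm algebra_simps norm_minus_commute)
      then show ?thesis using r by blast
    qed
    have "\<exists>\<tau>>0. \<tau> < s \<and> (F (x + s *\<^sub>R w + s *\<^sub>R v) - F (x + s *\<^sub>R v)) - (F (x + s *\<^sub>R w + 0 *\<^sub>R v) - F (x + 0 *\<^sub>R v))
       = (s - 0) * (?D v (x + s *\<^sub>R w + \<tau> *\<^sub>R v) - ?D v (x + \<tau> *\<^sub>R v))"
    proof (rule MVT2[OF s(1)])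
      fix t assume t: "0 \<le> t" "t \<le> s"
      have "x + s *\<^sub>R w + t *\<^sub>R v \<in> S" "x + t *\<^sub>R v \<in> S"
        using inS[OF t, of s] inS[OF t, of 0] s by (auto simp: algebra_simps)
      from this[THEN smooth_on_has_vector_derivative_line[OF assms(3), of _ _ _ UNIV]]
      show "DERIV (\<lambda>t. F (x + s *\<^sub>R w + t *\<^sub>R v) - F (x + t *\<^sub>R v)) t :> (?D v (x + s *\<^sub>R w + t *\<^sub>R v) - ?D v (x + t *\<^sub>R v))"
        unfolding has_real_derivative_iff_has_vector_derivative by (rule has_vector_derivative_diff)
    qed
    then obtain \<tau> where t: "\<tau> > 0" "\<tau> < s" and
      1: "F (x + s *\<^sub>R w + s *\<^sub>R v) - F (x + s *\<^sub>R v) - (F (x + s *\<^sub>R w) - F x) = s * (?D v (x + s *\<^sub>R w + \<tau> *\<^sub>R v) - ?D v (x + \<tau> *\<^sub>R v))"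
      by auto
    have "\<exists>\<sigma>>0. \<sigma> < s \<and> ?D v (x + \<tau> *\<^sub>R v + s *\<^sub>R w) - ?D v (x + \<tau> *\<^sub>R v + 0 *\<^sub>R w) = (s - 0) * ?DD v w (x + \<tau> *\<^sub>R v + \<sigma> *\<^sub>R w)"
    proof (rule MVT2[OF s(1)])
      fix t' assume "0 \<le> t'" "t' \<le> s"
      then have "x + \<tau> *\<^sub>R v + t' *\<^sub>R w \<in> S" using inS t by simp
      from smooth_on_has_vector_derivative_line[OF smooth_on_frechet[OF assms(3)] this, of _ UNIV]
      show "DERIV (\<lambda>t'. ?D v (x + \<tau> *\<^sub>R v + t' *\<^sub>R w)) t' :> ?DD v w (x + \<tau> *\<^sub>R v + t' *\<^sub>R w)"
        unfolding has_real_derivative_iff_has_vector_derivative .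
    qed
    then obtain \<sigma> where "\<sigma> > 0" "\<sigma> < s"
      "?D v (x + \<tau> *\<^sub>R v + s *\<^sub>R w) - ?D v (x + \<tau> *\<^sub>R v) = s * ?DD v w (x + \<tau> *\<^sub>R v + \<sigma> *\<^sub>R w)"
      by auto
    moreover have e: "x + s *\<^sub>R w + s *\<^sub>R v = x + s *\<^sub>R v + s *\<^sub>R w" "x + s *\<^sub>R w + \<tau> *\<^sub>R v = x + \<tau> *\<^sub>R v + s *\<^sub>R w"
      by simp_all
    ultimately show ?thesis using t 1[unfolded e]
      by (intro exI conjI[of "0 < \<tau>"] conjI) (simp_all only:)
  qed
  show ?thesis
  proof (rule ccontr)
    assume ne: "?DD v w x \<noteq> ?DD w v x"
    define e where "e = dist (?DD v w x) (?DD w v x) / 2"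
    have e: "e > 0" using ne by (simp add: e_def)
    have cont: "isCont (?DD v w) x" for v w
      using smooth_on_continuous[OF smooth_on_frechet[OF smooth_on_frechet[OF assms(3)]]]
        continuous_on_eq_continuous_at[OF assms(1)] assms(2) by blast
    obtain d1 where d1: "d1 > 0" "\<And>y. dist y x < d1 \<Longrightarrow> dist (?DD v w y) (?DD v w x) < e"
      using cont[of v w] e unfolding continuous_at_eps_delta by blast
    obtain d2 where d2: "d2 > 0" "\<And>y. dist y x < d2 \<Longrightarrow> dist (?DD w v y) (?DD w v x) < e"
      using cont[of w v] e unfolding continuous_at_eps_delta by blast
    define m where "m = min r (min d1 d2)"
    \<comment> \<open>The summand 1 keeps the denominator positive when \<open>v\<close> and
      \<open>w\<close> are both zero.\<close>
    define s where "s = m / (norm v + norm w + 1)"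
    have m: "m > 0" using r d1 d2 by (simp add: m_def)
    have s: "s > 0" unfolding s_def using m by (simp add: add_nonneg_pos)
    have sm: "s * (norm v + norm w) < m"
    proof -
      have "s * (norm v + norm w) < s * (norm v + norm w + 1)" using s by simp
      also have "\<dots> = m" by (simp add: s_def add_nonneg_eq_0_iff)
      finally show ?thesis .
    qed
    have near: "dist (x + \<tau> *\<^sub>R v + \<sigma> *\<^sub>R w) x < m" if "0 < \<tau>" "\<tau> < s" "0 < \<sigma>" "\<sigma> < s" for \<tau> \<sigma>
    proof -
      have "dist (x + \<tau> *\<^sub>R v + \<sigma> *\<^sub>R w) x = norm (\<tau> *\<^sub>R v + \<sigma> *\<^sub>R w)" by (simp add: dist_norm algebra_simps)
      also have "\<dots> \<le> norm (\<tau> *\<^sub>R v) + norm (\<sigma> *\<^sub>R w)" by (rule norm_triangle_ineq)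
      also have "\<dots> \<le> s * norm v + s * norm w"
        using that s by (intro add_mono) (auto intro: mult_right_mono)
      finally show ?thesis using sm by (simp add: algebra_simps)
    qed
    have sr: "s * (norm v + norm w) < r" using sm by (simp add: m_def)
    obtain \<tau> \<sigma> where 1: "0 < \<tau>" "\<tau> < s" "0 < \<sigma>" "\<sigma> < s"
       "F (x + s *\<^sub>R v + s *\<^sub>R w) - F (x + s *\<^sub>R v) - (F (x + s *\<^sub>R w) - F x) = s * (s * ?DD v w (x + \<tau> *\<^sub>R v + \<sigma> *\<^sub>R w))"
      using quot[OF s sr] by blast
    obtain \<tau>' \<sigma>' where 2: "0 < \<tau>'" "\<tau>' < s" "0 < \<sigma>'" "\<sigma>' < s"
       "F (x + s *\<^sub>R w + s *\<^sub>R v) - F (x + s *\<^sub>R w) - (F (x + s *\<^sub>R v) - F x) = s * (s * ?DD w v (x + \<tau>' *\<^sub>R w + \<sigma>' *\<^sub>R v))"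
      using quot[OF s, of w v] sr unfolding add.commute[of "norm w"] by blast
    have e: "x + s *\<^sub>R w + s *\<^sub>R v = x + s *\<^sub>R v + s *\<^sub>R w" by simp
    have "s * (s * ?DD v w (x + \<tau> *\<^sub>R v + \<sigma> *\<^sub>R w)) = s * (s * ?DD w v (x + \<tau>' *\<^sub>R w + \<sigma>' *\<^sub>R v))"
      unfolding 1(5)[symmetric] 2(5)[symmetric] e by simp
    then have eq: "?DD v w (x + \<tau> *\<^sub>R v + \<sigma> *\<^sub>R w) = ?DD w v (x + \<tau>' *\<^sub>R w + \<sigma>' *\<^sub>R v)"
      using s by simp
    have A: "dist (?DD v w (x + \<tau> *\<^sub>R v + \<sigma> *\<^sub>R w)) (?DD v w x) < e"
      using near[OF 1(1-4)] by (intro d1) (simp add: m_def)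
    have B: "dist (?DD w v (x + \<tau>' *\<^sub>R w + \<sigma>' *\<^sub>R v)) (?DD w v x) < e"
    proof (rule d2(2))
      have "x + \<tau>' *\<^sub>R w + \<sigma>' *\<^sub>R v = x + \<sigma>' *\<^sub>R v + \<tau>' *\<^sub>R w" by simp
      then show "dist (x + \<tau>' *\<^sub>R w + \<sigma>' *\<^sub>R v) x < d2"
        using near[OF 2(3,4,1,2)] by (simp only: m_def)
    qed
    show False
      using dist_triangle_half_r[OF A[unfolded e_def] B[folded eq, unfolded e_def]] by simp
  qed
qed

lemma frechet_derivative_commute:
  fixes F :: "'a::euclidean_space \<Rightarrow> 'b::euclidean_space"
  assumes S: "open S" "x \<in> S" and F: "smooth_on S F"
  shows "frechet_derivative (\<lambda>y. frechet_derivative F (at y) v) (at x) w =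
         frechet_derivative (\<lambda>y. frechet_derivative F (at y) w) (at x) v"
proof (rule euclidean_eqI)
  fix b :: 'b assume "b \<in> Basis"
  have Fb: "smooth_on S (\<lambda>y. F y \<bullet> b)"
    by (rule smooth_on_linear[OF S(1) bounded_linear_inner_left F])
  have inner: "frechet_derivative (\<lambda>y. H y \<bullet> b) (at y) u = frechet_derivative H (at y) u \<bullet> b"
    if "smooth_on S H" "y \<in> S" for H :: "'a \<Rightarrow> 'b" and y u
    using frechet_derivative_at[OF has_derivative_inner_left[OF smooth_on_has_derivative[OF that], of b]] by metis
  have cong: "frechet_derivative (\<lambda>y. frechet_derivative (\<lambda>y. F y \<bullet> b) (at y) u) (at x) u' =
      frechet_derivative (\<lambda>y. frechet_derivative F (at y) u) (at x) u' \<bullet> b" for u u'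
  proof -
    have "frechet_derivative (\<lambda>y. frechet_derivative (\<lambda>y. F y \<bullet> b) (at y) u) (at x) =
      frechet_derivative (\<lambda>y. frechet_derivative F (at y) u \<bullet> b) (at x)"
      by (rule frechet_derivative_transform_within_open[OF smooth_on_differentiable[OF smooth_on_frechet[OF Fb] S(2)] S])
         (simp add: inner[OF F])
    then show ?thesis by (simp add: inner[OF smooth_on_frechet[OF F] S(2)])
  qed
  show "frechet_derivative (\<lambda>y. frechet_derivative F (at y) v) (at x) w \<bullet> b =
         frechet_derivative (\<lambda>y. frechet_derivative F (at y) w) (at x) v \<bullet> b"
    unfolding cong[symmetric] by (rule frechet_derivative_commute_real[OF S Fb])
qed

text \<open>The primitive is the integral of the form along the segment from the centre.
  Differentiated under the integral sign, and rewritten by closedness, its integrand becomes the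
  derivative in \<open>t\<close> of t times the form at \<open>?\<gamma> x t\<close>.\<close>

lemma Poincare_lemma_ball:
  fixes \<omega> :: "'a::euclidean_space \<Rightarrow> 'a \<Rightarrow> 'c::banach"
  assumes lin: "\<And>x. x \<in> ball a r \<Longrightarrow> linear (\<omega> x)"
    and smooth: "\<And>v. smooth_on (ball a r) (\<lambda>x. \<omega> x v)"
    and closed: "\<And>x v w. x \<in> ball a r \<Longrightarrow>
      frechet_derivative (\<lambda>y. \<omega> y v) (at x) w = frechet_derivative (\<lambda>y. \<omega> y w) (at x) v"
  shows "\<exists>h. \<forall>x\<in>ball a r. (h has_derivative \<omega> x) (at x)"
proof -
  let ?U = "ball a r"
  let ?\<gamma> = "\<lambda>x t. a + t *\<^sub>R (x - a)"
  define D where "D v y = frechet_derivative (\<lambda>y. \<omega> y v) (at y)" for v y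
  have seg: "?\<gamma> x t \<in> ?U" if "x \<in> ?U" "t \<in> cbox 0 1" for x t
  proof -
    have "norm (t *\<^sub>R (x - a)) \<le> 1 * norm (x - a)"
      unfolding norm_scaleR using that by (intro mult_right_mono) auto
    then show ?thesis using that by (auto simp: dist_norm norm_minus_commute)
  qed
  have dw: "((\<lambda>y. \<omega> y v) has_derivative D v y) (at y)" if "y \<in> ?U" for v y
    unfolding D_def by (rule smooth_on_has_derivative[OF smooth that])
  have expand: "\<omega> y v = (\<Sum>b\<in>Basis. (v \<bullet> b) *\<^sub>R \<omega> y b)" if "y \<in> ?U" for y v
    by (rule linear_expansion[OF lin[OF that]])
  have linD: "linear (D v y)" if "y \<in> ?U" for v y
    using dw[OF that] has_derivative_linear by blast
  \<comment> \<open>Here closedness enters: it exchanges the direction of differentiation with the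
    argument of the form.\<close>
  have sumD: "(\<Sum>b\<in>Basis. (v \<bullet> b) *\<^sub>R D b y w) = D w y v" if "y \<in> ?U" for v w y
  proof -
    have "(\<Sum>b\<in>Basis. (v \<bullet> b) *\<^sub>R D b y w) = (\<Sum>b\<in>Basis. (v \<bullet> b) *\<^sub>R D w y b)"
      using closed[OF that] by (simp add: D_def)
    also have "\<dots> = D w y (\<Sum>b\<in>Basis. (v \<bullet> b) *\<^sub>R b)"
      by (simp add: linear_sum[OF linD[OF that]] linear_scale[OF linD[OF that]])
    finally show ?thesis by (simp add: euclidean_representation)
  qed
  \<comment> \<open>The derivative of the integrand in the direction \<open>w\<close>, already
    rewritten by closedness. The Leibniz rule wants it as a bounded linear function.\<close>
  define fx where "fx x t = Blinfun (\<lambda>w. t *\<^sub>R D w (?\<gamma> x t) (x - a) + \<omega> (?\<gamma> x t) w)" for x t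
  have fx: "blinfun_apply (fx x t) = (\<lambda>w. t *\<^sub>R D w (?\<gamma> x t) (x - a) + \<omega> (?\<gamma> x t) w)"
    if "x \<in> ?U" "t \<in> cbox 0 1" for x t
    unfolding fx_def
  proof (rule bounded_linear_Blinfun_apply)
    have "linear (\<lambda>w. \<Sum>b\<in>Basis. ((x - a) \<bullet> b) *\<^sub>R D b (?\<gamma> x t) w)"
      by (intro linear_compose_sum ballI linear_compose_scale_right linD seg that)
    then have "linear (\<lambda>w. D w (?\<gamma> x t) (x - a))"
      unfolding sumD[OF seg[OF that]] .
    then show "bounded_linear (\<lambda>w. t *\<^sub>R D w (?\<gamma> x t) (x - a) + \<omega> (?\<gamma> x t) w)"
      unfolding linear_conv_bounded_linear[symmetric]
      by (intro linear_compose_add linear_compose_scale_right lin seg that)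
  qed
  have cont_\<gamma>: "continuous_on (?U \<times> cbox 0 1) (\<lambda>z. ?\<gamma> (fst z) (snd z))"
    by (intro continuous_intros)
  have comp: "continuous_on (?U \<times> cbox 0 1) (\<lambda>z. k (?\<gamma> (fst z) (snd z)))" if "continuous_on ?U k" for k :: "'a \<Rightarrow> 'c"
    by (rule continuous_on_compose2[OF that cont_\<gamma>]) (use seg in auto)
  have cont_D: "continuous_on (?U \<times> cbox 0 1) (\<lambda>z. D b (?\<gamma> (fst z) (snd z)) i)" for b i
    unfolding D_def by (rule comp[OF smooth_on_continuous[OF smooth_on_frechet[OF smooth]]])
  have cont_\<omega>: "continuous_on (?U \<times> cbox 0 1) (\<lambda>z. \<omega> (?\<gamma> (fst z) (snd z)) i)" for i
    by (rule comp[OF smooth_on_continuous[OF smooth]])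
  have cont_fx: "continuous_on (?U \<times> cbox 0 1) (\<lambda>z. fx (fst z) (snd z))"
  proof (rule continuous_on_blinfun_componentwise)
    fix i :: 'a
    have eq: "t *\<^sub>R (\<Sum>b\<in>Basis. ((x - a) \<bullet> b) *\<^sub>R D b (?\<gamma> x t) i) + \<omega> (?\<gamma> x t) i = fx x t i"
      if "x \<in> ?U" "t \<in> cbox 0 1" for x t
      unfolding fx[OF that] sumD[OF seg[OF that]] ..
    have "continuous_on (?U \<times> cbox 0 1)
       (\<lambda>z. snd z *\<^sub>R (\<Sum>b\<in>Basis. ((fst z - a) \<bullet> b) *\<^sub>R D b (?\<gamma> (fst z) (snd z)) i) + \<omega> (?\<gamma> (fst z) (snd z)) i)"
      by (intro continuous_intros cont_D cont_\<omega>)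
    then show "continuous_on (?U \<times> cbox 0 1) (\<lambda>z. blinfun_apply (fx (fst z) (snd z)) i)"
      by (rule continuous_on_eq) (simp only: eq mem_Times_iff)
  qed
  have deriv: "((\<lambda>x. integral (cbox 0 1) (\<lambda>t. \<omega> (?\<gamma> x t) (x - a))) has_derivative integral (cbox 0 1) (fx x)) (at x within ?U)"
    and int_fx: "fx x integrable_on cbox 0 1" if "x \<in> ?U" for x
  proof -
    show "((\<lambda>x. integral (cbox 0 1) (\<lambda>t. \<omega> (?\<gamma> x t) (x - a))) has_derivative integral (cbox 0 1) (fx x)) (at x within ?U)"
    proof (rule leibniz_rule[OF _ _ _ that convex_ball])
      fix x t assume xt: "x \<in> ?U" "t \<in> cbox (0::real) 1"
      have g: "((\<lambda>x. ?\<gamma> x t) has_derivative (\<lambda>w. t *\<^sub>R w)) (at x within ?U)"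
        by (auto intro!: derivative_eq_intros)
      have "((\<lambda>x. \<Sum>b\<in>Basis. ((x - a) \<bullet> b) *\<^sub>R \<omega> (?\<gamma> x t) b) has_derivative
         (\<lambda>w. \<Sum>b\<in>Basis. ((x - a) \<bullet> b) *\<^sub>R D b (?\<gamma> x t) (t *\<^sub>R w) + (w \<bullet> b) *\<^sub>R \<omega> (?\<gamma> x t) b)) (at x within ?U)"
        by (intro has_derivative_sum has_derivative_scaleR has_derivative_compose[OF g dw[OF seg[OF xt]]])
           (auto intro!: derivative_eq_intros)
      then have "((\<lambda>x. \<omega> (?\<gamma> x t) (x - a)) has_derivative
         (\<lambda>w. \<Sum>b\<in>Basis. ((x - a) \<bullet> b) *\<^sub>R D b (?\<gamma> x t) (t *\<^sub>R w) + (w \<bullet> b) *\<^sub>R \<omega> (?\<gamma> x t) b)) (at x within ?U)"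
        by (rule has_derivative_transform[OF xt(1), rotated]) (rule expand[OF seg[OF _ xt(2)]])
      moreover have "(\<Sum>b\<in>Basis. ((x - a) \<bullet> b) *\<^sub>R D b (?\<gamma> x t) (t *\<^sub>R w) + (w \<bullet> b) *\<^sub>R \<omega> (?\<gamma> x t) b)
          = t *\<^sub>R D w (?\<gamma> x t) (x - a) + \<omega> (?\<gamma> x t) w" for w
      proof -
        have "(\<Sum>b\<in>Basis. ((x - a) \<bullet> b) *\<^sub>R D b (?\<gamma> x t) (t *\<^sub>R w)) =
            t *\<^sub>R (\<Sum>b\<in>Basis. ((x - a) \<bullet> b) *\<^sub>R D b (?\<gamma> x t) w)"
          by (simp add: linear_scale[OF linD[OF seg[OF xt]]] scaleR_sum_right mult.commute)
        then show ?thesis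
          unfolding sum.distrib expand[OF seg[OF xt], of w, symmetric] sumD[OF seg[OF xt]] by simp
      qed
      ultimately show "((\<lambda>x. \<omega> (?\<gamma> x t) (x - a)) has_derivative blinfun_apply (fx x t)) (at x within ?U)"
        unfolding fx[OF xt] by simp
    next
      fix x assume x: "x \<in> ?U"
      have "continuous_on (cbox 0 1) (\<lambda>t. \<omega> (?\<gamma> x t) (x - a))"
        by (rule continuous_on_compose2[OF smooth_on_continuous[OF smooth]])
           (use seg[OF x] in \<open>auto intro!: continuous_intros\<close>)
      then show "(\<lambda>t. \<omega> (?\<gamma> x t) (x - a)) integrable_on cbox 0 1"
        by (rule integrable_continuous)
    next
      show "continuous_on (?U \<times> cbox 0 1) (\<lambda>(x, t). fx x t)"
        using cont_fx by (simp add: case_prod_beta)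
    qed
    have "continuous_on (cbox 0 1) (\<lambda>t. fx (fst (x, t)) (snd (x, t)))"
      by (rule continuous_on_compose2[OF cont_fx]) (use that in \<open>auto intro!: continuous_intros\<close>)
    then show "fx x integrable_on cbox 0 1"
      by (intro integrable_continuous) simp
  qed
  have int_value: "integral (cbox 0 1) (fx x) w = \<omega> x w" if x: "x \<in> ?U" for x w
  proof -
    \<comment> \<open>An exact derivative, that of
      \<open>t *\<^sub>R \<omega> (?\<gamma> x t) w\<close>. The factor \<open>t\<close> removes the
      contribution of the centre.\<close>
    have "((\<lambda>t. t *\<^sub>R D w (?\<gamma> x t) (x - a) + \<omega> (?\<gamma> x t) w) has_integral 1 *\<^sub>R \<omega> (?\<gamma> x 1) w - 0 *\<^sub>R \<omega> (?\<gamma> x 0) w) {0..1}"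
    proof (rule fundamental_theorem_of_calculus)
      fix t :: real assume "t \<in> {0..1}"
      then have s: "?\<gamma> x t \<in> ?U" using seg[OF x] by simp
      have "((\<lambda>t. \<omega> (?\<gamma> x t) w) has_vector_derivative D w (?\<gamma> x t) (x - a)) (at t within {0..1})"
        unfolding D_def by (rule smooth_on_has_vector_derivative_line[OF smooth s])
      from has_vector_derivative_scaleR[OF DERIV_ident this]
      show "((\<lambda>t. t *\<^sub>R \<omega> (?\<gamma> x t) w) has_vector_derivative
          t *\<^sub>R D w (?\<gamma> x t) (x - a) + \<omega> (?\<gamma> x t) w) (at t within {0..1})"
        by simp
    qed simp
    then have "((\<lambda>t. t *\<^sub>R D w (?\<gamma> x t) (x - a) + \<omega> (?\<gamma> x t) w) has_integral \<omega> x w) (cbox 0 1)"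
      by simp
    then have "((\<lambda>t. fx x t w) has_integral \<omega> x w) (cbox 0 1)"
      by (rule has_integral_eq[rotated]) (simp only: fx[OF x])
    then have "integral (cbox 0 1) (\<lambda>t. fx x t w) = \<omega> x w"
      by (rule integral_unique)
    then show ?thesis by (simp only: blinfun_apply_integral[OF int_fx[OF x]])
  qed
  show ?thesis
  proof (intro exI ballI)
    fix x assume x: "x \<in> ?U"
    have "blinfun_apply (integral (cbox 0 1) (fx x)) = \<omega> x" using int_value[OF x] by blast
    then show "((\<lambda>x. integral (cbox 0 1) (\<lambda>t. \<omega> (?\<gamma> x t) (x - a))) has_derivative \<omega> x) (at x)"
      using deriv[OF x] at_within_open[OF x open_ball] by simp
  qed
qed

section \<open>Monodromy\<close>

text \<open>Models the primitives of a closed form. Increments are compared only near a point,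
  because two primitives may differ by different constants on different components of the
  overlap.\<close>

definition local_primitives :: "('m::topological_space set \<times> ('m \<Rightarrow> 'c::real_normed_vector)) set \<Rightarrow> bool" where
  "local_primitives \<F> \<longleftrightarrow> (\<forall>U h. (U, h) \<in> \<F> \<longrightarrow> open U) \<and> (\<forall>x. \<exists>U h. (U, h) \<in> \<F> \<and> x \<in> U) \<and>
     (\<forall>U h V k x. (U, h) \<in> \<F> \<longrightarrow> (V, k) \<in> \<F> \<longrightarrow> x \<in> U \<inter> V \<longrightarrow>
        (\<exists>W. open W \<and> x \<in> W \<and> (\<forall>y\<in>W. h y - h x = k y - k x)))"

text \<open>Along \<open>H\<close>, the function \<open>K\<close> behaves like the pull-back of a global primitive, which need not exist.\<close>

definition continuation ::
  "('m set \<times> ('m \<Rightarrow> 'c::real_normed_vector)) set \<Rightarrow> 'e::metric_space set \<Rightarrow> ('e \<Rightarrow> 'm) \<Rightarrow> ('e \<Rightarrow> 'c) \<Rightarrow> bool" where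
  "continuation \<F> S H K \<longleftrightarrow> (\<forall>x\<in>S. \<forall>U h. (U, h) \<in> \<F> \<longrightarrow> H x \<in> U \<longrightarrow>
     (\<exists>e>0. \<forall>y\<in>S. dist y x < e \<longrightarrow> K y - K x = h (H y) - h (H x)))"

lemma continuationD:
  assumes "continuation \<F> S H K" "x \<in> S" "(U, h) \<in> \<F>" "H x \<in> U"
  obtains e where "e > 0" "\<And>y. y \<in> S \<Longrightarrow> dist y x < e \<Longrightarrow> K y - K x = h (H y) - h (H x)"
  using assms unfolding continuation_def by blast

lemma continuation_cong:
  "continuation \<F> S H K \<Longrightarrow> (\<And>x. x \<in> S \<Longrightarrow> H x = H' x) \<Longrightarrow> continuation \<F> S H' K"
  unfolding continuation_def by auto

lemma continuation_compose:
  assumes "continuation \<F> S H K" "continuous_on T \<phi>" "\<phi> ` T \<subseteq> S"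
  shows "continuation \<F> T (\<lambda>t. H (\<phi> t)) (\<lambda>t. K (\<phi> t))"
  unfolding continuation_def
proof (intro ballI allI impI)
  fix t U h assume t: "t \<in> T" "(U, h) \<in> \<F>" "H (\<phi> t) \<in> U"
  then obtain e where e: "e > 0" "\<And>y. y \<in> S \<Longrightarrow> dist y (\<phi> t) < e \<Longrightarrow> K y - K (\<phi> t) = h (H y) - h (H (\<phi> t))"
    using continuationD[OF assms(1), of "\<phi> t"] assms(3) by blast
  obtain d where "d > 0" "\<And>s. s \<in> T \<Longrightarrow> dist s t < d \<Longrightarrow> dist (\<phi> s) (\<phi> t) < e"
    using assms(2) t(1) e(1) unfolding continuous_on_iff by blast
  then show "\<exists>e>0. \<forall>s\<in>T. dist s t < e \<longrightarrow> K (\<phi> s) - K (\<phi> t) = h (H (\<phi> s)) - h (H (\<phi> t))"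
    using e(2) assms(3) by blast
qed

lemma local_primitives_cover:
  assumes "local_primitives \<F>"
  obtains U h where "(U, h) \<in> \<F>" "x \<in> U"
  using assms[unfolded local_primitives_def, THEN conjunct2, THEN conjunct1] by blast

lemma local_primitives_open: "local_primitives \<F> \<Longrightarrow> (U, h) \<in> \<F> \<Longrightarrow> open U"
  using local_primitives_def[THEN iffD1, THEN conjunct1] by blast

lemma local_primitives_overlap:
  assumes "local_primitives \<F>" "(U, h) \<in> \<F>" "(V, k) \<in> \<F>" "x \<in> U" "x \<in> V"
  shows "\<exists>W. open W \<and> x \<in> W \<and> (\<forall>y\<in>W. h y - h x = k y - k x)"
  using assms(1)[unfolded local_primitives_def, THEN conjunct2, THEN conjunct2, rule_format, OF assms(2,3)]
    assms(4,5) by simp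

text \<open>The difference of two continuations is locally constant, since both have the increments
  of the same local primitive.\<close>

lemma continuation_unique:
  assumes \<F>: "local_primitives \<F>" and S: "connected S" "x \<in> S" "y \<in> S"
    and K: "continuation \<F> S H K" "continuation \<F> S H K'"
  shows "K y - K x = K' y - K' x"
proof -
  have "(\<lambda>x. K x - K' x) constant_on S"
  proof (rule locally_constant_imp_constant[OF S(1)])
    fix a assume a: "a \<in> S"
    obtain U h where U: "(U, h) \<in> \<F>" "H a \<in> U" using local_primitives_cover[OF \<F>] .
    obtain e1 where e1: "e1 > 0" "\<And>y. y \<in> S \<Longrightarrow> dist y a < e1 \<Longrightarrow> K y - K a = h (H y) - h (H a)"
      by (rule continuationD[OF K(1) a U]) blast
    obtain e2 where e2: "e2 > 0" "\<And>y. y \<in> S \<Longrightarrow> dist y a < e2 \<Longrightarrow> K' y - K' a = h (H y) - h (H a)"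
      by (rule continuationD[OF K(2) a U]) blast
    show "\<exists>T. openin (top_of_set S) T \<and> a \<in> T \<and> (\<forall>x\<in>T. K x - K' x = K a - K' a)"
    proof (intro exI[of _ "S \<inter> ball a (min e1 e2)"] conjI ballI)
      fix x assume "x \<in> S \<inter> ball a (min e1 e2)"
      then have "K x - K a = K' x - K' a" using e1(2)[of x] e2(2)[of x] by (simp add: dist_commute)
      then show "K x - K' x = K a - K' a" by (simp add: algebra_simps)
    qed (use a e1 e2 in auto)
  qed
  then have "K x - K' x = K y - K' y" using S unfolding constant_on_def by metis
  then show ?thesis by (simp add: algebra_simps)
qed

lemma continuous_on_preimage_ball:
  assumes "continuous_on S H" "x \<in> S" "open W" "H x \<in> W"
  shows "\<exists>e>0. \<forall>y\<in>S. dist y x < e \<longrightarrow> H y \<in> W"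
proof -
  obtain G where G: "open G" "G \<inter> S = H -` W \<inter> S"
    using assms unfolding continuous_on_open_invariant by blast
  then have "x \<in> G" using assms by auto
  then obtain e where "e > 0" "ball x e \<subseteq> G" using G(1) openE by blast
  then show ?thesis using G(2) by (intro exI[of _ e]) (auto simp: dist_commute subset_iff set_eq_iff)
qed

text \<open>As long as \<open>H\<close> stays in one domain, its primitive is itself a continuation;
  the overlap condition gives compatibility with all the others.\<close>

lemma continuation_within:
  assumes \<F>: "local_primitives \<F>" and H: "continuous_on S H" "H ` S \<subseteq> U" and U: "(U, h) \<in> \<F>"
  shows "continuation \<F> S H (\<lambda>x. h (H x))"
  unfolding continuation_def
proof (intro ballI allI impI)
  fix x V k assume x: "x \<in> S" "(V, k) \<in> \<F>" "H x \<in> V"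
  have "H x \<in> U" using x H(2) by blast
  then obtain W where W: "open W" "H x \<in> W" "\<forall>y\<in>W. h y - h (H x) = k y - k (H x)"
    using local_primitives_overlap[OF \<F> U x(2) _ x(3)] by blast
  obtain e where "e > 0" "\<And>y. y \<in> S \<Longrightarrow> dist y x < e \<Longrightarrow> H y \<in> W"
    using continuous_on_preimage_ball[OF H(1) x(1) W(1,2)] by blast
  then show "\<exists>e>0. \<forall>y\<in>S. dist y x < e \<longrightarrow> h (H y) - h (H x) = k (H y) - k (H x)"
    using W(3) by blast
qed

text \<open>The increments between nearby points are well defined because small pieces of \<open>S\<close> are
  connected; on a star-shaped set they can be added up along the segments from the centre.\<close>

lemma continuation_exists:
  fixes H :: "'e::euclidean_space \<Rightarrow> 'm::topological_space"
  assumes \<F>: "local_primitives \<F>" and S: "compact S" "convex S" "a \<in> S" and H: "continuous_on S H"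
  shows "\<exists>K. continuation \<F> S H K"
proof -
  define \<G> where "\<G> = {G. open G \<and> (\<exists>U h. (U, h) \<in> \<F> \<and> H ` (G \<inter> S) \<subseteq> U)}"
  have pre: "\<exists>G. open G \<and> x \<in> G \<and> H ` (G \<inter> S) \<subseteq> U" if "x \<in> S" "open U" "H x \<in> U" for x U
  proof -
    obtain G where "open G" "G \<inter> S = H -` U \<inter> S"
      using H \<open>open U\<close> unfolding continuous_on_open_invariant by blast
    then show ?thesis using that by (intro exI[of _ G]) auto
  qed
  have cover: "S \<subseteq> \<Union>\<G>"
  proof
    fix x assume x: "x \<in> S"
    obtain U h where "(U, h) \<in> \<F>" "H x \<in> U" using local_primitives_cover[OF \<F>] .
    moreover obtain G where "open G" "x \<in> G" "H ` (G \<inter> S) \<subseteq> U"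
      using pre[OF x local_primitives_open[OF \<F>]] calculation by blast
    ultimately show "x \<in> \<Union>\<G>" unfolding \<G>_def by blast
  qed
  have opn: "open G" if "G \<in> \<G>" for G using that by (simp add: \<G>_def)
  \<comment> \<open>A Lebesgue number: \<open>H\<close> maps the part of \<open>S\<close> within
    this distance of any of its points into a single domain.\<close>
  have "\<exists>\<epsilon>>0. \<forall>x\<in>S. \<exists>G\<in>\<G>. ball x \<epsilon> \<subseteq> G"
    by (rule Heine_Borel_lemma[OF S(1) cover opn]) blast+
  then obtain \<epsilon> where \<epsilon>: "\<epsilon> > 0" and eG: "\<And>x. x \<in> S \<Longrightarrow> \<exists>G\<in>\<G>. ball x \<epsilon> \<subseteq> G"
    by blast
  have "\<exists>U h. (U, h) \<in> \<F> \<and> H ` (ball x \<epsilon> \<inter> S) \<subseteq> U" if x: "x \<in> S" for x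
  proof -
    obtain G where G: "G \<in> \<G>" "ball x \<epsilon> \<subseteq> G" using eG[OF x] by blast
    then obtain U h where "(U, h) \<in> \<F>" "H ` (G \<inter> S) \<subseteq> U" unfolding \<G>_def by blast
    then show ?thesis using G(2) by blast
  qed
  then obtain u h where uh: "\<And>x. x \<in> S \<Longrightarrow> (u x, h x) \<in> \<F> \<and> H ` (ball x \<epsilon> \<inter> S) \<subseteq> u x"
    by metis
  \<comment> \<open>On a convex piece lying in two domains, the increment of either primitive is the
    same, by uniqueness of continuations on connected sets.\<close>
  have indep: "k (H z) - k (H y) = k' (H z) - k' (H y)"
    if "(U, k) \<in> \<F>" "(U', k') \<in> \<F>" "C \<subseteq> S" "convex C" "y \<in> C" "z \<in> C" "H ` C \<subseteq> U" "H ` C \<subseteq> U'" for U U' k k' C y z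
    using that continuous_on_subset[OF H that(3)]
    by (intro continuation_unique[OF \<F> convex_connected, of C y z H "\<lambda>x. k (H x)" "\<lambda>x. k' (H x)"])
       (auto intro: continuation_within[OF \<F>])
  define \<delta> where "\<delta> x y = h x (H y) - h x (H x)" for x y
  have \<delta>: "\<delta> y z = h x (H z) - h x (H y)" if "x \<in> S" "y \<in> S" "z \<in> S" "dist x y < \<epsilon>" "dist x z < \<epsilon>" "dist y z < \<epsilon>" for x y z
    unfolding \<delta>_def using uh[OF that(1)] uh[OF that(2)] that \<epsilon>
    by (intro indep[of "u y" _ "u x" _ "ball x \<epsilon> \<inter> ball y \<epsilon> \<inter> S"]) (auto intro: convex_Int S simp: dist_commute)
  have add: "\<delta> x y + \<delta> y z = \<delta> x z" if "x \<in> S" "y \<in> S" "z \<in> S" "dist x y < \<epsilon>" "dist x z < \<epsilon>" "dist y z < \<epsilon>" for x y z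
    using \<delta>[OF that] by (simp add: \<delta>_def)
  obtain R where R: "\<And>x. x \<in> S \<Longrightarrow> norm (x - a) \<le> R"
    using compact_imp_bounded[OF S(1)] unfolding bounded_any_center[of S a] dist_norm norm_minus_commute[of a]
    by blast
  \<comment> \<open>With this many steps, consecutive points on each segment from \<open>a\<close>
    are less than \<open>\<epsilon> / 2\<close> apart.\<close>
  obtain n :: nat where n: "R / (\<epsilon> / 2) < real n" using reals_Archimedean2 by blast
  have R0: "R \<ge> 0" using R[OF S(3)] by simp
  then have n0: "n > 0" using n \<epsilon> by (cases n) (auto simp: divide_less_0_iff)
  define p where "p k x = a + (real k / real n) *\<^sub>R (x - a)" for k x
  have pS: "p k x \<in> S" if "x \<in> S" "k \<le> n" for k x
  proof -
    have "p k x = (1 - real k / real n) *\<^sub>R a + (real k / real n) *\<^sub>R x" by (simp add: p_def algebra_simps)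
    also have "\<dots> \<in> S" using that n0 by (intro convexD[OF S(2,3)]) auto
    finally show ?thesis .
  qed
  have step: "dist (p k x) (p (Suc k) x) < \<epsilon> / 2" if "x \<in> S" for k x
  proof -
    have "p k x - p (Suc k) x = - ((1 / real n) *\<^sub>R (x - a))"
      by (simp add: p_def algebra_simps add_divide_distrib)
    then have "dist (p k x) (p (Suc k) x) = norm (x - a) / real n" by (simp add: dist_norm)
    also have "\<dots> \<le> R / real n" using R[OF that] by (intro divide_right_mono) auto
    also have "\<dots> < \<epsilon> / 2" using n n0 \<epsilon> by (simp add: field_simps)
    finally show ?thesis .
  qed
  have close: "dist (p k x) (p k y) \<le> dist x y" if "k \<le> n" for k x y
  proof -
    have "p k x - p k y = (real k / real n) *\<^sub>R (x - y)" by (simp add: p_def algebra_simps)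
    then have "dist (p k x) (p k y) = (real k / real n) * dist x y" by (simp add: dist_norm)
    also have "\<dots> \<le> 1 * dist x y" using that n0 by (intro mult_right_mono) auto
    finally show ?thesis by simp
  qed
  define K where "K x = (\<Sum>k<n. \<delta> (p k x) (p (Suc k) x))" for x
  have K: "K y - K x = \<delta> x y" if xy: "x \<in> S" "y \<in> S" "dist x y < \<epsilon> / 2" for x y
  proof -
    \<comment> \<open>Cuts the quadrilateral between neighbouring segments along a diagonal. Its
      sides are shorter than \<open>\<epsilon> / 2\<close>, hence the diagonal is shorter than
      \<open>\<epsilon>\<close> and additivity applies to both triangles. The resulting sum
      telescopes.\<close>
    have "\<delta> (p k y) (p (Suc k) y) - \<delta> (p k x) (p (Suc k) x) = \<delta> (p (Suc k) x) (p (Suc k) y) - \<delta> (p k x) (p k y)"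
      if "k < n" for k
    proof -
      have d: "dist (p k x) (p (Suc k) x) < \<epsilon> / 2" "dist (p k y) (p (Suc k) y) < \<epsilon> / 2"
        "dist (p k x) (p k y) < \<epsilon> / 2" "dist (p (Suc k) x) (p (Suc k) y) < \<epsilon> / 2"
        using step xy close[of k x y] close[of "Suc k" x y] that by auto
      have d': "dist (p k x) (p (Suc k) y) < \<epsilon>"
        using dist_triangle_half_r[of "p k y" "p k x" \<epsilon> "p (Suc k) y"] d by (simp add: dist_commute)
      have "\<delta> (p k x) (p (Suc k) x) + \<delta> (p (Suc k) x) (p (Suc k) y) = \<delta> (p k x) (p (Suc k) y)"
        using d d' \<epsilon> that xy by (intro add pS) auto
      moreover have "\<delta> (p k x) (p k y) + \<delta> (p k y) (p (Suc k) y) = \<delta> (p k x) (p (Suc k) y)"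
        using d d' \<epsilon> that xy by (intro add pS) auto
      ultimately show ?thesis by (simp add: algebra_simps)
    qed
    then have "K y - K x = (\<Sum>k<n. \<delta> (p (Suc k) x) (p (Suc k) y) - \<delta> (p k x) (p k y))"
      unfolding K_def sum_subtractf[symmetric] by (intro sum.cong) auto
    also have "\<dots> = \<delta> (p n x) (p n y) - \<delta> (p 0 x) (p 0 y)" by (rule sum_lessThan_telescope)
    also have "\<dots> = \<delta> x y" using n0 by (simp add: p_def \<delta>_def)
    finally show ?thesis .
  qed
  have "continuation \<F> S H K"
    unfolding continuation_def
  proof (intro ballI allI impI)
    fix x U k assume x: "x \<in> S" "(U, k) \<in> \<F>" "H x \<in> U"
    obtain G where G: "open G" "x \<in> G" "H ` (G \<inter> S) \<subseteq> U"
      using pre[OF x(1) local_primitives_open[OF \<F> x(2)] x(3)] by blast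
    then obtain e where e: "e > 0" "ball x e \<subseteq> G" using openE by blast
    have "K y - K x = k (H y) - k (H x)" if y: "y \<in> S" "dist y x < min e (\<epsilon> / 2)" for y
    proof -
      have "K y - K x = \<delta> x y" using y x by (intro K) (auto simp: dist_commute)
      also have "\<dots> = k (H y) - k (H x)"
        unfolding \<delta>_def using uh[OF x(1)] x y e G \<epsilon>
        by (intro indep[of "u x" _ U _ "ball x (min e \<epsilon>) \<inter> S"])
           (auto intro: convex_Int S simp: dist_commute subset_iff image_subset_iff)
      finally show ?thesis .
    qed
    then show "\<exists>e>0. \<forall>y\<in>S. dist y x < e \<longrightarrow> K y - K x = k (H y) - k (H x)"
      using e(1) \<epsilon> by (intro exI[of _ "min e (\<epsilon> / 2)"]) auto
  qed
  then show ?thesis by blast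
qed

lemma continuation_path_exists:
  assumes "local_primitives \<F>" "path \<gamma>"
  shows "\<exists>K. continuation \<F> {0..1} \<gamma> K"
  using assms by (intro continuation_exists[where a = 0]) (auto simp: path_def)

text \<open>The homotopy is continued over the whole square. It passes through loops, so the two
  sides traced by the end points carry the same map and contribute equal increments; comparing the
  other two sides gives the claim.\<close>

lemma continuation_homotopic_loops:
  assumes \<F>: "local_primitives \<F>" and hom: "homotopic_loops UNIV p q"
    and K: "continuation \<F> {0..1} p Kp" "continuation \<F> {0..1} q Kq"
  shows "Kp 1 - Kp 0 = Kq 1 - Kq 0"
proof -
  let ?I = "{0..1::real}"
  obtain H where H: "continuous_on (?I \<times> ?I) H" and
    ends: "\<And>t. t \<in> ?I \<Longrightarrow> H (0, t) = p t" "\<And>t. t \<in> ?I \<Longrightarrow> H (1, t) = q t"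
    and loop: "\<And>t. t \<in> ?I \<Longrightarrow> H (t, 0) = H (t, 1)"
    using hom unfolding homotopic_loops by (auto simp: pathstart_def pathfinish_def)
  obtain K where K': "continuation \<F> (?I \<times> ?I) H K"
    using continuation_exists[OF \<F> _ _ _ H, of "(0, 0)"] by (auto intro: compact_Times convex_Times)
  note comp = continuation_compose[OF K']
  have "K (0, 1) - K (0, 0) = Kp 1 - Kp 0"
    by (rule continuation_unique[OF \<F> _ _ _ comp[of ?I "\<lambda>t. (0, t)"]])
       (auto intro!: continuous_intros continuation_cong[OF K(1)] simp: ends)
  moreover have "K (1, 1) - K (1, 0) = Kq 1 - Kq 0"
    by (rule continuation_unique[OF \<F> _ _ _ comp[of ?I "\<lambda>t. (1, t)"]])
       (auto intro!: continuous_intros continuation_cong[OF K(2)] simp: ends)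
  moreover have "K (1, 0) - K (0, 0) = K (1, 1) - K (0, 1)"
    by (rule continuation_unique[OF \<F> _ _ _ comp[of ?I "\<lambda>t. (t, 0)"] continuation_cong[OF comp[of ?I "\<lambda>t. (t, 1)"]]])
       (auto intro!: continuous_intros simp: loop)
  moreover have "(K (0, 1) - K (0, 0)) - (K (1, 1) - K (1, 0)) = (K (1, 0) - K (0, 0)) - (K (1, 1) - K (0, 1))"
    by simp
  ultimately show ?thesis by simp
qed

text \<open>All loops are homotopic, in particular the constant ones at \<open>p\<close> and
  \<open>q\<close>; the track of the base point under such a homotopy joins them.\<close>

lemma simply_connected_path:
  assumes "simply_connected (UNIV :: 'm::topological_space set)"
  shows "\<exists>\<gamma>. path \<gamma> \<and> pathstart \<gamma> = p \<and> pathfinish \<gamma> = (q :: 'm)"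
proof -
  have "homotopic_loops UNIV (\<lambda>t. p) (\<lambda>t. q)"
    using assms unfolding simply_connected_def by (auto simp: path_def pathstart_def pathfinish_def)
  then obtain H where H: "continuous_on ({0..1} \<times> {0..1::real}) H" "H (0::real, 0) = p" "H (1, 0) = q"
    unfolding homotopic_loops by force
  have "path (\<lambda>t. H (t, 0))"
    unfolding path_def by (rule continuous_on_compose2[OF H(1)]) (auto intro!: continuous_intros)
  then show ?thesis
    using H by (intro exI[of _ "\<lambda>t. H (t, 0)"]) (auto simp: pathstart_def pathfinish_def)
qed

text \<open>The value at a point is the increment of a continuation along any path from a base
  point. Two such paths form a loop, which is homotopic to a constant one and so has increment zero.
  By \<open>lpc\<close>, nearby points are joined to \<open>p\<close> inside one domain
  \<open>U\<close>, where the increment is that of \<open>h\<close>.\<close>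

lemma simply_connected_primitive:
  fixes \<F> :: "('m::topological_space set \<times> ('m \<Rightarrow> 'c::real_normed_vector)) set"
  assumes \<F>: "local_primitives \<F>" and sc: "simply_connected (UNIV :: 'm set)"
    and lpc: "\<And>x (U :: 'm set). open U \<Longrightarrow> x \<in> U \<Longrightarrow>
      \<exists>W. open W \<and> x \<in> W \<and> W \<subseteq> U \<and> (\<forall>y\<in>W. \<exists>\<gamma>. path \<gamma> \<and> path_image \<gamma> \<subseteq> U \<and> pathstart \<gamma> = x \<and> pathfinish \<gamma> = y)"
  shows "\<exists>F. \<forall>U h p. (U, h) \<in> \<F> \<longrightarrow> p \<in> U \<longrightarrow> (\<exists>W. open W \<and> p \<in> W \<and> (\<forall>q\<in>W. F q - F p = h q - h p))"
proof -
  let ?I = "{0..1::real}"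
  have const: "path (\<lambda>t. p)" for p :: 'm by (simp add: path_def)
  have loop0: "K 1 = K 0" if \<gamma>: "path \<gamma>" "pathfinish \<gamma> = pathstart \<gamma>" and K: "continuation \<F> ?I \<gamma> K" for \<gamma> K
  proof -
    have "homotopic_loops UNIV \<gamma> (\<lambda>t. \<gamma> 0)"
      using sc \<gamma> const unfolding simply_connected_def by (auto simp: pathstart_def pathfinish_def)
    moreover have "continuation \<F> ?I (\<lambda>t. \<gamma> 0) (\<lambda>t. 0)"
      unfolding continuation_def by (auto intro: exI[of _ 1])
    ultimately show ?thesis using continuation_homotopic_loops[OF \<F> _ K] by fastforce
  qed
  \<comment> \<open>Any base point will do: changing it alters the primitive by a constant.\<close>
  define p\<^sub>0 :: 'm where "p\<^sub>0 = undefined"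
  define reach where "reach p c \<longleftrightarrow> (\<exists>\<gamma> K. path \<gamma> \<and> pathstart \<gamma> = p\<^sub>0 \<and> pathfinish \<gamma> = p \<and>
     continuation \<F> ?I \<gamma> K \<and> c = K 1 - K 0)" for p c
  have ex: "\<exists>c. reach p c" for p
  proof -
    obtain \<gamma> where \<gamma>: "path \<gamma>" "pathstart \<gamma> = p\<^sub>0" "pathfinish \<gamma> = p"
      using simply_connected_path[OF sc] by blast
    then show ?thesis
      using continuation_path_exists[OF \<F> \<gamma>(1)] unfolding reach_def by blast
  qed
  have first: "K (1/2) - K 0 = K' 1 - K' 0"
    if "continuation \<F> ?I (\<gamma> +++ \<gamma>') K" "continuation \<F> ?I \<gamma> K'" for \<gamma> \<gamma>' K K'
  proof -
    have "continuation \<F> ?I (\<lambda>t. (\<gamma> +++ \<gamma>') (t / 2)) (\<lambda>t. K (t / 2))"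
      by (rule continuation_compose[OF that(1)]) (auto intro!: continuous_intros)
    then have "continuation \<F> ?I \<gamma> (\<lambda>t. K (t / 2))"
      by (rule continuation_cong) (simp add: joinpaths_def)
    then show ?thesis using continuation_unique[OF \<F> _ _ _ _ that(2), of 0 1 "\<lambda>t. K (t / 2)"] by simp
  qed
  have second: "K 1 - K (1/2) = K' 1 - K' 0"
    if "continuation \<F> ?I (\<gamma> +++ \<gamma>') K" "continuation \<F> ?I \<gamma>' K'" "pathfinish \<gamma> = pathstart \<gamma>'" for \<gamma> \<gamma>' K K'
  proof -
    have "continuation \<F> ?I (\<lambda>t. (\<gamma> +++ \<gamma>') ((1 + t) / 2)) (\<lambda>t. K ((1 + t) / 2))"
      by (rule continuation_compose[OF that(1)]) (auto intro!: continuous_intros)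
    then have "continuation \<F> ?I \<gamma>' (\<lambda>t. K ((1 + t) / 2))"
      by (rule continuation_cong) (use that(3) in \<open>auto simp: joinpaths_def pathstart_def pathfinish_def field_simps\<close>)
    then show ?thesis using continuation_unique[OF \<F> _ _ _ _ that(2), of 0 1 "\<lambda>t. K ((1 + t) / 2)"] by simp
  qed
  have uniq: "c = c'" if r: "reach p c" "reach p c'" for p c c'
  proof -
    obtain \<gamma> K1 where 1: "path \<gamma>" "pathstart \<gamma> = p\<^sub>0" "pathfinish \<gamma> = p" "continuation \<F> ?I \<gamma> K1" "c = K1 1 - K1 0"
      using r(1) unfolding reach_def by blast
    obtain \<gamma>' K2 where 2: "path \<gamma>'" "pathstart \<gamma>' = p\<^sub>0" "pathfinish \<gamma>' = p" "continuation \<F> ?I \<gamma>' K2" "c' = K2 1 - K2 0"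
      using r(2) unfolding reach_def by blast
    have \<gamma>: "path (\<gamma> +++ reversepath \<gamma>')" using 1 2 by simp
    obtain K where K: "continuation \<F> ?I (\<gamma> +++ reversepath \<gamma>') K"
      using continuation_path_exists[OF \<F> \<gamma>] by blast
    \<comment> \<open>The reversed path contributes the opposite increment, so the loop gives c - c'
      = 0.\<close>
    have r: "continuation \<F> ?I (reversepath \<gamma>') (\<lambda>t. K2 (1 - t))"
      unfolding reversepath_def by (rule continuation_compose[OF 2(4)]) (auto intro!: continuous_intros)
    have "K 1 = K 0" using loop0[OF \<gamma> _ K] 1 2 by simp
    moreover have "K (1/2) - K 0 = c" using first[OF K 1(4)] 1 by simp
    moreover have "K 1 - K (1/2) = - c'" using second[OF K r] 1 2 by simp
    ultimately show ?thesis by (simp add: algebra_simps)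
  qed
  define F where "F p = (THE c. reach p c)" for p
  have F: "reach p (F p)" for p unfolding F_def by (rule theI') (use ex uniq in blast)
  show ?thesis
  proof (intro exI[of _ F] allI impI)
    fix U h p assume U: "(U, h) \<in> \<F>" "p \<in> U"
    obtain W where W: "open W" "p \<in> W" "W \<subseteq> U"
      "\<And>y. y \<in> W \<Longrightarrow> \<exists>\<gamma>. path \<gamma> \<and> path_image \<gamma> \<subseteq> U \<and> pathstart \<gamma> = p \<and> pathfinish \<gamma> = y"
      using lpc[OF local_primitives_open[OF \<F> U(1)] U(2)] by blast
    obtain \<gamma> K1 where 1: "path \<gamma>" "pathstart \<gamma> = p\<^sub>0" "pathfinish \<gamma> = p" "continuation \<F> ?I \<gamma> K1" "F p = K1 1 - K1 0"
      using F[of p] unfolding reach_def by blast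
    have "F q - F p = h q - h p" if q: "q \<in> W" for q
    proof -
      obtain \<gamma>' where 2: "path \<gamma>'" "path_image \<gamma>' \<subseteq> U" "pathstart \<gamma>' = p" "pathfinish \<gamma>' = q"
        using W(4)[OF q] by blast
      have \<gamma>: "path (\<gamma> +++ \<gamma>')" using 1 2 by simp
      obtain K where K: "continuation \<F> ?I (\<gamma> +++ \<gamma>') K"
        using continuation_path_exists[OF \<F> \<gamma>] by blast
      have "continuation \<F> ?I \<gamma>' (\<lambda>t. h (\<gamma>' t))"
        using 2 by (intro continuation_within[OF \<F> _ _ U(1)]) (auto simp: path_def path_image_def)
      then have "K 1 - K (1/2) = h q - h p"
        using second[OF K, of "\<lambda>t. h (\<gamma>' t)"] 1 2 by (simp add: pathstart_def pathfinish_def)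
      moreover have "K (1/2) - K 0 = F p" using first[OF K 1(4)] 1 by simp
      moreover have "reach q (K 1 - K 0)"
        unfolding reach_def using \<gamma> K 1 2 by (intro exI[of _ "\<gamma> +++ \<gamma>'"] exI[of _ K]) auto
      ultimately show ?thesis using uniq[OF F[of q]] by (simp add: algebra_simps)
    qed
    then show "\<exists>W. open W \<and> p \<in> W \<and> (\<forall>q\<in>W. F q - F p = h q - h p)" using W by blast
  qed
qed

section \<open>Closed forms on manifolds\<close>

text \<open>A product rule for a family of linear maps whose dependence on the point is known only
  for each fixed argument. Expanding the argument in \<open>Basis\<close> reduces it to scalar
  coefficients.\<close>

lemma has_derivative_applied_linear:
  fixes \<Theta> :: "'a::euclidean_space \<Rightarrow> 'e::euclidean_space \<Rightarrow> 'c::real_normed_vector" and \<eta> :: "'a \<Rightarrow> 'e"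
  assumes S: "open S" "x \<in> S" and lin: "\<And>y. y \<in> S \<Longrightarrow> linear (\<Theta> y)"
    and \<Theta>: "\<And>v. ((\<lambda>y. \<Theta> y v) has_derivative \<Theta>' v) (at x)"
    and \<eta>: "(\<eta> has_derivative \<eta>') (at x)"
  shows "((\<lambda>y. \<Theta> y (\<eta> y)) has_derivative (\<lambda>u. \<Theta>' (\<eta> x) u + \<Theta> x (\<eta>' u))) (at x)"
proof -
  have expand: "\<Theta> y v = (\<Sum>b\<in>Basis. (v \<bullet> b) *\<^sub>R \<Theta> y b)" if "y \<in> S" for y v
    by (rule linear_expansion[OF lin[OF that]])
  have "((\<lambda>y. \<Sum>b\<in>Basis. (v \<bullet> b) *\<^sub>R \<Theta> y b) has_derivative (\<lambda>u. \<Sum>b\<in>Basis. (v \<bullet> b) *\<^sub>R \<Theta>' b u)) (at x)" for v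
    by (intro has_derivative_sum has_derivative_scaleR_right \<Theta>)
  then have "((\<lambda>y. \<Theta> y v) has_derivative (\<lambda>u. \<Sum>b\<in>Basis. (v \<bullet> b) *\<^sub>R \<Theta>' b u)) (at x)" for v
    by (rule has_derivative_transform_within_open[OF _ S]) (use expand in auto)
  \<comment> \<open>Uniqueness of derivatives supplies the linearity of \<open>\<Theta>' v\<close>
    in \<open>v\<close>, which is not among the assumptions.\<close>
  from has_derivative_unique[OF \<Theta> this]
  have expand': "\<Theta>' v = (\<lambda>u. \<Sum>b\<in>Basis. (v \<bullet> b) *\<^sub>R \<Theta>' b u)" for v .
  have "((\<lambda>y. \<Sum>b\<in>Basis. (\<eta> y \<bullet> b) *\<^sub>R \<Theta> y b) has_derivative
      (\<lambda>u. \<Sum>b\<in>Basis. (\<eta> x \<bullet> b) *\<^sub>R \<Theta>' b u + (\<eta>' u \<bullet> b) *\<^sub>R \<Theta> x b)) (at x)"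
    by (intro has_derivative_sum has_derivative_scaleR has_derivative_inner_left \<eta> \<Theta>)
  then have "((\<lambda>y. \<Theta> y (\<eta> y)) has_derivative
      (\<lambda>u. \<Sum>b\<in>Basis. (\<eta> x \<bullet> b) *\<^sub>R \<Theta>' b u + (\<eta>' u \<bullet> b) *\<^sub>R \<Theta> x b)) (at x)"
    by (rule has_derivative_transform_within_open[OF _ S]) (use expand in auto)
  moreover have "(\<Sum>b\<in>Basis. (\<eta> x \<bullet> b) *\<^sub>R \<Theta>' b u + (\<eta>' u \<bullet> b) *\<^sub>R \<Theta> x b) = \<Theta>' (\<eta> x) u + \<Theta> x (\<eta>' u)" for u
    by (simp add: sum.distrib fun_cong[OF expand', of "\<eta> x" u] expand[OF S(2), of "\<eta>' u"])
  ultimately show ?thesis by simp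
qed

lemma smooth_on_applied_linear:
  fixes \<Theta> :: "'a::euclidean_space \<Rightarrow> 'e::euclidean_space \<Rightarrow> 'c::real_normed_vector" and \<eta> :: "'a \<Rightarrow> 'e"
  assumes S: "open S" and lin: "\<And>y. y \<in> S \<Longrightarrow> linear (\<Theta> y)"
    and \<Theta>: "\<And>v. smooth_on S (\<lambda>y. \<Theta> y v)" and \<eta>: "smooth_on S \<eta>"
  shows "smooth_on S (\<lambda>y. \<Theta> y (\<eta> y))"
proof (rule smooth_on_cong[OF S])
  show "smooth_on S (\<lambda>y. \<Sum>b\<in>Basis. (\<eta> y \<bullet> b) *\<^sub>R \<Theta> y b)"
    by (intro smooth_on_sum S smooth_on_bilinear[OF _ bounded_bilinear_scaleR] \<Theta>
        smooth_on_linear[OF _ bounded_linear_inner_left] \<eta>)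
  fix y assume "y \<in> S"
  then show "(\<Sum>b\<in>Basis. (\<eta> y \<bullet> b) *\<^sub>R \<Theta> y b) = \<Theta> y (\<eta> y)"
    by (intro linear_expansion[symmetric] lin)
qed

lemma has_derivative_identity_near:
  assumes "open S" "x \<in> S" "\<And>y. y \<in> S \<Longrightarrow> k y = y" "(k has_derivative D) (at x)"
  shows "D = (\<lambda>v. v)"
proof -
  have "(k has_derivative (\<lambda>v. v)) (at x)"
    by (rule has_derivative_transform_within_open[OF has_derivative_ident assms(1,2)]) (simp add: assms)
  then show ?thesis using has_derivative_unique assms(4) by blast
qed

section \<open>Charts and tangent maps\<close>

locale manifold =
  fixes \<A> :: "('m::{t2_space,second_countable_topology}, 'a::euclidean_space) chart set"
  assumes atlas: "smooth_atlas \<A>"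
begin

abbreviation "tm \<equiv> tangent_map \<A>"
abbreviation "cf \<equiv> coord_field \<A>"
abbreviation "ca \<equiv> chart_at \<A>"

lemma chart:
  assumes "c \<in> \<A>"
  shows chart_open_domain: "open (fst c)" and chart_open_image: "open (snd c ` fst c)"
    and chart_homeo: "homeomorphism (fst c) (snd c ` fst c) (snd c) (chart_inv c)"
  using assms atlas unfolding smooth_atlas_def is_chart_def by blast+

lemma chart_inv_chart [simp]: "c \<in> \<A> \<Longrightarrow> p \<in> fst c \<Longrightarrow> chart_inv c (snd c p) = p"
  using chart_homeo homeomorphism_apply1 by metis

lemma chart_chart_inv [simp]: "c \<in> \<A> \<Longrightarrow> x \<in> snd c ` fst c \<Longrightarrow> snd c (chart_inv c x) = x"
  using chart_homeo homeomorphism_apply2 by metis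

lemma chart_inv_in [simp]: "c \<in> \<A> \<Longrightarrow> x \<in> snd c ` fst c \<Longrightarrow> chart_inv c x \<in> fst c"
  using chart_homeo unfolding homeomorphism_def by blast

lemma chart_at: "ca p \<in> \<A>" "p \<in> fst (ca p)"
proof -
  have "p \<in> (\<Union>c\<in>\<A>. fst c)" using atlas unfolding smooth_atlas_def by simp
  then have "\<exists>c. c \<in> \<A> \<and> p \<in> fst c" by blast
  then have "ca p \<in> \<A> \<and> p \<in> fst (ca p)" unfolding chart_at_def by (rule someI_ex)
  then show "ca p \<in> \<A>" "p \<in> fst (ca p)" by auto
qed

lemma open_chart_image:
  assumes "c \<in> \<A>" "open U"
  shows "open (snd c ` (fst c \<inter> U))"
proof -
  have "continuous_on (snd c ` fst c) (chart_inv c)"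
    using chart_homeo[OF assms(1)] by (simp add: homeomorphism_def)
  then have "open (chart_inv c -` U \<inter> snd c ` fst c)"
    using continuous_on_open_vimage[OF chart_open_image[OF assms(1)]] assms(2) by blast
  moreover have "chart_inv c -` U \<inter> snd c ` fst c = snd c ` (fst c \<inter> U)"
    using assms(1) by auto
  ultimately show ?thesis by simp
qed

lemma open_chart_preimage:
  assumes "c \<in> \<A>" "open V"
  shows "open (fst c \<inter> snd c -` V)"
proof -
  have "continuous_on (fst c) (snd c)"
    using chart_homeo[OF assms(1)] by (simp add: homeomorphism_def)
  then show ?thesis
    using continuous_on_open_vimage[OF chart_open_domain[OF assms(1)]] assms(2) by (metis Int_commute)
qed

lemma chart_ball:
  assumes "c \<in> \<A>" "p \<in> fst c" "open U" "p \<in> U"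
  obtains r W where "r > 0" "ball (snd c p) r \<subseteq> snd c ` fst c" "open W" "p \<in> W" "W \<subseteq> fst c \<inter> U"
    "snd c ` W = ball (snd c p) r"
proof -
  have "snd c p \<in> snd c ` (fst c \<inter> U)" using assms by blast
  then obtain r where r: "r > 0" "ball (snd c p) r \<subseteq> snd c ` (fst c \<inter> U)"
    using open_chart_image[OF assms(1,3)] openE by blast
  define W where "W = fst c \<inter> snd c -` ball (snd c p) r"
  have 1: "open W" "p \<in> W" unfolding W_def using open_chart_preimage[OF assms(1)] r assms by auto
  have 2: "W \<subseteq> fst c \<inter> U"
  proof
    fix q assume q: "q \<in> W"
    then obtain q' where "q' \<in> fst c" "q' \<in> U" "snd c q = snd c q'" using r unfolding W_def by blast
    then show "q \<in> fst c \<inter> U" using q chart_inv_chart[OF assms(1)] unfolding W_def by (metis IntD1 IntI)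
  qed
  have 3: "snd c ` W = ball (snd c p) r" unfolding W_def using r by blast
  show thesis using that[OF r(1) _ 1 2 3] r(2) by blast
qed

lemma transition_smooth:
  assumes "c \<in> \<A>" "d \<in> \<A>"
  shows "smooth_on (snd c ` (fst c \<inter> fst d)) (snd d \<circ> chart_inv c)"
  using atlas assms unfolding smooth_atlas_def by blast

lemma transition_has_derivative:
  assumes "c \<in> \<A>" "d \<in> \<A>" "p \<in> fst c" "p \<in> fst d"
  shows "((snd d \<circ> chart_inv c) has_derivative frechet_derivative (snd d \<circ> chart_inv c) (at (snd c p))) (at (snd c p))"
  using assms by (intro smooth_on_has_derivative[OF transition_smooth]) auto

text \<open>Unlike \<open>tm\<close>, this asserts differentiability. It suits functions controlled
  only near a point, such as local primitives.\<close>

definition has_diff :: "('m \<Rightarrow> 'c::real_normed_vector) \<Rightarrow> 'm \<Rightarrow> ('a \<Rightarrow> 'c) \<Rightarrow> bool" where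
  "has_diff h p D \<longleftrightarrow> ((h \<circ> chart_inv (ca p)) has_derivative D) (at (snd (ca p) p))"

lemma has_diff_imp_eq: "has_diff h p D \<Longrightarrow> tm h p = D"
  unfolding has_diff_def tangent_map_def by (metis frechet_derivative_at)

lemma has_diff_linear: "has_diff h p D \<Longrightarrow> linear D"
  unfolding has_diff_def by (rule has_derivative_linear)

lemma change_of_chart:
  assumes c: "c \<in> \<A>" "d \<in> \<A>" "p \<in> fst c" "p \<in> fst d"
    and h: "((h \<circ> chart_inv c) has_derivative D) (at (snd c p))"
  shows "((h \<circ> chart_inv d) has_derivative (\<lambda>v. D (frechet_derivative (snd c \<circ> chart_inv d) (at (snd d p)) v))) (at (snd d p))"
proof -
  have "((h \<circ> chart_inv c) \<circ> (snd c \<circ> chart_inv d) has_derivative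
     D \<circ> frechet_derivative (snd c \<circ> chart_inv d) (at (snd d p))) (at (snd d p))"
    by (rule diff_chain_at[OF transition_has_derivative[OF c(2,1,4,3)]]) (use c h in simp)
  then have "((h \<circ> chart_inv d) has_derivative
     D \<circ> frechet_derivative (snd c \<circ> chart_inv d) (at (snd d p))) (at (snd d p))"
  proof (rule has_derivative_transform_within_open)
    show "open (snd d ` (fst d \<inter> fst c))"
      using c by (intro open_chart_image chart_open_domain)
    show "snd d p \<in> snd d ` (fst d \<inter> fst c)" using c by blast
    show "((h \<circ> chart_inv c) \<circ> (snd c \<circ> chart_inv d)) x = (h \<circ> chart_inv d) x" if "x \<in> snd d ` (fst d \<inter> fst c)" for x
      using that c by auto
  qed
  then show ?thesis by (simp add: o_def)
qed

lemma has_diff_chart_coord: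
  assumes "c \<in> \<A>" "p \<in> fst c"
  shows "has_diff (snd c) p (tm (snd c) p)"
  unfolding has_diff_def tangent_map_def
  by (rule transition_has_derivative) (use assms chart_at in auto)

lemma coord_field_linear: "c \<in> \<A> \<Longrightarrow> p \<in> fst c \<Longrightarrow> linear (\<lambda>v. cf c v p)"
  unfolding coord_field_def
  using has_derivative_linear[OF transition_has_derivative[of c "ca p" p]] chart_at by simp

lemma has_diff_chartI:
  assumes "c \<in> \<A>" "p \<in> fst c" "((h \<circ> chart_inv c) has_derivative D) (at (snd c p))"
  shows "has_diff h p (\<lambda>u. D (tm (snd c) p u))"
  unfolding has_diff_def tangent_map_def
  by (rule change_of_chart[OF assms(1) _ assms(2) _ assms(3)]) (use chart_at in auto)

lemma has_diff_chartD:
  assumes "has_diff h p D" "c \<in> \<A>" "p \<in> fst c"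
  shows "((h \<circ> chart_inv c) has_derivative (\<lambda>v. D (cf c v p))) (at (snd c p))"
  using change_of_chart[OF _ assms(2) _ assms(3) assms(1)[unfolded has_diff_def]] chart_at
  unfolding coord_field_def by simp

text \<open>Together with \<open>coord_field_tm\<close> this says that passing from the components
  in the selected chart at \<open>p\<close> to those in \<open>c\<close>, and back, are inverse
  operations: they are the derivatives of inverse transition maps.\<close>

lemma tm_coord_field:
  assumes c: "c \<in> \<A>" "p \<in> fst c"
  shows "tm (snd c) p (cf c v p) = v"
proof -
  have "(\<lambda>v. tm (snd c) p (cf c v p)) = (\<lambda>v. v)"
    by (rule has_derivative_identity_near[OF chart_open_image[OF c(1)] _ _ has_diff_chartD[OF has_diff_chart_coord[OF c] c]])
       (use c in auto)
  then show ?thesis by meson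
qed

lemma coord_field_tm:
  assumes c: "c \<in> \<A>" "p \<in> fst c"
  shows "cf c (tm (snd c) p u) p = u"
proof -
  have d: "((snd (ca p) \<circ> chart_inv c) has_derivative (\<lambda>v. cf c v p)) (at (snd c p))"
    unfolding coord_field_def by (rule transition_has_derivative) (use c chart_at in auto)
  have "(\<lambda>u. cf c (tm (snd c) p u) p) = (\<lambda>v. v)"
    by (rule has_derivative_identity_near[OF chart_open_image[OF chart_at(1)] _ _ has_diff_chartI[OF c d, unfolded has_diff_def]])
       (use chart_at in auto)
  then show ?thesis by meson
qed

lemma tm_chart_linear: "c \<in> \<A> \<Longrightarrow> p \<in> fst c \<Longrightarrow> linear (tm (snd c) p)"
  using has_diff_linear[OF has_diff_chart_coord] .

lemma has_diff_chartI':
  assumes "c \<in> \<A>" "p \<in> fst c" "((h \<circ> chart_inv c) has_derivative (\<lambda>v. D (cf c v p))) (at (snd c p))"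
  shows "has_diff h p D"
  using has_diff_chartI[OF assms] coord_field_tm[OF assms(1,2)] by simp

lemma smooth_map_has_diff: "smooth_map \<A> h \<Longrightarrow> has_diff h p (tm h p)"
  unfolding smooth_map_def has_diff_def tangent_map_def
  by (rule smooth_on_has_derivative[of "snd (ca p) ` fst (ca p)"]) (use chart_at in auto)

lemma tm_linear: "smooth_map \<A> h \<Longrightarrow> linear (tm h p)"
  using has_diff_linear[OF smooth_map_has_diff] .

lemma tm_in_chart:
  assumes "smooth_map \<A> h" "c \<in> \<A>" "p \<in> fst c"
  shows "tm h p u = frechet_derivative (h \<circ> chart_inv c) (at (snd c p)) (tm (snd c) p u)"
proof -
  have "((h \<circ> chart_inv c) has_derivative frechet_derivative (h \<circ> chart_inv c) (at (snd c p))) (at (snd c p))"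
    using assms unfolding smooth_map_def by (intro smooth_on_has_derivative[of "snd c ` fst c"]) auto
  from has_diff_imp_eq[OF has_diff_chartI[OF assms(2,3) this]] show ?thesis by simp
qed

lemma tm_coord_in_chart:
  assumes "smooth_map \<A> h" "c \<in> \<A>" "x \<in> snd c ` fst c"
  shows "tm h (chart_inv c x) (cf c v (chart_inv c x)) = frechet_derivative (h \<circ> chart_inv c) (at x) v"
  using tm_in_chart[OF assms(1,2), of "chart_inv c x"] assms(2,3) by (simp add: tm_coord_field)

section \<open>Calculus of smooth maps on the manifold\<close>

lemma smooth_map_const: "smooth_map \<A> (\<lambda>p. k)"
  unfolding smooth_map_def o_def by (auto intro: smooth_on_const chart_open_image)

lemma smooth_map_linear: "bounded_linear l \<Longrightarrow> smooth_map \<A> h \<Longrightarrow> smooth_map \<A> (\<lambda>p. l (h p))"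
  unfolding smooth_map_def o_def by (auto intro: smooth_on_linear chart_open_image)

lemma smooth_map_add: "smooth_map \<A> h \<Longrightarrow> smooth_map \<A> k \<Longrightarrow> smooth_map \<A> (\<lambda>p. h p + k p)"
  unfolding smooth_map_def o_def by (auto intro: smooth_on_add chart_open_image)

lemma smooth_map_bilinear:
  "bounded_bilinear pr \<Longrightarrow> smooth_map \<A> h \<Longrightarrow> smooth_map \<A> k \<Longrightarrow> smooth_map \<A> (\<lambda>p. pr (h p) (k p))"
  unfolding smooth_map_def o_def by (auto intro: smooth_on_bilinear chart_open_image)

lemma smooth_map_sum: "(\<And>i. i \<in> I \<Longrightarrow> smooth_map \<A> (h i)) \<Longrightarrow> smooth_map \<A> (\<lambda>p. \<Sum>i\<in>I. h i p)"
  unfolding smooth_map_def o_def by (intro ballI smooth_on_sum chart_open_image) auto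

lemma smooth_map_minus: "smooth_map \<A> h \<Longrightarrow> smooth_map \<A> (\<lambda>p. - h p)"
  by (rule smooth_map_linear[OF bounded_linear_minus[OF bounded_linear_ident]])

lemma smooth_map_diff: "smooth_map \<A> h \<Longrightarrow> smooth_map \<A> k \<Longrightarrow> smooth_map \<A> (\<lambda>p. h p - k p)"
  using smooth_map_add[OF _ smooth_map_minus] by fastforce

lemma smooth_map_inner: "smooth_map \<A> h \<Longrightarrow> smooth_map \<A> k \<Longrightarrow> smooth_map \<A> (\<lambda>p. h p \<bullet> k p)"
  by (rule smooth_map_bilinear[OF bounded_bilinear_inner])

lemma smooth_map_scaleR: "smooth_map \<A> h \<Longrightarrow> smooth_map \<A> k \<Longrightarrow> smooth_map \<A> (\<lambda>p. h p *\<^sub>R k p)"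
  by (rule smooth_map_bilinear[OF bounded_bilinear_scaleR])

lemmas smooth_map_intros = smooth_map_const smooth_map_add smooth_map_minus smooth_map_diff
  smooth_map_inner smooth_map_scaleR smooth_map_sum

lemma tm_const: "tm (\<lambda>p. k) p u = 0"
  unfolding tangent_map_def o_def by (simp add: frechet_derivative_const)

lemma tm_compose_linear:
  assumes "bounded_linear l" "smooth_map \<A> h"
  shows "tm (\<lambda>p. l (h p)) p u = l (tm h p u)"
  using has_diff_imp_eq[of "\<lambda>p. l (h p)" p "\<lambda>u. l (tm h p u)"]
    bounded_linear.has_derivative[OF assms(1) smooth_map_has_diff[OF assms(2), unfolded has_diff_def]]
  unfolding has_diff_def o_def by metis

lemma tm_add:
  assumes "smooth_map \<A> h" "smooth_map \<A> k"
  shows "tm (\<lambda>p. h p + k p) p u = tm h p u + tm k p u"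
  using has_diff_imp_eq[of "\<lambda>p. h p + k p" p "\<lambda>u. tm h p u + tm k p u"]
    has_derivative_add[OF assms[THEN smooth_map_has_diff, unfolded has_diff_def]]
  unfolding has_diff_def o_def by metis

lemma tm_diff:
  assumes "smooth_map \<A> h" "smooth_map \<A> k"
  shows "tm (\<lambda>p. h p - k p) p u = tm h p u - tm k p u"
  using has_diff_imp_eq[of "\<lambda>p. h p - k p" p "\<lambda>u. tm h p u - tm k p u"]
    has_derivative_diff[OF assms[THEN smooth_map_has_diff, unfolded has_diff_def]]
  unfolding has_diff_def o_def by metis

lemma tm_bilinear:
  assumes "bounded_bilinear pr" "smooth_map \<A> h" "smooth_map \<A> k"
  shows "tm (\<lambda>p. pr (h p) (k p)) p u = pr (h p) (tm k p u) + pr (tm h p u) (k p)"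
proof -
  have "has_diff (\<lambda>p. pr (h p) (k p)) p (\<lambda>u. pr (h p) (tm k p u) + pr (tm h p u) (k p))"
    using bounded_bilinear.FDERIV[OF assms(1) assms(2,3)[THEN smooth_map_has_diff[of _ p], unfolded has_diff_def]]
      chart_at
    unfolding has_diff_def o_def by simp
  from has_diff_imp_eq[OF this] show ?thesis by simp
qed

lemma tm_sum:
  assumes "\<And>i. i \<in> I \<Longrightarrow> smooth_map \<A> (h i)"
  shows "tm (\<lambda>p. \<Sum>i\<in>I. h i p) p u = (\<Sum>i\<in>I. tm (h i) p u)"
proof -
  have "has_diff (\<lambda>p. \<Sum>i\<in>I. h i p) p (\<lambda>u. \<Sum>i\<in>I. tm (h i) p u)"
    unfolding has_diff_def o_def
    by (intro has_derivative_sum assms[THEN smooth_map_has_diff, unfolded has_diff_def o_def])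
  from has_diff_imp_eq[OF this] show ?thesis by simp
qed

lemmas tm_inner = tm_bilinear[OF bounded_bilinear_inner]
lemmas tm_scaleR = tm_bilinear[OF bounded_bilinear_scaleR]

section \<open>Vector-valued one-forms\<close>

definition smooth_form :: "('m \<Rightarrow> 'a \<Rightarrow> 'c::real_normed_vector) \<Rightarrow> bool" where
  "smooth_form \<omega> \<longleftrightarrow> (\<forall>p. linear (\<omega> p)) \<and>
     (\<forall>c\<in>\<A>. \<forall>v. smooth_on (snd c ` fst c) (\<lambda>x. \<omega> (chart_inv c x) (cf c v (chart_inv c x))))"

text \<open>In a fixed chart the form and the components of the field are smooth;
  \<open>coord_field_tm\<close> recovers the field from its components.\<close>

lemma smooth_form_apply:
  assumes "smooth_form \<omega>" "smooth_field \<A> X"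
  shows "smooth_map \<A> (\<lambda>p. \<omega> p (X p))"
  unfolding smooth_map_def
proof
  fix c assume c: "c \<in> \<A>"
  let ?S = "snd c ` fst c"
  have "smooth_on ?S (\<lambda>x. \<omega> (chart_inv c x) (cf c (tm (snd c) (chart_inv c x) (X (chart_inv c x))) (chart_inv c x)))"
  proof (rule smooth_on_applied_linear[where \<Theta> = "\<lambda>x v. \<omega> (chart_inv c x) (cf c v (chart_inv c x))"
      and \<eta> = "\<lambda>x. tm (snd c) (chart_inv c x) (X (chart_inv c x))", OF chart_open_image[OF c]])
    show "linear (\<lambda>v. \<omega> (chart_inv c x) (cf c v (chart_inv c x)))" if "x \<in> ?S" for x
      using linear_compose[OF coord_field_linear[OF c] assms(1)[unfolded smooth_form_def, THEN conjunct1, rule_format]] c that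
      by (simp add: o_def)
    show "smooth_on ?S (\<lambda>x. \<omega> (chart_inv c x) (cf c v (chart_inv c x)))" for v
      using assms(1) c unfolding smooth_form_def by blast
    show "smooth_on ?S (\<lambda>x. tm (snd c) (chart_inv c x) (X (chart_inv c x)))"
      using assms(2) c unfolding smooth_field_def o_def by blast
  qed
  then show "smooth_on ?S ((\<lambda>p. \<omega> p (X p)) \<circ> chart_inv c)"
    by (rule smooth_on_cong[OF chart_open_image[OF c]]) (use c in \<open>simp add: coord_field_tm\<close>)
qed

lemma smooth_form_tm: "smooth_map \<A> h \<Longrightarrow> smooth_form (tm h)"
  unfolding smooth_form_def
proof (intro conjI allI ballI)
  fix c v assume h: "smooth_map \<A> h" and c: "c \<in> \<A>"
  have "smooth_on (snd c ` fst c) (\<lambda>x. frechet_derivative (h \<circ> chart_inv c) (at x) v)"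
    using h c unfolding smooth_map_def by (intro smooth_on_frechet) auto
  then show "smooth_on (snd c ` fst c) (\<lambda>x. tm h (chart_inv c x) (cf c v (chart_inv c x)))"
    by (rule smooth_on_cong[OF chart_open_image[OF c]]) (simp add: tm_coord_in_chart h c)
qed (rule tm_linear)

lemma smooth_form_endo:
  assumes "smooth_form \<omega>" "smooth_endo \<A> B"
  shows "smooth_form (\<lambda>p u. \<omega> p (B p u))"
  unfolding smooth_form_def
proof (intro conjI allI ballI)
  show "linear (\<lambda>u. \<omega> p (B p u))" for p
    using linear_compose[of "B p" "\<omega> p"] assms unfolding smooth_form_def smooth_endo_def by (simp add: o_def)
  fix c v assume c: "c \<in> \<A>"
  let ?S = "snd c ` fst c"
  have "smooth_on ?S (\<lambda>x. \<omega> (chart_inv c x) (cf c (tm (snd c) (chart_inv c x) (B (chart_inv c x) (cf c v (chart_inv c x)))) (chart_inv c x)))"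
  proof (rule smooth_on_applied_linear[where \<Theta> = "\<lambda>x v. \<omega> (chart_inv c x) (cf c v (chart_inv c x))"
      and \<eta> = "\<lambda>x. tm (snd c) (chart_inv c x) (B (chart_inv c x) (cf c v (chart_inv c x)))", OF chart_open_image[OF c]])
    show "linear (\<lambda>v. \<omega> (chart_inv c x) (cf c v (chart_inv c x)))" if "x \<in> ?S" for x
      using linear_compose[OF coord_field_linear[OF c] assms(1)[unfolded smooth_form_def, THEN conjunct1, rule_format]] c that
      by (simp add: o_def)
    show "smooth_on ?S (\<lambda>x. \<omega> (chart_inv c x) (cf c v (chart_inv c x)))" for v
      using assms(1) c unfolding smooth_form_def by blast
    show "smooth_on ?S (\<lambda>x. tm (snd c) (chart_inv c x) (B (chart_inv c x) (cf c v (chart_inv c x))))"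
      using assms(2) c unfolding smooth_endo_def o_def by blast
  qed
  then show "smooth_on ?S (\<lambda>x. \<omega> (chart_inv c x) (B (chart_inv c x) (cf c v (chart_inv c x))))"
    by (rule smooth_on_cong[OF chart_open_image[OF c]]) (use c in \<open>simp add: coord_field_tm\<close>)
qed

lemma smooth_field_endo:
  assumes "smooth_endo \<A> B" "smooth_field \<A> X"
  shows "smooth_field \<A> (\<lambda>p. B p (X p))"
  unfolding smooth_field_def o_def
proof
  fix c assume c: "c \<in> \<A>"
  let ?S = "snd c ` fst c"
  have "smooth_on ?S (\<lambda>x. tm (snd c) (chart_inv c x) (B (chart_inv c x) (cf c (tm (snd c) (chart_inv c x) (X (chart_inv c x))) (chart_inv c x))))"
  proof (rule smooth_on_applied_linear[where \<Theta> = "\<lambda>x v. tm (snd c) (chart_inv c x) (B (chart_inv c x) (cf c v (chart_inv c x)))"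
      and \<eta> = "\<lambda>x. tm (snd c) (chart_inv c x) (X (chart_inv c x))", OF chart_open_image[OF c]])
    fix x assume "x \<in> ?S"
    then show "linear (\<lambda>v. tm (snd c) (chart_inv c x) (B (chart_inv c x) (cf c v (chart_inv c x))))"
      using linear_compose[OF linear_compose[OF coord_field_linear] tm_chart_linear, of c "chart_inv c x" "B (chart_inv c x)"] c
        assms(1)[unfolded smooth_endo_def]
      by (simp add: o_def)
  next
    show "smooth_on ?S (\<lambda>x. tm (snd c) (chart_inv c x) (B (chart_inv c x) (cf c v (chart_inv c x))))" for v
      using assms(1) c unfolding smooth_endo_def o_def by blast
    show "smooth_on ?S (\<lambda>x. tm (snd c) (chart_inv c x) (X (chart_inv c x)))"
      using assms(2) c unfolding smooth_field_def o_def by blast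
  qed
  then show "smooth_on ?S (\<lambda>x. tm (snd c) (chart_inv c x) (B (chart_inv c x) (X (chart_inv c x))))"
    by (rule smooth_on_cong[OF chart_open_image[OF c]]) (use c in \<open>simp add: coord_field_tm\<close>)
qed

lemma smooth_form_add: "smooth_form \<omega> \<Longrightarrow> smooth_form \<omega>' \<Longrightarrow> smooth_form (\<lambda>p u. \<omega> p u + \<omega>' p u)"
  unfolding smooth_form_def
  by (intro conjI allI ballI linear_compose_add smooth_on_add chart_open_image) auto

lemma smooth_form_bilinear:
  fixes pr :: "'c::real_normed_vector \<Rightarrow> 'd::real_normed_vector \<Rightarrow> 'e::real_normed_vector"
  assumes "bounded_bilinear pr" "smooth_map \<A> h" "smooth_form \<omega>"
  shows "smooth_form (\<lambda>p u. pr (h p) (\<omega> p u))"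
  unfolding smooth_form_def
proof (intro conjI allI ballI)
  show "linear (\<lambda>u. pr (h p) (\<omega> p u))" for p
    using linear_compose[of "\<omega> p" "pr (h p)"] assms(3) bounded_bilinear.bounded_linear_right[OF assms(1)]
    unfolding smooth_form_def by (simp add: o_def bounded_linear.linear)
  fix c v assume "c \<in> \<A>"
  then show "smooth_on (snd c ` fst c) (\<lambda>x. pr (h (chart_inv c x)) (\<omega> (chart_inv c x) (cf c v (chart_inv c x))))"
    using assms(2,3) unfolding smooth_form_def smooth_map_def o_def
    by (intro smooth_on_bilinear[OF _ assms(1)] chart_open_image) auto
qed

section \<open>Local constancy and local paths\<close>

lemma has_diff_diff: "has_diff h p D \<Longrightarrow> has_diff k p E \<Longrightarrow> has_diff (\<lambda>q. h q - k q) p (\<lambda>u. D u - E u)"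
  unfolding has_diff_def using has_derivative_diff by (fastforce simp: o_def)

lemma has_diff_zero_locally_constant:
  assumes U: "open U" "p \<in> U" and h: "\<And>q. q \<in> U \<Longrightarrow> has_diff h q (\<lambda>u. 0)"
  shows "\<exists>W. open W \<and> p \<in> W \<and> W \<subseteq> U \<and> (\<forall>q\<in>W. h q = h p)"
proof -
  note c = chart_at[of p]
  obtain r W where W: "r > 0" "ball (snd (ca p) p) r \<subseteq> snd (ca p) ` fst (ca p)" "open W" "p \<in> W"
    "W \<subseteq> fst (ca p) \<inter> U" "snd (ca p) ` W = ball (snd (ca p) p) r"
    by (rule chart_ball[OF c U])
  have "h q = h p" if q: "q \<in> W" for q
  proof -
    have "\<exists>k. \<forall>x\<in>ball (snd (ca p) p) r. (h \<circ> chart_inv (ca p)) x = k"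
    proof (rule has_derivative_zero_constant[OF convex_ball])
      fix x assume "x \<in> ball (snd (ca p) p) r"
      then obtain q' where q': "q' \<in> W" "x = snd (ca p) q'" using W(6) by blast
      then have "has_diff h q' (\<lambda>u. 0)" using h W(5) by blast
      from has_diff_chartD[OF this c(1), of] q' W(5)
      show "((h \<circ> chart_inv (ca p)) has_derivative (\<lambda>h. 0)) (at x within ball (snd (ca p) p) r)"
        by (auto intro: has_derivative_at_withinI)
    qed
    then obtain k where k: "\<And>x. x \<in> ball (snd (ca p) p) r \<Longrightarrow> (h \<circ> chart_inv (ca p)) x = k" by blast
    have "h q' = k" if q': "q' \<in> W" for q'
    proof -
      have "snd (ca p) q' \<in> ball (snd (ca p) p) r" "q' \<in> fst (ca p)" using W(5,6) q' by blast+
      then show ?thesis using k[of "snd (ca p) q'"] c(1) by simp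
    qed
    then show ?thesis using q W(4) by simp
  qed
  then show ?thesis using W by blast
qed

lemma zero_derivative_constant:
  fixes h :: "'m \<Rightarrow> 'c::real_normed_vector"
  assumes "connected (UNIV :: 'm set)" "\<And>q. has_diff h q (\<lambda>u. 0)"
  shows "h q = h p"
proof -
  have "h constant_on UNIV"
  proof (rule locally_constant_imp_constant[OF assms(1)])
    fix a
    show "\<exists>T. openin (top_of_set UNIV) T \<and> a \<in> T \<and> (\<forall>x\<in>T. h x = h a)"
      using has_diff_zero_locally_constant[of UNIV a h] assms(2) by auto
  qed
  then show ?thesis unfolding constant_on_def by auto
qed

text \<open>Segments in a coordinate ball, carried back by the chart, supply the short paths needed
  for the monodromy argument.\<close>

lemma locally_path_connected_charts:
  fixes p :: 'm
  assumes "open U" "p \<in> U"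
  shows "\<exists>W. open W \<and> p \<in> W \<and> W \<subseteq> U \<and>
    (\<forall>q\<in>W. \<exists>\<gamma>. path \<gamma> \<and> path_image \<gamma> \<subseteq> U \<and> pathstart \<gamma> = p \<and> pathfinish \<gamma> = q)"
proof -
  note c = chart_at[of p]
  let ?c = "ca p" and ?x = "snd (ca p) p"
  obtain r W where W: "r > 0" "ball ?x r \<subseteq> snd ?c ` fst ?c" "open W" "p \<in> W"
    "W \<subseteq> fst ?c \<inter> U" "snd ?c ` W = ball ?x r"
    by (rule chart_ball[OF c assms])
  have inW: "chart_inv ?c y \<in> W" if y: "y \<in> ball ?x r" for y
  proof -
    obtain q where q: "q \<in> W" "y = snd ?c q" using y unfolding W(6)[symmetric] by blast
    then have "q \<in> fst ?c" using W(5) by blast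
    then show ?thesis using q c(1) by simp
  qed
  have cont: "continuous_on (ball ?x r) (chart_inv ?c)"
    by (rule continuous_on_subset[OF homeomorphism_cont2[OF chart_homeo[OF c(1)]] W(2)])
  have "\<exists>\<gamma>. path \<gamma> \<and> path_image \<gamma> \<subseteq> U \<and> pathstart \<gamma> = p \<and> pathfinish \<gamma> = q" if q: "q \<in> W" for q
  proof (intro exI conjI)
    let ?l = "linepath ?x (snd ?c q)"
    have "?x \<in> ball ?x r" "snd ?c q \<in> ball ?x r" using W q by auto
    then have l: "path_image ?l \<subseteq> ball ?x r" by (simp add: closed_segment_subset)
    show "path (chart_inv ?c \<circ> ?l)"
      by (rule path_continuous_image[OF path_linepath continuous_on_subset[OF cont l]])
    show "path_image (chart_inv ?c \<circ> ?l) \<subseteq> U"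
      unfolding path_image_compose using l inW W(5) by blast
    show "pathstart (chart_inv ?c \<circ> ?l) = p" "pathfinish (chart_inv ?c \<circ> ?l) = q"
      using c q W(5) by (auto simp: pathstart_compose pathfinish_compose)
  qed
  then show ?thesis using W by blast
qed

lemma simply_connected_imp_connected_manifold:
  assumes "simply_connected (UNIV :: 'm set)"
  shows "connected (UNIV :: 'm set)"
  by (rule path_connected_imp_connected)
    (simp add: path_connected_def simply_connected_path[OF assms])

text \<open>The vanishing of the exterior derivative, tested on coordinate fields of one chart.
  These commute, hence no bracket term.\<close>

definition closed_form :: "('m \<Rightarrow> 'a \<Rightarrow> 'c::real_normed_vector) \<Rightarrow> bool" where
  "closed_form \<omega> \<longleftrightarrow> smooth_form \<omega> \<and> (\<forall>c\<in>\<A>. \<forall>x\<in>snd c ` fst c. \<forall>v w.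
     frechet_derivative (\<lambda>y. \<omega> (chart_inv c y) (cf c v (chart_inv c y))) (at x) w =
     frechet_derivative (\<lambda>y. \<omega> (chart_inv c y) (cf c w (chart_inv c y))) (at x) v)"

lemma form_linear: "smooth_form \<omega> \<Longrightarrow> linear (\<omega> p)"
  unfolding smooth_form_def by blast

lemma form_coord_linear: "smooth_form \<omega> \<Longrightarrow> c \<in> \<A> \<Longrightarrow> p \<in> fst c \<Longrightarrow> linear (\<lambda>v. \<omega> p (cf c v p))"
  using linear_compose[OF coord_field_linear form_linear] by (simp add: o_def)

lemma closed_form_local_primitive:
  fixes \<omega> :: "'m \<Rightarrow> 'a \<Rightarrow> 'c::banach"
  assumes \<omega>: "closed_form \<omega>"
  shows "\<exists>U h. open U \<and> p \<in> U \<and> (\<forall>q\<in>U. has_diff h q (\<omega> q))"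
proof -
  note c = chart_at[of p]
  let ?c = "ca p" and ?x = "snd (ca p) p"
  let ?w = "\<lambda>y v. \<omega> (chart_inv ?c y) (cf ?c v (chart_inv ?c y))"
  have sm: "smooth_form \<omega>" using \<omega> by (simp add: closed_form_def)
  obtain r W where W: "r > 0" "ball ?x r \<subseteq> snd ?c ` fst ?c" "open W" "p \<in> W"
    "W \<subseteq> fst ?c \<inter> UNIV" "snd ?c ` W = ball ?x r"
    by (rule chart_ball[OF c open_UNIV UNIV_I])
  have "\<exists>h. \<forall>x\<in>ball ?x r. (h has_derivative ?w x) (at x)"
  proof (rule Poincare_lemma_ball)
    show "linear (?w x)" if "x \<in> ball ?x r" for x
      using that W(2) c(1) by (intro form_coord_linear sm) auto
    show "smooth_on (ball ?x r) (\<lambda>x. ?w x v)" for v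
      using sm c(1) W(2) smooth_on_subset unfolding smooth_form_def by blast
    show "frechet_derivative (\<lambda>y. ?w y v) (at x) w = frechet_derivative (\<lambda>y. ?w y w) (at x) v"
      if "x \<in> ball ?x r" for x v w
      using \<omega> c(1) W(2) that unfolding closed_form_def by blast
  qed
  then obtain h where h: "\<And>x. x \<in> ball ?x r \<Longrightarrow> (h has_derivative ?w x) (at x)" by blast
  have "has_diff (h \<circ> snd ?c) q (\<omega> q)" if q: "q \<in> W" for q
  proof (rule has_diff_chartI')
    show "?c \<in> \<A>" "q \<in> fst ?c" using c q W by auto
    have x: "snd ?c q \<in> ball ?x r" using W(6) q by blast
    show "((h \<circ> snd ?c) \<circ> chart_inv ?c has_derivative (\<lambda>v. \<omega> q (cf ?c v q))) (at (snd ?c q))"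
    proof (rule has_derivative_transform_within_open[OF _ open_ball x])
      show "(h has_derivative (\<lambda>v. \<omega> q (cf ?c v q))) (at (snd ?c q))"
        using h[OF x] c q W(5) by auto
    qed (use W(2) c in \<open>auto simp: subset_iff\<close>)
  qed
  then show ?thesis using W by blast
qed

text \<open>Two local primitives differ by a function with zero differential, so the monodromy
  argument applies to the family of all of them. The result agrees locally with each up to a
  constant; this yields its differential, and smoothness follows from that of the form.\<close>

lemma closed_form_primitive:
  fixes \<omega> :: "'m \<Rightarrow> 'a \<Rightarrow> 'c::banach"
  assumes \<omega>: "closed_form \<omega>" and sc: "simply_connected (UNIV :: 'm set)"
  obtains F where "smooth_map \<A> F" "\<And>p v. tm F p v = \<omega> p v"
proof -
  have sm: "smooth_form \<omega>" using \<omega> by (simp add: closed_form_def)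
  define \<F> where "\<F> = {(U, h). open U \<and> (\<forall>q\<in>U. has_diff h q (\<omega> q))}"
  have "local_primitives \<F>"
    unfolding local_primitives_def
  proof (intro conjI allI impI)
    show "\<exists>U h. (U, h) \<in> \<F> \<and> x \<in> U" for x
      using closed_form_local_primitive[OF \<omega>, of x] unfolding \<F>_def by blast
    fix U h V k x assume UV: "(U, h) \<in> \<F>" "(V, k) \<in> \<F>" "x \<in> U \<inter> V"
    have "has_diff (\<lambda>q. h q - k q) q (\<lambda>u. 0)" if "q \<in> U \<inter> V" for q
      using has_diff_diff[of h q "\<omega> q" k "\<omega> q"] UV that by (simp add: \<F>_def)
    from has_diff_zero_locally_constant[OF _ UV(3) this] UV
    obtain W where W: "open W" "x \<in> W" "\<forall>q\<in>W. h q - k q = h x - k x" by (auto simp: \<F>_def)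
    have "h y - h x = k y - k x" if "y \<in> W" for y
    proof -
      have "h y - k y = h x - k x" using W(3) that by blast
      then show ?thesis by (simp add: algebra_simps)
    qed
    then show "\<exists>W. open W \<and> x \<in> W \<and> (\<forall>y\<in>W. h y - h x = k y - k x)" using W by blast
  qed (simp add: \<F>_def)
  from simply_connected_primitive[OF this sc locally_path_connected_charts]
  obtain F where F: "\<And>U h p. (U, h) \<in> \<F> \<Longrightarrow> p \<in> U \<Longrightarrow> \<exists>W. open W \<and> p \<in> W \<and> (\<forall>q\<in>W. F q - F p = h q - h p)"
    by blast
  have dF: "has_diff F p (\<omega> p)" for p
  proof -
    obtain U h where U: "open U" "p \<in> U" "\<And>q. q \<in> U \<Longrightarrow> has_diff h q (\<omega> q)"
      using closed_form_local_primitive[OF \<omega>, of p] by blast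
    have "(U, h) \<in> \<F>" using U by (simp add: \<F>_def)
    from F[OF this U(2)] obtain W where W: "open W" "p \<in> W" "\<And>q. q \<in> W \<Longrightarrow> F q - F p = h q - h p"
      by blast
    note c = chart_at[of p]
    have "((\<lambda>x. (h \<circ> chart_inv (ca p)) x + (F p - h p)) has_derivative \<omega> p) (at (snd (ca p) p))"
      using has_derivative_add[OF U(3)[OF U(2), unfolded has_diff_def] has_derivative_const[of "F p - h p"]]
      by simp
    then show ?thesis
      unfolding has_diff_def
    proof (rule has_derivative_transform_within_open[OF _ open_chart_image[OF c(1) W(1)]])
      show "snd (ca p) p \<in> snd (ca p) ` (fst (ca p) \<inter> W)" using c W by blast
      fix x assume "x \<in> snd (ca p) ` (fst (ca p) \<inter> W)"
      then obtain q where q: "q \<in> fst (ca p)" "q \<in> W" "x = snd (ca p) q" by blast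
      then have "F q = h q + (F p - h p)" using W(3)[of q] by (simp add: algebra_simps)
      then show "(h \<circ> chart_inv (ca p)) x + (F p - h p) = (F \<circ> chart_inv (ca p)) x"
        using q c by simp
    qed
  qed
  have "smooth_map \<A> F"
    unfolding smooth_map_def
  proof
    fix c assume c: "c \<in> \<A>"
    show "smooth_on (snd c ` fst c) (F \<circ> chart_inv c)"
    proof (rule smooth_onI[OF chart_open_image[OF c]])
      show "((F \<circ> chart_inv c) has_derivative (\<lambda>v. \<omega> (chart_inv c x) (cf c v (chart_inv c x)))) (at x)"
        if "x \<in> snd c ` fst c" for x
        using has_diff_chartD[OF dF c, of "chart_inv c x"] that c by simp
      show "smooth_on (snd c ` fst c) (\<lambda>x. \<omega> (chart_inv c x) (cf c v (chart_inv c x)))" for v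
        using sm c unfolding smooth_form_def by blast
    qed
  qed
  moreover have "tm F p v = \<omega> p v" for p v using has_diff_imp_eq[OF dF] by simp
  ultimately show thesis using that by blast
qed

text \<open>The derivative of \<omega>(Y) along X splits into one term from the coefficients of the
  form and one from the components \<open>\<xi> Y\<close> of the field. Antisymmetrised, the first
  gives d\<omega> and the second the value on the bracket.\<close>

lemma form_along_has_derivative:
  fixes \<omega> :: "'m \<Rightarrow> 'a \<Rightarrow> 'c::real_normed_vector"
  assumes \<omega>: "smooth_form \<omega>" and X: "smooth_field \<A> X" and Y: "smooth_field \<A> Y" and c: "c \<in> \<A>" "x \<in> snd c ` fst c"
  defines "\<xi> \<equiv> \<lambda>Z y. tm (snd c) (chart_inv c y) (Z (chart_inv c y))"
  shows "deriv_along \<A> X (\<lambda>q. \<omega> q (Y q)) (chart_inv c x) =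
     frechet_derivative (\<lambda>y. \<omega> (chart_inv c y) (cf c (\<xi> Y x) (chart_inv c y))) (at x) (\<xi> X x)
     + \<omega> (chart_inv c x) (cf c (frechet_derivative (\<xi> Y) (at x) (\<xi> X x)) (chart_inv c x))"
proof -
  let ?S = "snd c ` fst c" and ?p = "chart_inv c x"
  note S = chart_open_image[OF c(1)]
  have \<xi>: "smooth_on ?S (\<xi> Y)"
    using Y c(1) unfolding smooth_field_def \<xi>_def o_def by blast
  have "((\<lambda>y. \<omega> (chart_inv c y) (cf c (\<xi> Y y) (chart_inv c y))) has_derivative
    (\<lambda>u. frechet_derivative (\<lambda>y. \<omega> (chart_inv c y) (cf c (\<xi> Y x) (chart_inv c y))) (at x) u
     + \<omega> ?p (cf c (frechet_derivative (\<xi> Y) (at x) u) ?p))) (at x)"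
  proof (rule has_derivative_applied_linear[where \<Theta> = "\<lambda>y v. \<omega> (chart_inv c y) (cf c v (chart_inv c y))"
      and \<eta> = "\<xi> Y" and \<Theta>' = "\<lambda>v. frechet_derivative (\<lambda>y. \<omega> (chart_inv c y) (cf c v (chart_inv c y))) (at x)", OF S c(2)])
    show "linear (\<lambda>v. \<omega> (chart_inv c y) (cf c v (chart_inv c y)))" if "y \<in> ?S" for y
      using that c(1) by (intro form_coord_linear[OF \<omega>]) auto
    show "((\<lambda>y. \<omega> (chart_inv c y) (cf c v (chart_inv c y))) has_derivative
         frechet_derivative (\<lambda>y. \<omega> (chart_inv c y) (cf c v (chart_inv c y))) (at x)) (at x)" for v
      using \<omega> c by (intro smooth_on_has_derivative[of ?S]) (auto simp: smooth_form_def)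
    show "(\<xi> Y has_derivative frechet_derivative (\<xi> Y) (at x)) (at x)"
      by (rule smooth_on_has_derivative[OF \<xi> c(2)])
  qed
  then have "(((\<lambda>q. \<omega> q (Y q)) \<circ> chart_inv c) has_derivative
    (\<lambda>u. frechet_derivative (\<lambda>y. \<omega> (chart_inv c y) (cf c (\<xi> Y x) (chart_inv c y))) (at x) u
     + \<omega> ?p (cf c (frechet_derivative (\<xi> Y) (at x) u) ?p))) (at x)"
    by (rule has_derivative_transform_within_open[OF _ S c(2)]) (use c(1) in \<open>auto simp: \<xi>_def coord_field_tm\<close>)
  from frechet_derivative_at[OF this, symmetric]
  show ?thesis
    using tm_in_chart[OF smooth_form_apply[OF \<omega> Y] c(1), of ?p "X ?p"] c
    unfolding deriv_along_def \<xi>_def by simp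
qed

text \<open>The invariant criterion X(\<omega>(Y)) - Y(\<omega>(X)) = \<omega>([X, Y]). The bracket
  enters as the vector \<open>Z\<close> whose image under \<open>tm f\<close> is the commutator of
  the derivatives of \<open>f\<close>. Fields through arbitrary vectors suffice, because d\<omega>
  at a point depends only on their values there.\<close>

lemma closed_formI:
  fixes \<omega> :: "'m \<Rightarrow> 'a \<Rightarrow> 'c::real_normed_vector" and f :: "'m \<Rightarrow> 'd::euclidean_space"
  assumes \<omega>: "smooth_form \<omega>" and f: "smooth_map \<A> f" "\<And>p. inj (tm f p)"
    and span: "\<And>p u. \<exists>X. smooth_field \<A> X \<and> X p = u"
    and closed: "\<And>X Y Z p. smooth_field \<A> X \<Longrightarrow> smooth_field \<A> Y \<Longrightarrow>
      tm f p Z = deriv_along \<A> X (deriv_along \<A> Y f) p - deriv_along \<A> Y (deriv_along \<A> X f) p \<Longrightarrow>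
      deriv_along \<A> X (\<lambda>q. \<omega> q (Y q)) p - deriv_along \<A> Y (\<lambda>q. \<omega> q (X q)) p = \<omega> p Z"
  shows "closed_form \<omega>"
  unfolding closed_form_def
proof (intro conjI ballI allI)
  fix c x v w assume c: "c \<in> \<A>" and x: "x \<in> snd c ` fst c"
  let ?S = "snd c ` fst c" and ?p = "chart_inv c x"
  note S = chart_open_image[OF c]
  obtain X where X: "smooth_field \<A> X" "X ?p = cf c v ?p" using span by blast
  obtain Y where Y: "smooth_field \<A> Y" "Y ?p = cf c w ?p" using span by blast
  define \<xi> where "\<xi> Z y = tm (snd c) (chart_inv c y) (Z (chart_inv c y))" for Z y
  have \<xi>: "\<xi> X x = v" "\<xi> Y x = w" unfolding \<xi>_def X Y using c x by (auto simp: tm_coord_field)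
  \<comment> \<open>The components of the bracket of \<open>X\<close> and \<open>Y\<close> in the
    chart \<open>c\<close>.\<close>
  let ?z = "frechet_derivative (\<xi> Y) (at x) v - frechet_derivative (\<xi> X) (at x) w"
  let ?D = "\<lambda>k. frechet_derivative k (at x)"
  have form: "deriv_along \<A> X (\<lambda>q. \<theta> q (Y q)) ?p - deriv_along \<A> Y (\<lambda>q. \<theta> q (X q)) ?p =
     ?D (\<lambda>y. \<theta> (chart_inv c y) (cf c w (chart_inv c y))) v - ?D (\<lambda>y. \<theta> (chart_inv c y) (cf c v (chart_inv c y))) w
     + \<theta> ?p (cf c ?z ?p)"
    if \<theta>: "smooth_form \<theta>" for \<theta> :: "'m \<Rightarrow> 'a \<Rightarrow> 'e::real_normed_vector"
  proof -
    have "linear (\<lambda>v. \<theta> ?p (cf c v ?p))" using c x by (intro form_coord_linear[OF \<theta>]) auto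
    from linear_diff[OF this] show ?thesis
      using form_along_has_derivative[OF \<theta> X(1) Y(1) c x] form_along_has_derivative[OF \<theta> Y(1) X(1) c x] \<xi>
      unfolding \<xi>_def[abs_def] by simp
  qed
  have F: "smooth_on ?S (f \<circ> chart_inv c)" using f c unfolding smooth_map_def by blast
  have fD: "?D (\<lambda>y. tm f (chart_inv c y) (cf c w (chart_inv c y))) v = ?D (\<lambda>y. frechet_derivative (f \<circ> chart_inv c) (at y) w) v" for v w
  proof -
    have "(\<lambda>y. frechet_derivative (f \<circ> chart_inv c) (at y) w) differentiable (at x)"
      by (rule smooth_on_differentiable[OF smooth_on_frechet[OF F] x])
    then have "?D (\<lambda>y. frechet_derivative (f \<circ> chart_inv c) (at y) w) = ?D (\<lambda>y. tm f (chart_inv c y) (cf c w (chart_inv c y)))"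
      by (rule frechet_derivative_transform_within_open[OF _ S x]) (simp add: tm_coord_in_chart[OF f(1) c])
    then show ?thesis by simp
  qed
  \<comment> \<open>For the form \<open>tm f\<close> the coefficient terms cancel by symmetry of
    second derivatives, so what is left identifies \<open>?z\<close> as the bracket in the sense of
    \<open>closed\<close>.\<close>
  have "tm f ?p (cf c ?z ?p) = deriv_along \<A> X (deriv_along \<A> Y f) ?p - deriv_along \<A> Y (deriv_along \<A> X f) ?p"
    using form[OF smooth_form_tm[OF f(1)]] frechet_derivative_commute[OF S x F, of w v]
    unfolding deriv_along_def[abs_def] fD by simp
  from closed[OF X(1) Y(1) this] form[OF \<omega>]
  show "?D (\<lambda>y. \<omega> (chart_inv c y) (cf c v (chart_inv c y))) w = ?D (\<lambda>y. \<omega> (chart_inv c y) (cf c w (chart_inv c y))) v"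
    by simp
qed (rule \<omega>)

lemma smooth_form_sum: "(\<And>i. i \<in> I \<Longrightarrow> smooth_form (\<omega> i)) \<Longrightarrow> smooth_form (\<lambda>p u. \<Sum>i\<in>I. \<omega> i p u)"
  unfolding smooth_form_def by (intro conjI allI ballI linear_compose_sum smooth_on_sum chart_open_image) auto

text \<open>The Leibniz rule for a field of linear maps that is known to be smooth only on constant
  vectors.\<close>

lemma linear_family_apply:
  fixes D :: "'m \<Rightarrow> 'e::euclidean_space \<Rightarrow> 'c::real_normed_vector"
  assumes lin: "\<And>q. linear (D q)" and D: "\<And>y. smooth_map \<A> (\<lambda>q. D q y)" and h: "smooth_map \<A> h"
  shows "smooth_map \<A> (\<lambda>q. D q (h q))"
    and "tm (\<lambda>q. D q (h q)) p x = tm (\<lambda>q. D q (h p)) p x + D p (tm h p x)"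
proof -
  have expand: "D q y = (\<Sum>u\<in>Basis. (y \<bullet> u) *\<^sub>R D q u)" for q y
    by (rule linear_expansion[OF lin])
  have hu: "smooth_map \<A> (\<lambda>q. h q \<bullet> u)" for u by (intro smooth_map_intros h)
  have "smooth_map \<A> (\<lambda>q. \<Sum>u\<in>Basis. (h q \<bullet> u) *\<^sub>R D q u)"
    by (intro smooth_map_intros hu D)
  then show "smooth_map \<A> (\<lambda>q. D q (h q))" unfolding expand[symmetric] .
  have thu: "tm (\<lambda>q. h q \<bullet> u) p x = tm h p x \<bullet> u" for u
    by (rule tm_compose_linear[OF bounded_linear_inner_left h])
  have "tm (\<lambda>q. D q (h q)) p x = tm (\<lambda>q. \<Sum>u\<in>Basis. (h q \<bullet> u) *\<^sub>R D q u) p x"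
    unfolding expand[symmetric] ..
  also have "\<dots> = (\<Sum>u\<in>Basis. (h p \<bullet> u) *\<^sub>R tm (\<lambda>q. D q u) p x) + D p (tm h p x)"
    by (subst (2) expand)
      (simp add: tm_sum[OF smooth_map_scaleR[OF hu D]] tm_scaleR[OF hu D] thu sum.distrib)
  also have "(\<Sum>u\<in>Basis. (h p \<bullet> u) *\<^sub>R tm (\<lambda>q. D q u) p x) = tm (\<lambda>q. \<Sum>u\<in>Basis. (h p \<bullet> u) *\<^sub>R D q u) p x"
    by (simp add: tm_sum[OF smooth_map_scaleR[OF smooth_map_const D]] tm_scaleR[OF smooth_map_const D] tm_const)
  also have "\<dots> = tm (\<lambda>q. D q (h p)) p x" unfolding expand[symmetric] ..
  finally show "tm (\<lambda>q. D q (h q)) p x = tm (\<lambda>q. D q (h p)) p x + D p (tm h p x)" .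
qed

lemma constant_if_tm_zero:
  fixes h :: "'m \<Rightarrow> 'c::real_normed_vector"
  assumes "simply_connected (UNIV :: 'm set)" "smooth_map \<A> h" "\<And>q u. tm h q u = 0"
  shows "h q = h p"
proof (rule zero_derivative_constant[OF simply_connected_imp_connected_manifold[OF assms(1)]])
  have "tm h q = (\<lambda>u. 0)" for q using assms(3) by blast
  then show "has_diff h q (\<lambda>u. 0)" for q using smooth_map_has_diff[OF assms(2), of q] by simp
qed

end

lemma linear_sum_scaleR:
  fixes h :: "'v::real_vector \<Rightarrow> 'i \<Rightarrow> real" and e :: "'i \<Rightarrow> 'w::real_vector"
  assumes "\<And>b. linear (\<lambda>z. h z b)"
  shows "linear (\<lambda>z. \<Sum>b\<in>I. h z b *\<^sub>R e b)"
  by (rule linearI)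
    (simp_all add: linear_add[OF assms] linear_scale[OF assms] scaleR_add_left sum.distrib scaleR_sum_right)

section \<open>Duality between one-forms and fields\<close>

locale riemannian_manifold = manifold \<A>
  for \<A> :: "('m::{t2_space,second_countable_topology}, 'a::euclidean_space) chart set" +
  fixes g :: "'m \<Rightarrow> 'a \<Rightarrow> 'a \<Rightarrow> real"
  assumes metric: "riemannian_metric \<A> g"
begin

lemma g_bilinear: "bilinear (g p)" and g_sym: "g p u v = g p v u" and g_pos: "u \<noteq> 0 \<Longrightarrow> g p u u > 0"
  using metric unfolding riemannian_metric_def by blast+

lemma g_linear: "linear (g p u)" "linear (\<lambda>u. g p u v)"
  using g_bilinear[of p] unfolding bilinear_def by auto

lemmas g_add = linear_add[OF g_linear(1)] linear_add[OF g_linear(2)]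
lemmas g_diff = linear_diff[OF g_linear(1)] linear_diff[OF g_linear(2)]
lemmas g_scale = linear_scale[OF g_linear(1)] linear_scale[OF g_linear(2)]

lemma g_eqI: "(\<And>v. g p u v = g p u' v) \<Longrightarrow> u = u'"
  using g_pos[of "u - u'" p] g_diff by (metis eq_iff_diff_eq_0 less_irrefl)

text \<open>The Gram operator \<open>G\<close> is injective because the metric is positive, hence
  surjective.\<close>

lemma sharp_exists:
  assumes "linear \<nu>"
  shows "\<exists>z. \<forall>u. g p z u = \<nu> u"
proof -
  define G where "G z = (\<Sum>b\<in>Basis. g p z b *\<^sub>R b)" for z
  have lin: "linear G"
    unfolding G_def by (rule linear_sum_scaleR) (rule g_linear)
  have G: "G z \<bullet> b = g p z b" if "b \<in> Basis" for z b unfolding G_def using that by simp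
  have ext: "\<nu>' u = \<nu>'' u" if "linear \<nu>'" "linear \<nu>''" "\<And>b. b \<in> Basis \<Longrightarrow> \<nu>' b = \<nu>'' b" for \<nu>' \<nu>'' :: "'a \<Rightarrow> real" and u
    using linear_eq_stdbasis[OF that(1,2)] that(3) by metis
  have "inj G"
  proof (rule injI)
    fix z z' assume "G z = G z'"
    then have "g p z b = g p z' b" if "b \<in> Basis" for b using G that by metis
    then show "z = z'" using ext[OF g_linear(1) g_linear(1)] by (intro g_eqI) blast
  qed
  then have "surj G" using linear_injective_imp_surjective lin by blast
  then obtain z where z: "G z = (\<Sum>b\<in>Basis. \<nu> b *\<^sub>R b)" by (metis surjD)
  have "g p z b = \<nu> b" if "b \<in> Basis" for b
    using G[OF that, of z] that unfolding z by simp
  then show ?thesis using ext[OF g_linear(1) assms] by blast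
qed

text \<open>In a chart, the components of \<open>Z\<close> solve a linear system with the smooth
  Gram matrix of the metric, and \<open>smooth_on_solution\<close> applies.\<close>

lemma smooth_field_sharp:
  assumes \<nu>: "smooth_form \<nu>" and Z: "\<And>p u. g p (Z p) u = \<nu> p u"
  shows "smooth_field \<A> Z"
  unfolding smooth_field_def o_def
proof
  fix c assume c: "c \<in> \<A>"
  let ?S = "snd c ` fst c" and ?i = "chart_inv c"
  note S = chart_open_image[OF c]
  define G where "G x z = (\<Sum>b\<in>Basis. g (?i x) (cf c z (?i x)) (cf c b (?i x)) *\<^sub>R b)" for x z
  have G: "G x z \<bullet> b = g (?i x) (cf c z (?i x)) (cf c b (?i x))" if "b \<in> Basis" for x z b
    unfolding G_def using that by simp
  show "smooth_on ?S (\<lambda>x. tm (snd c) (?i x) (Z (?i x)))"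
  proof (rule smooth_on_solution[where G = G and r = "\<lambda>x. \<Sum>b\<in>Basis. \<nu> (?i x) (cf c b (?i x)) *\<^sub>R b", OF S])
    fix x assume x: "x \<in> ?S"
    have lc: "linear (\<lambda>v. cf c v (?i x))" using c x by (intro coord_field_linear) auto
    have "linear (\<lambda>z. g (?i x) (cf c z (?i x)) (cf c b (?i x)))" for b
      using linear_compose[OF lc g_linear(2)] by (simp add: o_def)
    then show "linear (G x)"
      unfolding G_def by (rule linear_sum_scaleR)
    show "inj (G x)"
    proof (rule injI)
      fix z z' assume eq: "G x z = G x z'"
      have "g (?i x) (cf c z (?i x)) (cf c b (?i x)) = g (?i x) (cf c z' (?i x)) (cf c b (?i x))" if "b \<in> Basis" for b
        using G[OF that] eq by metis
      then have *: "g (?i x) (cf c z (?i x)) (cf c v (?i x)) = g (?i x) (cf c z' (?i x)) (cf c v (?i x))" for v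
        using linear_eq_stdbasis[OF linear_compose[OF lc g_linear(1)] linear_compose[OF lc g_linear(1)]]
        unfolding o_def by metis
      have p: "?i x \<in> fst c" using c x by simp
      have "cf c z (?i x) = cf c z' (?i x)"
      proof (rule g_eqI)
        show "g (?i x) (cf c z (?i x)) u = g (?i x) (cf c z' (?i x)) u" for u
          using *[of "tm (snd c) (?i x) u"] unfolding coord_field_tm[OF c p] .
      qed
      then have "tm (snd c) (?i x) (cf c z (?i x)) = tm (snd c) (?i x) (cf c z' (?i x))" by simp
      then show "z = z'" unfolding tm_coord_field[OF c p] .
    qed
    have "cf c (tm (snd c) (?i x) (Z (?i x))) (?i x) = Z (?i x)"
      using c x by (intro coord_field_tm) auto
    then show "G x (tm (snd c) (?i x) (Z (?i x))) = (\<Sum>b\<in>Basis. \<nu> (?i x) (cf c b (?i x)) *\<^sub>R b)"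
      unfolding G_def by (simp only: Z)
  next
    fix v
    have gs: "smooth_on ?S (\<lambda>x. g (?i x) (cf c v (?i x)) (cf c b (?i x)))" for b
      using metric[unfolded riemannian_metric_def, THEN conjunct2, rule_format, OF c] by (simp only: o_def)
    show "smooth_on ?S (\<lambda>x. G x v)"
      unfolding G_def
      by (intro smooth_on_sum S smooth_on_bilinear[OF S bounded_bilinear_scaleR] smooth_on_const gs)
    have \<nu>s: "smooth_on ?S (\<lambda>x. \<nu> (?i x) (cf c b (?i x)))" for b
      using \<nu>[unfolded smooth_form_def, THEN conjunct2, rule_format, OF c] .
    show "smooth_on ?S (\<lambda>x. \<Sum>b\<in>Basis. \<nu> (?i x) (cf c b (?i x)) *\<^sub>R b)"
      by (intro smooth_on_sum S smooth_on_bilinear[OF S bounded_bilinear_scaleR] smooth_on_const \<nu>s)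
  qed
qed

lemma sharp_field:
  assumes "smooth_form \<nu>"
  obtains Z where "smooth_field \<A> Z" "\<And>p u. g p (Z p) u = \<nu> p u"
proof -
  have "\<forall>p. \<exists>z. \<forall>u. g p z u = \<nu> p u"
    by (intro allI sharp_exists form_linear assms)
  then obtain Z where "\<forall>p u. g p (Z p) u = \<nu> p u" by metis
  then have Z: "\<And>p u. g p (Z p) u = \<nu> p u" by blast
  then show thesis using that[OF smooth_field_sharp[OF assms Z] Z] by blast
qed

lemma gradient:
  assumes "smooth_map \<A> \<rho>"
  shows "g p (gradient \<A> g \<rho> p) u = tm \<rho> p u" and "smooth_field \<A> (gradient \<A> g \<rho>)"
proof -
  show *: "g p (gradient \<A> g \<rho> p) u = tm \<rho> p u" for p u
  proof -
    obtain z where z: "\<forall>u. g p z u = tm \<rho> p u" using sharp_exists[OF tm_linear[OF assms]] by blast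
    have "\<forall>v. g p (gradient \<A> g \<rho> p) v = tm \<rho> p v"
      unfolding gradient_def by (rule theI[of _ z]) (use z in \<open>auto intro!: g_eqI[of p]\<close>)
    then show ?thesis by blast
  qed
  show "smooth_field \<A> (gradient \<A> g \<rho>)"
    by (rule smooth_field_sharp[OF smooth_form_tm[OF assms] *])
qed

end

section \<open>Hypersurfaces\<close>

text \<open>Alternating the two symmetries three times cycles the arguments back to their original
  places with the opposite sign.\<close>

lemma sym_skew_zero:
  fixes S :: "'x \<Rightarrow> 'x \<Rightarrow> 'x \<Rightarrow> real"
  assumes sym: "\<And>x y z. P x \<Longrightarrow> P y \<Longrightarrow> P z \<Longrightarrow> S x y z = S y x z"
    and skew: "\<And>x y z. P x \<Longrightarrow> P y \<Longrightarrow> P z \<Longrightarrow> S x y z = - S x z y"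
    and P: "P x" "P y" "P z"
  shows "S x y z = 0"
  using sym[of x y z] sym[of y z x] sym[of z x y] skew[of x y z] skew[of y z x] skew[of z x y] P by linarith

locale hypersurface = riemannian_manifold \<A> g
  for \<A> :: "('m::{t2_space,second_countable_topology}, 'a::euclidean_space) chart set"
    and g :: "'m \<Rightarrow> 'a \<Rightarrow> 'a \<Rightarrow> real" +
  fixes nabla :: "('m \<Rightarrow> 'a) \<Rightarrow> ('m \<Rightarrow> 'a) \<Rightarrow> 'm \<Rightarrow> 'a"
    and f N :: "'m \<Rightarrow> 'b::euclidean_space"
    and A :: "'m \<Rightarrow> 'a \<Rightarrow> 'a"
  assumes codim: "DIM('b) = DIM('a) + 1"
    and levi_civita: "levi_civita \<A> g nabla"
    and immersion: "isometric_immersion \<A> g f"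
    and gauss_map: "gauss_map \<A> f N"
    and shape: "shape_operator \<A> g nabla f N A"
begin

abbreviation "df \<equiv> tm f"
abbreviation "field \<equiv> smooth_field \<A>"

lemma f_smooth: "smooth_map \<A> f" and df_inj: "inj (df p)" and df_inner: "df p u \<bullet> df p v = g p u v"
  using immersion unfolding isometric_immersion_def by auto

lemma N_smooth: "smooth_map \<A> N" and N_norm: "N p \<bullet> N p = 1" and df_N: "df p u \<bullet> N p = 0" and N_df: "N p \<bullet> df p u = 0"
  using gauss_map unfolding gauss_map_def by (auto simp: inner_commute power2_norm_eq_inner[symmetric])

lemma df_linear: "linear (df p)"
  by (rule tm_linear[OF f_smooth])

lemmas df_add = linear_add[OF df_linear]
lemmas df_diff = linear_diff[OF df_linear]
lemmas df_scale = linear_scale[OF df_linear]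
lemmas df_zero = linear_0[OF df_linear]

lemma nabla_metric: "field X \<Longrightarrow> field Y \<Longrightarrow> field Z \<Longrightarrow>
    tm (\<lambda>q. g q (Y q) (Z q)) p (X p) = g p (nabla X Y p) (Z p) + g p (Y p) (nabla X Z p)"
  using levi_civita[unfolded levi_civita_def deriv_along_def[abs_def], THEN conjunct2, THEN conjunct2, THEN conjunct2,
      THEN conjunct2, THEN conjunct2, THEN conjunct1] by simp

lemma nabla_torsion: "field X \<Longrightarrow> field Y \<Longrightarrow> smooth_map \<A> (h :: 'm \<Rightarrow> real) \<Longrightarrow>
    tm h p (nabla X Y p) - tm h p (nabla Y X p) = tm (\<lambda>q. tm h q (Y q)) p (X p) - tm (\<lambda>q. tm h q (X q)) p (Y p)"
  using levi_civita[unfolded levi_civita_def deriv_along_def[abs_def], THEN conjunct2, THEN conjunct2, THEN conjunct2,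
      THEN conjunct2, THEN conjunct2, THEN conjunct2] by simp

text \<open>Codimension one: the tangent space and the unit normal, which is orthogonal to it, have
  enough dimensions to span the ambient space.\<close>

lemma orthogonal_to_all_zero:
  assumes "\<And>u. y \<bullet> df p u = 0" "y \<bullet> N p = 0"
  shows "y = 0"
proof -
  let ?R = "range (df p)"
  have "dim ?R = DIM('a)"
    using dim_image_eq[OF df_linear[of p], of UNIV] df_inj[of p] by (simp add: inj_on_subset)
  moreover have "N p \<notin> span ?R"
  proof
    assume "N p \<in> span ?R"
    then have "orthogonal (N p) (N p)"
      by (rule orthogonal_to_span) (auto simp: orthogonal_def N_df)
    then show False using N_norm[of p] by (simp add: orthogonal_def)
  qed
  ultimately have "dim (insert (N p) ?R) = DIM('b)" by (simp add: dim_insert codim)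
  then have "y \<in> span (insert (N p) ?R)" by (simp add: dim_eq_full)
  then have "orthogonal y y"
    by (rule orthogonal_to_span) (auto simp: orthogonal_def assms)
  then show ?thesis by (simp add: orthogonal_def)
qed

lemma vector_eqI:
  assumes "\<And>u. y \<bullet> df p u = y' \<bullet> df p u" "y \<bullet> N p = y' \<bullet> N p"
  shows "y = y'"
  using orthogonal_to_all_zero[of "y - y'" p] assms by (simp add: inner_diff_left)

lemma decompose: "\<exists>z. y = df p z + (y \<bullet> N p) *\<^sub>R N p"
proof -
  have "linear (\<lambda>u. y \<bullet> df p u)"
    by (rule linearI) (simp_all add: df_add df_scale inner_add_right)
  then obtain z where z: "\<And>u. g p z u = y \<bullet> df p u" using sharp_exists by metis
  have "y = df p z + (y \<bullet> N p) *\<^sub>R N p"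
    by (rule vector_eqI[of _ p]) (simp_all add: inner_add_left df_inner z N_df df_N N_norm)
  then show ?thesis ..
qed

lemma smooth_form_inner_df: "smooth_map \<A> h \<Longrightarrow> smooth_form (\<lambda>p u. h p \<bullet> df p u)"
  by (rule smooth_form_bilinear[OF bounded_bilinear_inner _ smooth_form_tm[OF f_smooth]])

lemma field_through: "\<exists>X. field X \<and> X p = u"
proof -
  \<comment> \<open>The tangential part of the constant vector \<open>df p u\<close>, which at
    \<open>p\<close> is \<open>u\<close> itself.\<close>
  obtain X where X: "field X" "\<And>q v. g q (X q) v = df p u \<bullet> df q v"
    using sharp_field[OF smooth_form_inner_df[OF smooth_map_const]] by metis
  have "X p = u" by (rule g_eqI[of p]) (simp add: X df_inner)
  then show ?thesis using X(1) by blast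
qed

lemma field_df: "field X \<Longrightarrow> smooth_map \<A> (\<lambda>q. df q (X q))"
  by (rule smooth_form_apply[OF smooth_form_tm[OF f_smooth]])

lemma field_tm: "field X \<Longrightarrow> smooth_map \<A> h \<Longrightarrow> smooth_map \<A> (\<lambda>q. tm h q (X q))"
  by (rule smooth_form_apply[OF smooth_form_tm])

lemma torsion_free:
  fixes h :: "'m \<Rightarrow> 'e::euclidean_space"
  assumes X: "field X" "field Y" and h: "smooth_map \<A> h"
  shows "tm (\<lambda>q. tm h q (Y q)) p (X p) - tm (\<lambda>q. tm h q (X q)) p (Y p) = tm h p (nabla X Y p - nabla Y X p)"
proof (rule euclidean_eqI)
  fix b :: 'e
  note bl = bounded_linear_inner_left[of b]
  have hb: "smooth_map \<A> (\<lambda>q. h q \<bullet> b)" by (rule smooth_map_linear[OF bl h])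
  have 1: "tm (\<lambda>q. k q \<bullet> b) q u = tm k q u \<bullet> b" if "smooth_map \<A> k" for k :: "'m \<Rightarrow> 'e" and q u
    by (rule tm_compose_linear[OF bl that])
  have "tm (\<lambda>q. h q \<bullet> b) p (nabla X Y p) - tm (\<lambda>q. h q \<bullet> b) p (nabla Y X p) =
     tm (\<lambda>q. tm (\<lambda>q. h q \<bullet> b) q (Y q)) p (X p) - tm (\<lambda>q. tm (\<lambda>q. h q \<bullet> b) q (X q)) p (Y p)"
    by (rule nabla_torsion[OF X hb])
  then show "(tm (\<lambda>q. tm h q (Y q)) p (X p) - tm (\<lambda>q. tm h q (X q)) p (Y p)) \<bullet> b = tm h p (nabla X Y p - nabla Y X p) \<bullet> b"
    by (simp add: 1[OF h] 1[OF field_tm[OF _ h]] X inner_diff_left linear_diff[OF tm_linear[OF h]])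
qed

text \<open>The tangential part of the Euclidean derivative is a connection without torsion that is
  compatible with the metric, hence equal to \<open>nabla\<close>.\<close>

lemma gauss_formula:
  assumes "field X" "field Y"
  shows "tm (\<lambda>q. df q (Y q)) p (X p) = df p (nabla X Y p) + g p (A p (X p)) (Y p) *\<^sub>R N p"
proof -
  define \<alpha> where "\<alpha> X Y = tm (\<lambda>q. df q (Y q)) p (X p) - df p (nabla X Y p)" for X Y
  have sym: "\<alpha> X Y = \<alpha> Y X" if "field X" "field Y" for X Y
    using torsion_free[OF that f_smooth, of p] unfolding \<alpha>_def df_diff by (simp add: algebra_simps)
  have skew: "\<alpha> X Y \<bullet> df p (Z p) = - (\<alpha> X Z \<bullet> df p (Y p))" if "field X" "field Y" "field Z" for X Y Z
  proof -
    show ?thesis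
      using nabla_metric[OF that, of p]
      unfolding df_inner[symmetric] tm_inner[OF field_df[OF that(2)] field_df[OF that(3)]] \<alpha>_def
      by (simp add: inner_diff_left inner_diff_right inner_commute)
  qed
  have tangential: "\<alpha> X Y \<bullet> df p (Z p) = 0" if Z: "field Z" for Z
  proof (rule sym_skew_zero[where S = "\<lambda>X Y Z. \<alpha> X Y \<bullet> df p (Z p)" and P = field])
    show "\<alpha> X Y \<bullet> df p (Z p) = \<alpha> Y X \<bullet> df p (Z p)" if "field X" "field Y" "field Z" for X Y Z
      using sym[OF that(1,2)] by simp
    show "\<alpha> X Y \<bullet> df p (Z p) = - (\<alpha> X Z \<bullet> df p (Y p))" if "field X" "field Y" "field Z" for X Y Z
      by (rule skew[OF that])
  qed (rule assms Z)+
  have normal: "\<alpha> X Y \<bullet> N p = g p (A p (X p)) (Y p)"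
    using shape assms unfolding shape_operator_def second_ff_def \<alpha>_def deriv_along_def[abs_def] by simp
  have "\<alpha> X Y = g p (A p (X p)) (Y p) *\<^sub>R N p"
  proof (rule vector_eqI[of _ p])
    fix u
    obtain Z where "field Z" "Z p = u" using field_through by blast
    then show "\<alpha> X Y \<bullet> df p u = (g p (A p (X p)) (Y p) *\<^sub>R N p) \<bullet> df p u"
      using tangential by (auto simp: N_df)
  qed (simp add: normal N_norm)
  then show ?thesis unfolding \<alpha>_def by (simp add: algebra_simps)
qed

text \<open>The commutator of the derivatives of \<open>f\<close> along two fields is tangential, so
  the normal parts in the Gauss formula agree.\<close>

lemma A_sym: "g p (A p u) v = g p (A p v) u"
proof -
  obtain X where X: "field X" "X p = u" using field_through by blast
  obtain Y where Y: "field Y" "Y p = v" using field_through by blast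
  have "(g p (A p u) v - g p (A p v) u) *\<^sub>R N p = 0"
    using torsion_free[OF X(1) Y(1) f_smooth, of p] gauss_formula[OF X(1) Y(1), of p] gauss_formula[OF Y(1) X(1), of p] X Y
    by (simp add: df_diff scaleR_diff_left)
  moreover have "N p \<noteq> 0" using N_norm[of p] by auto
  ultimately show ?thesis by simp
qed

text \<open>Obtained by differentiating N \<bullet> df Y = 0 and N \<bullet> N = 1.\<close>

lemma weingarten_formula: "tm N p u = - df p (A p u)"
proof (rule vector_eqI[of _ p])
  fix v
  obtain X where X: "field X" "X p = u" using field_through by blast
  obtain Y where Y: "field Y" "Y p = v" using field_through by blast
  have "tm (\<lambda>q. N q \<bullet> df q (Y q)) p u = 0" by (simp add: N_df tm_const)
  then have "N p \<bullet> tm (\<lambda>q. df q (Y q)) p u + tm N p u \<bullet> df p v = 0"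
    unfolding tm_inner[OF N_smooth field_df[OF Y(1)]] Y(2) .
  moreover have "N p \<bullet> tm (\<lambda>q. df q (Y q)) p u = g p (A p u) v"
    using gauss_formula[OF X(1) Y(1), of p] X Y by (simp add: inner_add_right N_df N_norm)
  ultimately show "tm N p u \<bullet> df p v = (- df p (A p u)) \<bullet> df p v" by (simp add: df_inner)
next
  have "tm (\<lambda>q. N q \<bullet> N q) p u = 0" by (simp add: N_norm tm_const)
  then show "tm N p u \<bullet> N p = (- df p (A p u)) \<bullet> N p"
    by (simp add: tm_inner[OF N_smooth N_smooth] df_N N_df inner_commute)
qed

text \<open>Since the torsion vanishes and \<open>df\<close> is injective, the bracket is
  \<open>nabla X Y - nabla Y X\<close>.\<close>

lemma closed_formI_nabla:
  fixes \<omega> :: "'m \<Rightarrow> 'a \<Rightarrow> 'c::real_normed_vector"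
  assumes \<omega>: "smooth_form \<omega>"
    and "\<And>X Y p. field X \<Longrightarrow> field Y \<Longrightarrow>
      tm (\<lambda>q. \<omega> q (Y q)) p (X p) - tm (\<lambda>q. \<omega> q (X q)) p (Y p) = \<omega> p (nabla X Y p - nabla Y X p)"
  shows "closed_form \<omega>"
proof (rule closed_formI[OF \<omega> f_smooth df_inj field_through])
  fix X Y Z p assume X: "field X" "field Y"
    and Z: "df p Z = deriv_along \<A> X (deriv_along \<A> Y f) p - deriv_along \<A> Y (deriv_along \<A> X f) p"
  have "df p Z = df p (nabla X Y p - nabla Y X p)"
    using Z torsion_free[OF X f_smooth, of p] unfolding deriv_along_def[abs_def] by simp
  then have "Z = nabla X Y p - nabla Y X p" using df_inj injD by metis
  then show "deriv_along \<A> X (\<lambda>q. \<omega> q (Y q)) p - deriv_along \<A> Y (\<lambda>q. \<omega> q (X q)) p = \<omega> p Z"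
    using assms(2)[OF X] unfolding deriv_along_def by simp
qed

text \<open>\<open>W u a b\<close> is \<open>(a \<and> b) u\<close> in the ambient space.\<close>

definition W :: "'b \<Rightarrow> 'b \<Rightarrow> 'b \<Rightarrow> 'b" where
  "W u a b = (b \<bullet> u) *\<^sub>R a - (a \<bullet> u) *\<^sub>R b"

lemma W_simps:
  "W u (a + a') b = W u a b + W u a' b" "W u a (b + b') = W u a b + W u a b'"
  "W u (a - a') b = W u a b - W u a' b" "W u a (b - b') = W u a b - W u a b'"
  "W u (k *\<^sub>R a) b = k *\<^sub>R W u a b" "W u a (k *\<^sub>R b) = k *\<^sub>R W u a b"
  "W u (- a) b = - W u a b" "W u a (- b) = - W u a b" "W u a a = 0" "W u 0 b = 0" "W u a 0 = 0"
  by (simp_all add: W_def inner_add_left inner_diff_left algebra_simps)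

lemma W_swap: "W u a b = - W u b a"
  by (simp add: W_def)

lemma W_skew: "W u a b \<bullet> v = - (W v a b \<bullet> u)"
  by (simp add: W_def inner_diff_left mult.commute)

lemma W_linear: "linear (\<lambda>u. W u a b)"
  by (rule linearI) (simp_all add: W_def inner_add_right algebra_simps)

lemma W_bilinear: "bounded_bilinear (W u)"
  unfolding bilinear_conv_bounded_bilinear[symmetric] bilinear_def
  by (auto intro!: linearI simp: W_simps)

text \<open>A bivector of tangent vectors ignores the normal part of its argument. This carries the
  intrinsic Gauss-type equation into the ambient space.\<close>

lemma W_tangential: "W (df p z + k *\<^sub>R N p) (df p a) (df p b) = df p (wedge (g p) a b z)"
  by (simp add: W_def wedge_def inner_add_right df_inner df_N df_diff df_scale)

lemma smooth_form_W_left: "smooth_map \<A> h \<Longrightarrow> smooth_form \<omega> \<Longrightarrow> smooth_form (\<lambda>p x. W u (\<omega> p x) (h p))"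
  by (rule smooth_form_bilinear[OF bounded_bilinear.flip[OF W_bilinear]])

lemma smooth_form_W_right: "smooth_map \<A> h \<Longrightarrow> smooth_form \<omega> \<Longrightarrow> smooth_form (\<lambda>p x. W u (h p) (\<omega> p x))"
  by (rule smooth_form_bilinear[OF W_bilinear])

lemmas tm_W = tm_bilinear[OF W_bilinear]
lemmas smooth_map_W = smooth_map_bilinear[OF W_bilinear]

section \<open>Uniqueness\<close>

text \<open>With \<open>a\<close> the derivative of \<open>V\<close>, the assumption is the
  closedness of X \<and> V. In an orthonormal tangent basis it makes \<open>a\<close> diagonal with
  pairwise opposite entries, and three pairwise opposite numbers vanish.\<close>

lemma wedge_symmetric_zero:
  assumes dim: "DIM('a) \<ge> 3" and a: "linear a"
    and eq: "\<And>x z y. W y (df p z) (a x) = W y (df p x) (a z)"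
  shows "a x = 0"
proof -
  \<comment> \<open>Test the identity on orthonormal triples; this is where dimension three is needed.\<close>
  let ?R = "range (df p)"
  obtain i where i: "linear i" "\<And>u. i (df p u) = u"
    using linear_injective_left_inverse[OF df_linear df_inj, of p] by (metis comp_apply id_apply)
  \<comment> \<open>\<open>a\<close> transported to the image of \<open>df p\<close>, where the
    ambient inner product provides orthonormal bases.\<close>
  define b where "b = a \<circ> i"
  have b: "linear b" unfolding b_def by (rule linear_compose[OF i(1) a])
  have beq: "W y e' (b e) = W y e (b e')" if "e \<in> ?R" "e' \<in> ?R" for e e' y
    using that eq by (auto simp: b_def i)
  have "subspace ?R" by (rule linear_subspace_image[OF df_linear subspace_UNIV])
  then have "\<exists>E\<subseteq>?R. pairwise orthogonal E \<and> (\<forall>e\<in>E. norm e = 1) \<and> card E = dim ?R \<and> span E = ?R"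
    by (rule orthonormal_basis_subspace) blast
  then obtain E where E: "E \<subseteq> ?R" "pairwise orthogonal E" "\<And>e. e \<in> E \<Longrightarrow> norm e = 1"
    "card E = dim ?R" "span E = ?R"
    by blast
  have "dim ?R = DIM('a)"
    using dim_image_eq[OF df_linear[of p], of UNIV] df_inj[of p] by (simp add: inj_on_subset)
  then have card: "card E \<ge> 3" using E(4) dim by simp
  have ee: "e \<bullet> e = 1" if "e \<in> E" for e using E(3)[OF that] by (simp add: norm_eq_1)
  have orth: "e \<bullet> e' = 0" if "e \<in> E" "e' \<in> E" "e \<noteq> e'" for e e'
    using E(2) that unfolding pairwise_def orthogonal_def by blast
  \<comment> \<open>Evaluating both bivectors on \<open>e'\<close> confines \<open>b e\<close> to
    the plane of \<open>e\<close> and \<open>e'\<close>; in particular it has no normal part.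
    Varying \<open>e'\<close> removes the off-diagonal entries.\<close>
  have expr: "b e = (b e \<bullet> e') *\<^sub>R e' - (b e' \<bullet> e') *\<^sub>R e" if e: "e \<in> E" "e' \<in> E" "e \<noteq> e'" for e e'
  proof -
    have "W e' e' (b e) = W e' e (b e')" using e E(1) by (intro beq) auto
    then show ?thesis using ee[OF e(2)] orth[OF e] by (simp add: W_def algebra_simps)
  qed
  have third: "\<exists>e3\<in>E. e3 \<noteq> e1 \<and> e3 \<noteq> e2" for e1 e2
  proof (rule ccontr)
    assume "\<not> ?thesis"
    then have "E \<subseteq> {e1, e2}" by blast
    then have "card E \<le> card {e1, e2}" by (intro card_mono) auto
    also have "\<dots> \<le> 2" by (simp add: card_insert_if)
    finally show False using card by simp
  qed
  have off: "b e1 \<bullet> e2 = 0" if e: "e1 \<in> E" "e2 \<in> E" "e1 \<noteq> e2" for e1 e2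
  proof -
    obtain e3 where e3: "e3 \<in> E" "e3 \<noteq> e1" "e3 \<noteq> e2" using third by blast
    have "b e1 \<bullet> e2 = ((b e1 \<bullet> e3) *\<^sub>R e3 - (b e3 \<bullet> e3) *\<^sub>R e1) \<bullet> e2"
      by (rule arg_cong[where f = "\<lambda>v. v \<bullet> e2"], rule expr) (use e e3 in auto)
    also have "\<dots> = 0" using orth e e3 by (simp add: inner_diff_left)
    finally show ?thesis .
  qed
  have diag: "b e1 \<bullet> e1 = - (b e2 \<bullet> e2)" if e: "e1 \<in> E" "e2 \<in> E" "e1 \<noteq> e2" for e1 e2
  proof -
    have "b e1 \<bullet> e1 = ((b e1 \<bullet> e2) *\<^sub>R e2 - (b e2 \<bullet> e2) *\<^sub>R e1) \<bullet> e1"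
      by (rule arg_cong[where f = "\<lambda>v. v \<bullet> e1"], rule expr) (use e in auto)
    also have "\<dots> = - (b e2 \<bullet> e2)" using ee[OF e(1)] off[OF e] by (simp add: inner_diff_left)
    finally show ?thesis .
  qed
  have "b e = 0" if e: "e \<in> E" for e
  proof -
    obtain e2 where e2: "e2 \<in> E" "e2 \<noteq> e" using third[of e e] by blast
    obtain e3 where e3: "e3 \<in> E" "e3 \<noteq> e" "e3 \<noteq> e2" using third by blast
    have "b e \<bullet> e = - (b e2 \<bullet> e2)" "b e \<bullet> e = - (b e3 \<bullet> e3)" "b e2 \<bullet> e2 = - (b e3 \<bullet> e3)"
      by (rule diag; use e e2 e3 in blast)+
    then have "b e2 \<bullet> e2 = 0" by linarith
    moreover have "b e = (b e \<bullet> e2) *\<^sub>R e2 - (b e2 \<bullet> e2) *\<^sub>R e" by (rule expr) (use e e2 in auto)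
    moreover have "b e \<bullet> e2 = 0" by (rule off) (use e e2 in auto)
    ultimately show ?thesis by (metis diff_self scaleR_zero_left)
  qed
  moreover have "df p x \<in> span E" unfolding E(5) by blast
  ultimately have "b (df p x) = 0" using linear_eq_0_on_span[OF b] by blast
  then show ?thesis by (simp add: b_def i)
qed

lemma umbilical_bending_trivial:
  fixes T :: "'m \<Rightarrow> 'b"
  assumes dim: "DIM('a) \<ge> 3" and sc: "simply_connected (UNIV :: 'm set)"
    and T: "smooth_map \<A> T" and \<sigma>: "smooth_map \<A> \<sigma>" and \<phi>: "smooth_map \<A> \<phi>"
    and conf: "\<And>p x y. tm T p x \<bullet> df p y + df p x \<bullet> tm T p y = 2 * \<sigma> p * g p x y"
    and tensor: "\<And>X Y p. field X \<Longrightarrow> field Y \<Longrightarrow>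
      (tm (\<lambda>q. tm T q (Y q) - \<sigma> q *\<^sub>R df q (Y q)) p (X p) - (tm T p (nabla X Y p) - \<sigma> p *\<^sub>R df p (nabla X Y p))) \<bullet> N p
        = \<phi> p * g p (X p) (Y p)"
  shows "\<exists>l v w D. linear D \<and> (\<forall>x y. D x \<bullet> y = - (x \<bullet> D y)) \<and>
    (\<forall>x. T x = (f x \<bullet> v + l) *\<^sub>R f x - (1/2 * (norm (f x))\<^sup>2) *\<^sub>R v + D (f x) + w)"
proof -
  define L where "L p x = tm T p x - \<sigma> p *\<^sub>R df p x" for p x
  have L_alt: "L p x = tm T p x + (- \<sigma> p) *\<^sub>R df p x" for p x by (simp add: L_def)
  have Ls: "smooth_form L"
    unfolding L_alt[abs_def]
    by (intro smooth_form_add smooth_form_bilinear[OF bounded_bilinear_scaleR] smooth_form_tm smooth_map_minus T \<sigma> f_smooth)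
  note Llin = form_linear[OF Ls]
  have L_skew: "L p x \<bullet> df p y = - (L p y \<bullet> df p x)" for p x y
    using conf[of p x y] by (simp add: L_def inner_diff_left inner_diff_right df_inner inner_commute g_sym[of p y x])
  have "smooth_form (\<lambda>q x. N q \<bullet> L q x)"
    by (rule smooth_form_bilinear[OF bounded_bilinear_inner N_smooth Ls])
  \<comment> \<open>\<open>Z\<close> is dual to the normal part of \<open>L\<close>. Skewness of the
    extension forces it to send the normal to \<open>- df p (Z p)\<close>.\<close>
  then obtain Z where Z: "field Z" "\<And>p x. g p (Z p) x = N p \<bullet> L p x" by (rule sharp_field) blast
  \<comment> \<open>\<open>E y\<close> is the tangential part of the constant vector
    \<open>y\<close>.\<close>
  have "\<exists>E. field E \<and> (\<forall>p x. g p (E p) x = y \<bullet> df p x)" for y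
    using sharp_field[OF smooth_form_inner_df[OF smooth_map_const[of y]]] by metis
  then obtain E where E: "\<And>y. field (E y)" "\<And>y p x. g p (E y p) x = y \<bullet> df p x" by metis
  have E_lin: "linear (\<lambda>y. E y p)" for p
    by (rule linearI; rule g_eqI[of p]) (simp_all add: E g_add g_scale inner_add_left)
  have E_df: "E (df p z + k *\<^sub>R N p) p = z" for p z k
    by (rule g_eqI[of p]) (simp add: E inner_add_left df_inner N_df)

  define D where "D q y = L q (E y q) - (y \<bullet> N q) *\<^sub>R df q (Z q)" for q y
  have Dlin: "linear (D q)" for q
    unfolding D_def
    by (rule linearI) (simp_all add: linear_add[OF E_lin] linear_scale[OF E_lin] linear_add[OF Llin] linear_scale[OF Llin]
        inner_add_left algebra_simps)
  have Ds: "smooth_map \<A> (\<lambda>q. D q y)" for y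
    unfolding D_def
    by (intro smooth_map_intros smooth_form_apply[OF Ls E(1)] field_df[OF Z(1)] N_smooth)
  note fam = linear_family_apply[OF Dlin Ds]
  have D_val: "D p (df p z + k *\<^sub>R N p) = L p z - k *\<^sub>R df p (Z p)" for p z k
    unfolding D_def E_df by (simp add: inner_add_left df_N N_norm)
  have D_df: "D p (df p z) = L p z" for p z using D_val[of p z 0] by simp
  have D_skew: "D p y \<bullet> y' = - (y \<bullet> D p y')" for p y y'
  proof -
    obtain z where z: "y = df p z + (y \<bullet> N p) *\<^sub>R N p" using decompose by blast
    obtain z' where z': "y' = df p z' + (y' \<bullet> N p) *\<^sub>R N p" using decompose by blast
    have "D p (df p z + k *\<^sub>R N p) \<bullet> (df p z' + k' *\<^sub>R N p) = - ((df p z + k *\<^sub>R N p) \<bullet> D p (df p z' + k' *\<^sub>R N p))" for k k'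
      unfolding D_val using L_skew[of p z z'] Z(2)[of p z] Z(2)[of p z']
      by (simp add: inner_diff_left inner_diff_right inner_add_left inner_add_right df_inner df_N N_df inner_commute g_sym[of p _ "Z p"] algebra_simps)
    from this[of "y \<bullet> N p" "y' \<bullet> N p"] show ?thesis unfolding z[symmetric] z'[symmetric] .
  qed
  define \<Omega> where "\<Omega> p x y = tm (\<lambda>q. D q y) p x" for p x y
  have \<Omega>_skew: "\<Omega> p x y \<bullet> y' = - (\<Omega> p x y' \<bullet> y)" for p x y y'
  proof -
    have "tm (\<lambda>q. D q y \<bullet> y') p x = \<Omega> p x y \<bullet> y'" for y y'
      unfolding \<Omega>_def by (rule tm_compose_linear[OF bounded_linear_inner_left Ds])
    moreover have "D q y \<bullet> y' + D q y' \<bullet> y = 0" for q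
      using D_skew[of q y y'] by (simp add: inner_commute)
    then have "tm (\<lambda>q. D q y \<bullet> y' + D q y' \<bullet> y) p x = 0"
      by (simp only: tm_const)
    ultimately show ?thesis
      using tm_add[OF smooth_map_inner[OF Ds smooth_map_const] smooth_map_inner[OF Ds smooth_map_const], of y y' y' y p x]
      by simp
  qed
  have tm_L: "tm (\<lambda>q. L q (Y q)) p x = \<Omega> p x (df p (Y p)) + D p (tm (\<lambda>q. df q (Y q)) p x)" if "field Y" for Y p x
    using fam(2)[OF field_df[OF that], of p x] by (simp add: D_df \<Omega>_def)
  \<comment> \<open>The second fundamental form contributes a multiple of \<open>D p (N p)\<close>,
    which by skewness is orthogonal to the normal, so only the tensor remains.\<close>
  have \<Omega>_normal: "\<Omega> p x (df p y) \<bullet> N p = \<phi> p * g p x y" for p x y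
  proof -
    obtain X where X: "field X" "X p = x" using field_through by blast
    obtain Y where Y: "field Y" "Y p = y" using field_through by blast
    have "D p (N p) \<bullet> N p = 0" using D_skew[of p "N p" "N p"] by (simp add: inner_commute)
    then show ?thesis
      using tensor[OF X(1) Y(1), of p] tm_L[OF Y(1), of p "X p"] gauss_formula[OF X(1) Y(1), of p] X Y
      unfolding L_def[symmetric]
      by (simp add: linear_add[OF Dlin] linear_scale[OF Dlin] D_df inner_add_left inner_diff_left)
  qed
  \<comment> \<open>Second derivatives of \<open>T\<close> and \<open>f\<close> commute up to the
    bracket, so in the exterior derivative of \<open>L\<close> only the derivative of
    \<open>\<sigma>\<close> survives.\<close>
  have \<Omega>_sym: "\<Omega> p x (df p y) - \<Omega> p y (df p x) = tm \<sigma> p y *\<^sub>R df p x - tm \<sigma> p x *\<^sub>R df p y" for p x y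
  proof -
    obtain X where X: "field X" "X p = x" using field_through by blast
    obtain Y where Y: "field Y" "Y p = y" using field_through by blast
    have t: "tm (\<lambda>q. L q (Y q)) p x = tm (\<lambda>q. tm T q (Y q)) p x - (\<sigma> p *\<^sub>R tm (\<lambda>q. df q (Y q)) p x + tm \<sigma> p x *\<^sub>R df p (Y p))" if "field Y" for Y x
      unfolding L_def
      by (simp add: tm_diff[OF field_tm[OF that T] smooth_map_scaleR[OF \<sigma> field_df[OF that]]] tm_scaleR[OF \<sigma> field_df[OF that]])
    let ?br = "nabla X Y p - nabla Y X p"
    have "tm (\<lambda>q. L q (Y q)) p x - tm (\<lambda>q. L q (X q)) p y = L p ?br - tm \<sigma> p x *\<^sub>R df p y + tm \<sigma> p y *\<^sub>R df p x"
      using torsion_free[OF X(1) Y(1) T, of p] torsion_free[OF X(1) Y(1) f_smooth, of p] X Y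
      unfolding t[OF X(1)] t[OF Y(1)] L_def[of p] by (simp add: algebra_simps)
    moreover have "tm (\<lambda>q. L q (Y q)) p x - tm (\<lambda>q. L q (X q)) p y = \<Omega> p x (df p y) - \<Omega> p y (df p x) + L p ?br"
      using torsion_free[OF X(1) Y(1) f_smooth, of p] X Y
      unfolding tm_L[OF X(1)] tm_L[OF Y(1)] D_df[of p ?br, symmetric] by (simp add: linear_diff[OF Dlin, symmetric])
    ultimately show ?thesis by (simp add: algebra_simps)
  qed
  define V where "V q = df q (gradient \<A> g \<sigma> q) - \<phi> q *\<^sub>R N q" for q
  have V_df: "V p \<bullet> df p x = tm \<sigma> p x" for p x
    unfolding V_def using gradient(1)[OF \<sigma>] by (simp add: inner_diff_left df_inner N_df)
  have V_N: "V p \<bullet> N p = - \<phi> p" for p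
    unfolding V_def by (simp add: inner_diff_left df_N N_norm)
  have Vs: "smooth_map \<A> V"
    unfolding V_def by (intro smooth_map_intros field_df gradient(2) \<sigma> \<phi> N_smooth)
  \<comment> \<open>The deviation from the expected X \<and> V. On tangent vectors it is symmetric
    and has no normal part, and its values are skew; \<open>sym_skew_zero\<close> then kills it on
    them.\<close>
  define \<Theta> where "\<Theta> p x y = \<Omega> p x y - W y (df p x) (V p)" for p x y
  have \<Theta>_skew: "\<Theta> p x y \<bullet> y' = - (\<Theta> p x y' \<bullet> y)" for p x y y'
    unfolding \<Theta>_def using \<Omega>_skew[of p x y y'] W_skew[of y _ _ y'] by (simp add: inner_diff_left)
  have \<Theta>_normal: "\<Theta> p x (df p y) \<bullet> N p = 0" for p x y
    unfolding \<Theta>_def W_def by (simp add: inner_diff_left \<Omega>_normal V_N df_N df_inner)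
  have \<Theta>_sym: "\<Theta> p x (df p y) = \<Theta> p y (df p x)" for p x y
    using \<Omega>_sym[of p x y] unfolding \<Theta>_def W_def by (simp add: V_df df_inner g_sym[of p y x] algebra_simps)
  have \<Theta>_df: "\<Theta> p x (df p y) = 0" for p x y
  proof (rule vector_eqI[of _ p])
    have "\<Theta> p x (df p y) \<bullet> df p z = 0" for z
    proof (rule sym_skew_zero[where S = "\<lambda>x y z. \<Theta> p x (df p y) \<bullet> df p z" and P = "\<lambda>x. True"])
      show "\<Theta> p x (df p y) \<bullet> df p z = \<Theta> p y (df p x) \<bullet> df p z" for x y z
        by (rule arg_cong[where f = "\<lambda>v. v \<bullet> df p z", OF \<Theta>_sym])
      show "\<Theta> p x (df p y) \<bullet> df p z = - (\<Theta> p x (df p z) \<bullet> df p y)" for x y z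
        by (rule \<Theta>_skew)
    qed (rule TrueI)+
    then show "\<Theta> p x (df p y) \<bullet> df p z = 0 \<bullet> df p z" for z by simp
  qed (simp add: \<Theta>_normal)
  \<comment> \<open>A skew endomorphism that vanishes on the tangent space sends the normal to a
    vector orthogonal to everything.\<close>
  have \<Theta>_0: "\<Theta> p x y = 0" for p x y
  proof (rule vector_eqI[of _ p])
    show "\<Theta> p x y \<bullet> df p z = 0 \<bullet> df p z" for z using \<Theta>_skew[of p x y "df p z"] by (simp add: \<Theta>_df)
    have "\<Theta> p x (N p) = 0"
    proof (rule vector_eqI[of _ p])
      show "\<Theta> p x (N p) \<bullet> df p z = 0 \<bullet> df p z" for z using \<Theta>_skew[of p x "N p" "df p z"] by (simp add: \<Theta>_df)
      show "\<Theta> p x (N p) \<bullet> N p = 0 \<bullet> N p" using \<Theta>_skew[of p x "N p" "N p"] by simp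
    qed
    then show "\<Theta> p x y \<bullet> N p = 0 \<bullet> N p" using \<Theta>_skew[of p x y "N p"] by simp
  qed
  have tm_D: "tm (\<lambda>q. D q y) p x = W y (df p x) (V p)" for y p x
    using \<Theta>_0[of p x y] by (simp add: \<Theta>_def \<Omega>_def)
  have "tm V p x = 0" for p x
  \<comment> \<open>The form X \<and> V is a differential, that of \<open>D\<close> on a constant
    vector, so it is closed. The bracket terms match, leaving the symmetry that
    \<open>wedge_symmetric_zero\<close> needs.\<close>
  proof (rule wedge_symmetric_zero[OF dim tm_linear[OF Vs]])
    fix x z y
    obtain X where X: "field X" "X p = x" using field_through by blast
    obtain Y where Y: "field Y" "Y p = z" using field_through by blast
    have "tm (\<lambda>q. W y (df q (Y q)) (V q)) p x - tm (\<lambda>q. W y (df q (X q)) (V q)) p z =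
       W y (df p (nabla X Y p - nabla Y X p)) (V p)"
      using torsion_free[OF X(1) Y(1) Ds, of y p] X Y unfolding tm_D by simp
    then show "W y (df p z) (tm V p x) = W y (df p x) (tm V p z)"
      using torsion_free[OF X(1) Y(1) f_smooth, of p, symmetric] X Y
      unfolding tm_W[OF field_df[OF X(1)] Vs] tm_W[OF field_df[OF Y(1)] Vs]
      by (simp add: W_simps)
  qed
  then have V_const: "V q = V p" for q p by (rule constant_if_tm_zero[OF sc Vs])
  fix p\<^sub>0 :: 'm
  define v where "v = V p\<^sub>0"
  have V: "V q = v" for q unfolding v_def by (rule V_const)
  have fv: "smooth_map \<A> (\<lambda>q. f q \<bullet> v)" by (intro smooth_map_intros f_smooth)
  have tfv: "tm (\<lambda>q. f q \<bullet> v) q x = df q x \<bullet> v" for q x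
    by (rule tm_compose_linear[OF bounded_linear_inner_left f_smooth])
  define l where "l = \<sigma> p\<^sub>0 - f p\<^sub>0 \<bullet> v"
  have "\<sigma> q - f q \<bullet> v = l" for q
    unfolding l_def
  proof (rule constant_if_tm_zero[OF sc])
    show "smooth_map \<A> (\<lambda>q. \<sigma> q - f q \<bullet> v)" by (intro smooth_map_diff \<sigma> fv)
    show "tm (\<lambda>q. \<sigma> q - f q \<bullet> v) q x = 0" for q x
      unfolding tm_diff[OF \<sigma> fv] tfv using V_df[of q x] by (simp add: V inner_commute)
  qed
  then have \<sigma>_eq: "\<sigma> q = f q \<bullet> v + l" for q by (metis add.commute diff_add_cancel)
  define D\<^sub>0 where "D\<^sub>0 y = D p\<^sub>0 y - W y (f p\<^sub>0) v" for y
  have "D q y - W y (f q) v = D\<^sub>0 y" for q y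
    unfolding D\<^sub>0_def
  proof (rule constant_if_tm_zero[OF sc])
    show "smooth_map \<A> (\<lambda>q. D q y - W y (f q) v)"
      by (intro smooth_map_diff Ds smooth_map_W f_smooth smooth_map_const)
    show "tm (\<lambda>q. D q y - W y (f q) v) q x = 0" for q x
      by (simp add: tm_diff[OF Ds smooth_map_W[OF f_smooth smooth_map_const]] tm_W[OF f_smooth smooth_map_const] tm_const tm_D V W_simps)
  qed
  then have D_eq: "D q y = W y (f q) v + D\<^sub>0 y" for q y by (metis add.commute diff_add_cancel)
  have D\<^sub>0_lin: "linear D\<^sub>0"
    unfolding D\<^sub>0_def by (intro linear_compose_sub Dlin W_linear)
  have D\<^sub>0_skew: "D\<^sub>0 x \<bullet> y = - (x \<bullet> D\<^sub>0 y)" for x y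
    unfolding D\<^sub>0_def using D_skew[of p\<^sub>0 x y] W_skew[of x "f p\<^sub>0" v y]
    by (simp add: inner_diff_left inner_diff_right inner_commute)
  have D\<^sub>0_bl: "bounded_linear D\<^sub>0" using D\<^sub>0_lin linear_conv_bounded_linear by blast
  \<comment> \<open>The conformal Killing field without its translation. Its differential is
    \<open>D q (df q x) + \<sigma> q *\<^sub>R df q x\<close>, that is, the one of \<open>T\<close>;
    the translation \<open>w\<close> is the remaining constant.\<close>
  define K where "K q = (f q \<bullet> v + l) *\<^sub>R f q - (1/2 * (f q \<bullet> f q)) *\<^sub>R v + D\<^sub>0 (f q)" for q
  note s1 = smooth_map_add[OF fv smooth_map_const[of l]]
  note s2 = smooth_map_scaleR[OF s1 f_smooth]
  note s3 = smooth_map_linear[OF bounded_linear_mult_right[of "1/2"] smooth_map_inner[OF f_smooth f_smooth]]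
  note s4 = smooth_map_scaleR[OF s3 smooth_map_const[of v]]
  note s5 = smooth_map_linear[OF D\<^sub>0_bl f_smooth]
  have Ks: "smooth_map \<A> K"
    unfolding K_def by (intro smooth_map_add smooth_map_diff s2 s4 s5)
  have tm_K: "tm K q x = tm T q x" for q x
  proof -
    have "tm K q x = (f q \<bullet> v + l) *\<^sub>R df q x + (df q x \<bullet> v) *\<^sub>R f q - (f q \<bullet> df q x) *\<^sub>R v + D\<^sub>0 (df q x)"
      unfolding K_def tm_add[OF smooth_map_diff[OF s2 s4] s5] tm_diff[OF s2 s4] tm_scaleR[OF s1 f_smooth]
        tm_add[OF fv smooth_map_const] tm_scaleR[OF s3 smooth_map_const] tfv tm_const
        tm_compose_linear[OF D\<^sub>0_bl f_smooth]
        tm_compose_linear[OF bounded_linear_mult_right smooth_map_inner[OF f_smooth f_smooth]]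
        tm_inner[OF f_smooth f_smooth]
      by (simp add: inner_commute)
    also have "\<dots> = D q (df q x) + \<sigma> q *\<^sub>R df q x"
      by (simp add: D_eq \<sigma>_eq W_def inner_commute)
    also have "\<dots> = tm T q x" by (simp add: D_df L_def)
    finally show ?thesis .
  qed
  define w where "w = T p\<^sub>0 - K p\<^sub>0"
  have "T q - K q = w" for q
    unfolding w_def
    by (rule constant_if_tm_zero[OF sc smooth_map_diff[OF T Ks]]) (simp add: tm_diff[OF T Ks] tm_K)
  then have "T q = K q + w" for q by (metis add.commute diff_add_cancel)
  then have "T q = (f q \<bullet> v + l) *\<^sub>R f q - (1/2 * (norm (f q))\<^sup>2) *\<^sub>R v + D\<^sub>0 (f q) + w" for q
    by (simp add: K_def power2_norm_eq_inner)
  then show ?thesis using D\<^sub>0_lin D\<^sub>0_skew by blast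
qed

lemma conformal_bending_pointwise:
  assumes "conformal_bending \<A> g f \<rho> T"
  shows "tm T p x \<bullet> df p y + df p x \<bullet> tm T p y = 2 * \<rho> p * g p x y"
proof -
  obtain X where X: "field X" "X p = x" using field_through by blast
  obtain Y where Y: "field Y" "Y p = y" using field_through by blast
  show ?thesis
    using assms X Y unfolding conformal_bending_def deriv_along_def by metis
qed

text \<open>Everything is linear in the bending and its factor, so \<open>B\<close> cancels in the
  difference and a multiple of the identity is left.\<close>

lemma bending_unique:
  assumes dim: "DIM('a) \<ge> 3" and sc: "simply_connected (UNIV :: 'm set)"
    and "bending_with_tensor \<A> g nabla f N B T\<^sub>1" "bending_with_tensor \<A> g nabla f N B T\<^sub>2"
  shows "trivial_bending \<A> g f (\<lambda>p. T\<^sub>1 p - T\<^sub>2 p)"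
proof -
  obtain \<rho>1 B1 \<phi>1 where 1: "conformal_bending \<A> g f \<rho>1 T\<^sub>1" "associated_tensor \<A> g nabla f N \<rho>1 T\<^sub>1 B1"
    "smooth_map \<A> \<phi>1" "\<And>p v. B1 p v = B p v + \<phi>1 p *\<^sub>R v"
    using assms(3) unfolding bending_with_tensor_def by blast
  obtain \<rho>2 B2 \<phi>2 where 2: "conformal_bending \<A> g f \<rho>2 T\<^sub>2" "associated_tensor \<A> g nabla f N \<rho>2 T\<^sub>2 B2"
    "smooth_map \<A> \<phi>2" "\<And>p v. B2 p v = B p v + \<phi>2 p *\<^sub>R v"
    using assms(4) unfolding bending_with_tensor_def by blast
  have s: "smooth_map \<A> \<rho>1" "smooth_map \<A> T\<^sub>1" "smooth_map \<A> \<rho>2" "smooth_map \<A> T\<^sub>2"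
    using 1(1) 2(1) unfolding conformal_bending_def by auto
  define T where "T p = T\<^sub>1 p - T\<^sub>2 p" for p
  define \<sigma> where "\<sigma> p = \<rho>1 p - \<rho>2 p" for p
  define \<phi> where "\<phi> p = \<phi>1 p - \<phi>2 p" for p
  have Ts: "smooth_map \<A> T" and \<sigma>s: "smooth_map \<A> \<sigma>" and \<phi>s: "smooth_map \<A> \<phi>"
    unfolding T_def \<sigma>_def \<phi>_def by (intro smooth_map_diff s 1 2)+
  have tmT: "tm T p x = tm T\<^sub>1 p x - tm T\<^sub>2 p x" for p x
    unfolding T_def by (rule tm_diff[OF s(2,4)])
  have conf: "tm T p x \<bullet> df p y + df p x \<bullet> tm T p y = 2 * \<sigma> p * g p x y" for p x y
    using conformal_bending_pointwise[OF 1(1), of p x y] conformal_bending_pointwise[OF 2(1), of p x y]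
    by (simp add: tmT \<sigma>_def inner_diff_left inner_diff_right algebra_simps)
  have "(tm (\<lambda>q. tm T q (Y q) - \<sigma> q *\<^sub>R df q (Y q)) p (X p) - (tm T p (nabla X Y p) - \<sigma> p *\<^sub>R df p (nabla X Y p))) \<bullet> N p
        = \<phi> p * g p (X p) (Y p)" if X: "field X" and Y: "field Y" for X Y p
  proof -
    let ?L1 = "\<lambda>q. tm T\<^sub>1 q (Y q) - \<rho>1 q *\<^sub>R df q (Y q)" and ?L2 = "\<lambda>q. tm T\<^sub>2 q (Y q) - \<rho>2 q *\<^sub>R df q (Y q)"
    have L: "smooth_map \<A> ?L1" "smooth_map \<A> ?L2"
      by (intro smooth_map_diff smooth_map_scaleR field_tm field_df Y s)+
    have "(\<lambda>q. tm T q (Y q) - \<sigma> q *\<^sub>R df q (Y q)) = (\<lambda>q. ?L1 q - ?L2 q)"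
      by (simp add: tmT \<sigma>_def algebra_simps)
    then have e: "tm (\<lambda>q. tm T q (Y q) - \<sigma> q *\<^sub>R df q (Y q)) p (X p) = tm ?L1 p (X p) - tm ?L2 p (X p)"
      using tm_diff[OF L] by simp
    have "g p (B1 p (X p)) (Y p) =
        (tm ?L1 p (X p) - (tm T\<^sub>1 p (nabla X Y p) - \<rho>1 p *\<^sub>R df p (nabla X Y p))) \<bullet> N p"
      using 1(2) X Y unfolding associated_tensor_def bending_L_def[abs_def] deriv_along_def by blast
    moreover have "g p (B2 p (X p)) (Y p) =
        (tm ?L2 p (X p) - (tm T\<^sub>2 p (nabla X Y p) - \<rho>2 p *\<^sub>R df p (nabla X Y p))) \<bullet> N p"
      using 2(2) X Y unfolding associated_tensor_def bending_L_def[abs_def] deriv_along_def by blast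
    ultimately show ?thesis
      unfolding e by (simp add: 1(4) 2(4) g_add g_scale tmT \<sigma>_def \<phi>_def inner_diff_left df_N algebra_simps)
  qed
  from umbilical_bending_trivial[OF dim sc Ts \<sigma>s \<phi>s conf this]
  obtain l v w D where D: "linear D" "\<forall>x y. D x \<bullet> y = - (x \<bullet> D y)"
    "\<forall>x. T x = (f x \<bullet> v + l) *\<^sub>R f x - (1/2 * (norm (f x))\<^sup>2) *\<^sub>R v + D (f x) + w"
    by blast
  have "conformal_bending \<A> g f \<sigma> T"
    unfolding conformal_bending_def deriv_along_def using Ts \<sigma>s conf by blast
  moreover have "\<exists>U l v w D. open U \<and> p \<in> U \<and> linear D \<and> (\<forall>x y. D x \<bullet> y = - (x \<bullet> D y)) \<and>
        (\<forall>x\<in>U. T x = (f x \<bullet> v + l) *\<^sub>R f x - (1/2 * (norm (f x))\<^sup>2) *\<^sub>R v + D (f x) + w)" for p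
    \<comment> \<open>One Killing field serves on the whole manifold.\<close>
    using D by (intro exI[of _ UNIV] exI[of _ l] exI[of _ v] exI[of _ w] exI[of _ D]) auto
  ultimately have "trivial_bending \<A> g f T"
    unfolding trivial_bending_def by blast
  then show ?thesis by (simp add: T_def[abs_def])
qed

end

section \<open>Existence\<close>

locale bending_data = hypersurface \<A> g nabla f N A
  for \<A> :: "('m::{t2_space,second_countable_topology}, 'a::euclidean_space) chart set"
    and g :: "'m \<Rightarrow> 'a \<Rightarrow> 'a \<Rightarrow> real"
    and nabla :: "('m \<Rightarrow> 'a) \<Rightarrow> ('m \<Rightarrow> 'a) \<Rightarrow> 'm \<Rightarrow> 'a"
    and f N :: "'m \<Rightarrow> 'b::euclidean_space"
    and A :: "'m \<Rightarrow> 'a \<Rightarrow> 'a" +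
  fixes B :: "'m \<Rightarrow> 'a \<Rightarrow> 'a" and \<rho> :: "'m \<Rightarrow> real"
  assumes sc: "simply_connected (UNIV :: 'm set)"
    and B_endo: "smooth_endo \<A> B" and B_sym: "symmetric_endo g B"
    and \<rho>_smooth: "smooth_map \<A> \<rho>"
    and gauss: "\<And>X Y p z. smooth_field \<A> X \<Longrightarrow> smooth_field \<A> Y \<Longrightarrow>
       wedge (g p) (B p (X p)) (A p (Y p)) z - wedge (g p) (B p (Y p)) (A p (X p)) z
       + wedge (g p) (X p) (hess \<A> g nabla \<rho> Y p) z
       - wedge (g p) (Y p) (hess \<A> g nabla \<rho> X p) z = 0"
    and codazzi: "\<And>X Y p. smooth_field \<A> X \<Longrightarrow> smooth_field \<A> Y \<Longrightarrow>
       nabla_endo nabla B X Y p - nabla_endo nabla B Y X p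
       + wedge (g p) (X p) (Y p) (A p (gradient \<A> g \<rho> p)) = 0"
begin

abbreviation "grad \<equiv> gradient \<A> g \<rho>"
abbreviation "R \<equiv> \<lambda>q. df q (grad q)"
abbreviation "H \<equiv> hess \<A> g nabla \<rho>"

lemma grad_field: "field grad" and g_grad: "g p (grad p) u = tm \<rho> p u"
  using gradient[OF \<rho>_smooth] by blast+

lemma R_smooth: "smooth_map \<A> R"
  by (rule field_df[OF grad_field])

lemma B_field: "field X \<Longrightarrow> field (\<lambda>q. B q (X q))"
  by (rule smooth_field_endo[OF B_endo])

lemma B_linear: "linear (B p)"
  using B_endo unfolding smooth_endo_def by blast

text \<open>The differential, applied to the constant vector \<open>u\<close>, of the skew-symmetric endomorphism field
  that extends \<open>L\<close> to the ambient space.\<close>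

definition rot :: "'b \<Rightarrow> 'm \<Rightarrow> 'a \<Rightarrow> 'b" where
  "rot u q x = W u (df q x) (R q) + W u (N q) (df q (B q x))"

lemma rot_skew: "rot u q x \<bullet> v = - (rot v q x \<bullet> u)"
  unfolding rot_def using W_skew[of u _ _ v] by (simp add: inner_add_left)

lemma rot_linear: "linear (\<lambda>u. rot u q x)"
  unfolding rot_def by (intro linear_compose_add W_linear)

lemma smooth_form_df_B: "smooth_form (\<lambda>q x. df q (B q x))"
  by (rule smooth_form_endo[OF smooth_form_tm[OF f_smooth] B_endo])

lemma smooth_form_rot: "smooth_form (rot u)"
proof -
  have "smooth_form (\<lambda>q x. W u (df q x) (R q) + W u (N q) (df q (B q x)))"
    by (intro smooth_form_add smooth_form_W_left smooth_form_W_right R_smooth N_smooth smooth_form_df_B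
        smooth_form_tm f_smooth)
  then show ?thesis by (simp add: rot_def[abs_def])
qed

text \<open>The product rule with the Gauss and Weingarten formulas, sorted into tangential
  bivectors and bivectors containing \<open>N p\<close>. The normal part of the derivative of
  \<open>df (B Y)\<close> drops out because N \<and> N = 0.\<close>

lemma tm_rot:
  assumes X: "field X" and Y: "field Y"
  shows "tm (\<lambda>q. rot u q (Y q)) p (X p) =
    W u (df p (nabla X Y p)) (R p) + g p (A p (X p)) (Y p) *\<^sub>R W u (N p) (R p)
    + W u (df p (Y p)) (df p (H X p)) + g p (A p (X p)) (grad p) *\<^sub>R W u (df p (Y p)) (N p)
    - W u (df p (A p (X p))) (df p (B p (Y p))) + W u (N p) (df p (nabla X (\<lambda>q. B q (Y q)) p))"
proof -
  note sm = field_df[OF Y] R_smooth N_smooth field_df[OF B_field[OF Y]]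
  have "tm (\<lambda>q. rot u q (Y q)) p (X p) =
      W u (df p (Y p)) (tm R p (X p)) + W u (tm (\<lambda>q. df q (Y q)) p (X p)) (R p)
      + (W u (N p) (tm (\<lambda>q. df q (B q (Y q))) p (X p)) + W u (tm N p (X p)) (df p (B p (Y p))))"
    unfolding rot_def tm_add[OF smooth_map_W[OF sm(1,2)] smooth_map_W[OF sm(3,4)]] tm_W[OF sm(1,2)] tm_W[OF sm(3,4)] ..
  then show ?thesis
    unfolding gauss_formula[OF X Y] gauss_formula[OF X grad_field] gauss_formula[OF X B_field[OF Y]]
      weingarten_formula hess_def
    by (simp add: W_simps algebra_simps)
qed

text \<open>After antisymmetrisation the tangential bivectors outside the bracket term cancel by
  \<open>gauss\<close>, those with \<open>N p\<close> by \<open>codazzi\<close>, and the multiples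
  of N \<and> \<nabla>\<rho> by the symmetry of \<open>A\<close>.\<close>

lemma closed_form_rot: "closed_form (rot u)"
proof (rule closed_formI_nabla[OF smooth_form_rot])
  fix X Y p assume X: "field X" and Y: "field Y"
  let ?x = "df p (X p)" and ?y = "df p (Y p)" and ?N = "N p" and ?R = "R p"
  let ?rx = "g p (A p (X p)) (grad p)" and ?ry = "g p (A p (Y p)) (grad p)"
  obtain z where z: "u = df p z + (u \<bullet> N p) *\<^sub>R N p" using decompose by blast
  have Wt: "W u (df p a) (df p b) = df p (wedge (g p) a b z)" for a b
    using W_tangential[of p z "u \<bullet> N p" a b] z by simp
  have 1: "W u (df p (B p (X p))) (df p (A p (Y p))) - W u (df p (B p (Y p))) (df p (A p (X p)))
     + W u ?x (df p (H Y p)) - W u ?y (df p (H X p)) = 0"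
    unfolding Wt df_add[symmetric] df_diff[symmetric] gauss[OF X Y] by (rule df_zero)
  have "nabla X (\<lambda>q. B q (Y q)) p - nabla Y (\<lambda>q. B q (X q)) p =
     B p (nabla X Y p - nabla Y X p) - wedge (g p) (X p) (Y p) (A p (grad p))"
    using codazzi[OF X Y, of p] unfolding nabla_endo_def linear_diff[OF B_linear] by (simp add: algebra_simps)
  \<comment> \<open>Self-adjointness of \<open>A\<close> turns this into the coefficients that the
    derivative of the gradient contributes in \<open>tm_rot\<close>.\<close>
  also have "wedge (g p) (X p) (Y p) (A p (grad p)) = ?ry *\<^sub>R X p - ?rx *\<^sub>R Y p"
    unfolding wedge_def using A_sym g_sym by metis
  finally have "df p (nabla X (\<lambda>q. B q (Y q)) p) - df p (nabla Y (\<lambda>q. B q (X q)) p) =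
     df p (B p (nabla X Y p - nabla Y X p)) - (?ry *\<^sub>R ?x - ?rx *\<^sub>R ?y)"
    by (simp only: df_diff[symmetric] df_scale[symmetric])
  then have "W u ?N (df p (nabla X (\<lambda>q. B q (Y q)) p) - df p (nabla Y (\<lambda>q. B q (X q)) p)) =
     W u ?N (df p (B p (nabla X Y p - nabla Y X p)) - (?ry *\<^sub>R ?x - ?rx *\<^sub>R ?y))"
    by simp
  then have 2: "W u ?N (df p (nabla X (\<lambda>q. B q (Y q)) p)) - W u ?N (df p (nabla Y (\<lambda>q. B q (X q)) p)) =
     W u ?N (df p (B p (nabla X Y p - nabla Y X p))) - ?ry *\<^sub>R W u ?N ?x + ?rx *\<^sub>R W u ?N ?y"
    by (simp only: W_simps) simp
  \<comment> \<open>Brings all bivectors into the order used in \<open>1\<close> and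
    \<open>2\<close>.\<close>
  have 3: "W u (df p (A p v)) (df p w) = - W u (df p w) (df p (A p v))" "W u (df p v) ?N = - W u ?N (df p v)" for v w
    by (rule W_swap)+
  have 4: "W u (df p (nabla X Y p - nabla Y X p)) ?R = W u (df p (nabla X Y p)) ?R - W u (df p (nabla Y X p)) ?R"
    by (simp add: df_diff W_simps)
  show "tm (\<lambda>q. rot u q (Y q)) p (X p) - tm (\<lambda>q. rot u q (X q)) p (Y p) = rot u p (nabla X Y p - nabla Y X p)"
    unfolding tm_rot[OF X Y] tm_rot[OF Y X] rot_def[of u p] 4 A_sym[of p "Y p" "X p"] 3
    using arg_cong2[where f = "(-)", OF 2 1] by (simp add: algebra_simps)
qed

text \<open>One primitive of \<open>rot u\<close> for each constant vector \<open>u\<close>,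
  assembled over \<open>Basis\<close> so that linearity is automatic. The stated rules already
  include variable arguments.\<close>

lemma rotation_exists:
  obtains D where "\<And>q. linear (D q)" "\<And>q y y'. D q y \<bullet> y' = - (y \<bullet> D q y')"
    "\<And>h. smooth_map \<A> h \<Longrightarrow> smooth_map \<A> (\<lambda>q. D q (h q))"
    "\<And>h q x. smooth_map \<A> h \<Longrightarrow> tm (\<lambda>q. D q (h q)) q x = rot (h q) q x + D q (tm h q x)"
    "\<And>\<omega>. smooth_form \<omega> \<Longrightarrow> smooth_form (\<lambda>q x. D q (\<omega> q x))"
proof -
  fix p\<^sub>0 :: 'm
  have "\<exists>E. smooth_map \<A> E \<and> (\<forall>q x. tm E q x = rot u q x)" for u
    by (rule closed_form_primitive[OF closed_form_rot[of u] sc]) blast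
  then obtain E where E: "\<And>u. smooth_map \<A> (E u)" "\<And>u q x. tm (E u) q x = rot u q x" by metis
  \<comment> \<open>The primitives are chosen separately for each \<open>u\<close>, each up to a
    constant. Making them vanish at \<open>p\<^sub>0\<close> gives \<open>D\<close> the value 0
    there, which is skew.\<close>
  define E' where "E' u q = E u q - E u p\<^sub>0" for u q
  have E's: "smooth_map \<A> (E' u)" for u
    unfolding E'_def by (intro smooth_map_diff smooth_map_const E)
  have E't: "tm (E' u) q x = rot u q x" for u q x
    unfolding E'_def by (simp add: tm_diff[OF E(1) smooth_map_const] tm_const E)
  define D where "D q y = (\<Sum>u\<in>Basis. (y \<bullet> u) *\<^sub>R E' u q)" for q y
  have Dlin: "linear (D q)" for q
    unfolding D_def by (rule linearI) (simp_all add: inner_add_left scaleR_add_left sum.distrib scaleR_sum_right)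
  have Dc: "smooth_map \<A> (\<lambda>q. D q y)" for y
    unfolding D_def by (intro smooth_map_intros E's)
  note Ds = linear_family_apply(1)[OF Dlin Dc]
  have rot_expand: "(\<Sum>u\<in>Basis. (y \<bullet> u) *\<^sub>R rot u q x) = rot y q x" for y q x
    by (rule linear_expansion[OF rot_linear, symmetric])
  have "tm (\<lambda>q. D q y) q x = rot y q x" for y q x
    unfolding D_def
    by (simp add: tm_sum[OF smooth_map_scaleR[OF smooth_map_const E's]] tm_scaleR[OF smooth_map_const E's]
        tm_const E't rot_expand)
  then have Dt: "tm (\<lambda>q. D q (h q)) q x = rot (h q) q x + D q (tm h q x)" if "smooth_map \<A> h" for h q x
    using linear_family_apply(2)[OF Dlin Dc that] by simp
  have skew: "D q y \<bullet> y' = - (y \<bullet> D q y')" for q y y'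
  proof -
    define s where "s q = D q y \<bullet> y' + y \<bullet> D q y'" for q
    note c = Dc
    have "tm s q x = 0" for q x
    proof -
      have "tm s q x = rot y q x \<bullet> y' + y \<bullet> rot y' q x"
        unfolding s_def
        by (simp add: tm_add[OF smooth_map_inner[OF c smooth_map_const] smooth_map_inner[OF smooth_map_const c]]
            tm_inner[OF c smooth_map_const] tm_inner[OF smooth_map_const c] Dt[OF smooth_map_const]
            tm_const linear_0[OF Dlin])
      then show ?thesis using rot_skew[of y q x y'] by (simp add: inner_commute)
    qed
    moreover have "smooth_map \<A> s" unfolding s_def by (intro smooth_map_intros c)
    ultimately have "s q = s p\<^sub>0" by (intro constant_if_tm_zero[OF sc])
    also have "s p\<^sub>0 = 0" by (simp add: s_def D_def E'_def)
    finally show ?thesis by (simp add: s_def)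
  qed
  have Df: "smooth_form (\<lambda>q x. D q (\<omega> q x))" if \<omega>: "smooth_form \<omega>" for \<omega>
  proof -
    have "smooth_form (\<lambda>q x. \<omega> q x \<bullet> u)" for u
      using smooth_form_bilinear[OF bounded_bilinear_inner smooth_map_const \<omega>, of u] by (simp add: inner_commute)
    from smooth_form_bilinear[OF bounded_bilinear.flip[OF bounded_bilinear_scaleR] E's this]
    show ?thesis unfolding D_def by (intro smooth_form_sum)
  qed
  show thesis using that[OF Dlin skew Ds Dt Df] .
qed

lemma bending_exists: "\<exists>T. bending_with_tensor \<A> g nabla f N B T"
proof (rule rotation_exists)
  fix D
  assume D: "\<And>q. linear (D q)" and skew: "\<And>q y y'. D q y \<bullet> y' = - (y \<bullet> D q y')"
    and Ds: "\<And>h. smooth_map \<A> h \<Longrightarrow> smooth_map \<A> (\<lambda>q. D q (h q))"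
    and Dt: "\<And>h q x. smooth_map \<A> h \<Longrightarrow> tm (\<lambda>q. D q (h q)) q x = rot (h q) q x + D q (tm h q x)"
    and Df: "\<And>\<omega>. smooth_form \<omega> \<Longrightarrow> smooth_form (\<lambda>q x. D q (\<omega> q x))"
  have rot_df: "rot (df p y) p x = tm \<rho> p y *\<^sub>R df p x - g p x y *\<^sub>R R p + g p (B p x) y *\<^sub>R N p" for p x y
    unfolding rot_def W_def by (simp add: df_inner N_df g_grad)
  define \<tau> where "\<tau> q x = D q (df q x) + \<rho> q *\<^sub>R df q x" for q x
  have \<tau>s: "smooth_form \<tau>"
    unfolding \<tau>_def by (intro smooth_form_add Df smooth_form_bilinear[OF bounded_bilinear_scaleR] \<rho>_smooth smooth_form_tm f_smooth)
  have "closed_form \<tau>"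
  \<comment> \<open>By \<open>rot_df\<close>, antisymmetrisation leaves d\<rho>(Y) X - d\<rho>(X) Y,
    which the derivative of the factor in \<open>\<rho> q *\<^sub>R df q x\<close> cancels. The
    normal terms cancel because \<open>B\<close> is symmetric.\<close>
  proof (rule closed_formI_nabla[OF \<tau>s])
    fix X Y p assume X: "field X" and Y: "field Y"
    have t: "tm (\<lambda>q. \<tau> q (Y q)) p (X p) = rot (df p (Y p)) p (X p) + D p (tm (\<lambda>q. df q (Y q)) p (X p))
        + (\<rho> p *\<^sub>R tm (\<lambda>q. df q (Y q)) p (X p) + tm \<rho> p (X p) *\<^sub>R df p (Y p))" if "field Y" for X Y
      unfolding \<tau>_def
      by (simp add: tm_add[OF Ds[OF field_df[OF that]] smooth_map_scaleR[OF \<rho>_smooth field_df[OF that]]]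
          Dt[OF field_df[OF that]] tm_scaleR[OF \<rho>_smooth field_df[OF that]])
    have b: "g p (B p (Y p)) (X p) = g p (B p (X p)) (Y p)"
      using B_sym g_sym unfolding symmetric_endo_def by metis
    have tf: "df p (nabla X Y p - nabla Y X p) = tm (\<lambda>q. df q (Y q)) p (X p) - tm (\<lambda>q. df q (X q)) p (Y p)"
      using torsion_free[OF X Y f_smooth] by simp
    show "tm (\<lambda>q. \<tau> q (Y q)) p (X p) - tm (\<lambda>q. \<tau> q (X q)) p (Y p) = \<tau> p (nabla X Y p - nabla Y X p)"
      unfolding t[OF X] t[OF Y] \<tau>_def[of p] tf linear_diff[OF D] rot_df b g_sym[of p "Y p" "X p"]
      by (simp add: algebra_simps)
  qed
  then obtain T where T: "smooth_map \<A> T" "\<And>p x. tm T p x = \<tau> p x"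
    by (rule closed_form_primitive[OF _ sc]) blast
  have "conformal_bending \<A> g f \<rho> T"
    unfolding conformal_bending_def deriv_along_def
    using skew by (auto simp: \<rho>_smooth T \<tau>_def inner_add_left inner_add_right df_inner)
  moreover have "associated_tensor \<A> g nabla f N \<rho> T B"
    unfolding associated_tensor_def
  proof (intro conjI allI impI B_endo)
    fix X Y p assume X: "field X" and Y: "field Y"
    have L: "bending_L \<A> f \<rho> T Z = (\<lambda>q. D q (df q (Z q)))" for Z
      unfolding bending_L_def[abs_def] deriv_along_def T \<tau>_def by simp
    \<comment> \<open>Removes the contribution of the second fundamental form, so that the normal
      part is the one in \<open>rot_df\<close>, namely \<open>g p (B p x) y\<close>.\<close>
    have "D p (N p) \<bullet> N p = 0" using skew[of p "N p" "N p"] by (simp add: inner_commute)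
    then show "g p (B p (X p)) (Y p) =
        (deriv_along \<A> X (bending_L \<A> f \<rho> T Y) p - bending_L \<A> f \<rho> T (nabla X Y) p) \<bullet> N p"
      unfolding L deriv_along_def
      by (simp add: Dt[OF field_df[OF Y]] gauss_formula[OF X Y] linear_add[OF D] linear_scale[OF D] rot_df
          inner_add_left inner_diff_left df_N N_norm)
  qed
  ultimately show ?thesis
    unfolding bending_with_tensor_def
    by (intro exI[of _ T] exI[of _ \<rho>] exI[of _ B] exI[of _ "\<lambda>p. 0"]) (simp add: smooth_map_const)
qed

end

theorem corollary2:
  fixes \<A> :: "('m::{t2_space,second_countable_topology}, 'a::euclidean_space) chart set"
    and g :: "'m \<Rightarrow> 'a \<Rightarrow> 'a \<Rightarrow> real"
    and nabla :: "('m \<Rightarrow> 'a) \<Rightarrow> ('m \<Rightarrow> 'a) \<Rightarrow> 'm \<Rightarrow> 'a"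
    and f N :: "'m \<Rightarrow> 'b::euclidean_space"
    and A B :: "'m \<Rightarrow> 'a \<Rightarrow> 'a"
    and \<rho> :: "'m \<Rightarrow> real"
  assumes dim: "DIM('a) \<ge> 3" "DIM('b) = DIM('a) + 1"
    and manifold: "smooth_atlas \<A>" "simply_connected (UNIV :: 'm set)"
    and metric: "riemannian_metric \<A> g" "levi_civita \<A> g nabla"
    and immersion: "isometric_immersion \<A> g f"
    and normal: "gauss_map \<A> f N" "shape_operator \<A> g nabla f N A"
    and tensor: "smooth_endo \<A> B" "symmetric_endo g B" "\<exists>p v. B p v \<noteq> 0"
    and factor: "smooth_map \<A> \<rho>"
    and gauss: "\<And>X Y p z. smooth_field \<A> X \<Longrightarrow> smooth_field \<A> Y \<Longrightarrow>
       wedge (g p) (B p (X p)) (A p (Y p)) z - wedge (g p) (B p (Y p)) (A p (X p)) z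
       + wedge (g p) (X p) (hess \<A> g nabla \<rho> Y p) z
       - wedge (g p) (Y p) (hess \<A> g nabla \<rho> X p) z = 0"
    and codazzi: "\<And>X Y p. smooth_field \<A> X \<Longrightarrow> smooth_field \<A> Y \<Longrightarrow>
       nabla_endo nabla B X Y p - nabla_endo nabla B Y X p
       + wedge (g p) (X p) (Y p) (A p (gradient \<A> g \<rho> p)) = 0"
  shows "(\<exists>T. bending_with_tensor \<A> g nabla f N B T) \<and>
    (\<forall>T\<^sub>1 T\<^sub>2. bending_with_tensor \<A> g nabla f N B T\<^sub>1 \<and> bending_with_tensor \<A> g nabla f N B T\<^sub>2 \<longrightarrow>
       trivial_bending \<A> g f (\<lambda>p. T\<^sub>1 p - T\<^sub>2 p))"
proof -
  interpret hypersurface \<A> g nabla f N A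
    by unfold_locales (rule manifold(1) metric immersion normal dim(2))+
  interpret bending_data \<A> g nabla f N A B \<rho>
    by unfold_locales (rule manifold(2) tensor(1,2) factor gauss codazzi; assumption?)+
  show ?thesis
    using bending_exists bending_unique[OF dim(1) manifold(2)] by blast
qed

end
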